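(* Let $\Gamma$ be a non-convex-cocompact, non-elementary Kleinian group acting on $\mathbb{H}^{d}$. Then \[ \operatorname{Hdim}\big(\Lambda_{Myr} \Gamma \cap \Lambda_{sublinear}\Gamma\big) = \delta_{\Gamma}. \]
   Context: A Kleinian group is a discrete group $\Gamma$ acting properly by isometries on real hyperbolic space $\mathbb{H}^d$, with a fixed basepoint $x_0$; $[x,y]$ is the geodesic from $x$ to $y$. The limit set $\Lambda\Gamma$ is the set of accumulation points of $\Gamma x_0$ in $\mathbb{H}^d\cup\partial\mathbb{H}^d$; $\Gamma$ is non-elementary if $\#\Lambda\Gamma>2$. $\Gamma$ is convex-cocompact if there is $K>0$ such that for all $g,h\in\Gamma$ the geodesic $[gx_0,hx_0]$ is contained in the $K$-neighborhood of $\Gamma x_0$. The critical exponent $\delta_\Gamma$ is the abscissa of convergence of $\sum_{g\in\Gamma}e^{-s\,d(x_0,gx_0)}$. For $\xi\in\partial\mathbb{H}^d$ let $\gamma:[0,\infty)\to\mathbb{H}^d$ be the arc-length parametrization of the ray $[x_0,\xi)$ and $f_\xi(t)=d(\gamma(t),\Gamma x_0)$. The conical limit set is $\Lambda_c\Gamma=\{\xi:\liminf_{t\to+\infty}f_\xi(t)<+\infty\}$, and $\Lambda_{sublinear}\Gamma=\{\xi\in\Lambda_c\Gamma:\lim_{t\to+\infty}f_\xi(t)/t=0\}$. A point $\xi\in\Lambda\Gamma$ is Myrberg if the closure of the $\Gamma$-orbit of $[x_0,\xi)$ contains every geodesic connecting a pair of distinct points of $\Lambda\Gamma$. Equivalently,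 $\xi\in\Lambda\Gamma$ is Myrberg if there exists $K>0$ such that for every $g\in\Gamma$ there is $h\in\Gamma$ with $h[x_0,gx_0]$ contained in the $K$-neighborhood of $[x_0,\xi)$. $\Lambda_{Myr}\Gamma$ is the set of Myrberg limit points. $\partial\mathbb{H}^d$ carries the visual metric $d_{vis}(\xi,\eta)=\measuredangle\,\xi x_0\eta$, and $\operatorname{Hdim}$ denotes Hausdorff dimension with respect to this metric. *)

theory Defs
  imports "HOL-Analysis.Analysis" "HOL-Algebra.Group_Action"
begin

section \<open>Hyperbolic space\<close>

text \<open>
  Hyperbolic space of dimension \<open>d = DIM('a)\<close> in the Poincare ball model with curvature \<open>-1\<close>.
  The boundary at infinity is \<open>sphere 0 1\<close>, and the compactification by the boundary is
  \<open>cball 0 1\<close> with its Euclidean topology.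
\<close>

definition hyp :: "'a::euclidean_space set" where
  "hyp = ball 0 1"

definition hyp_boundary :: "'a::euclidean_space set" where
  "hyp_boundary = sphere 0 1"

definition hdist :: "'a::euclidean_space \<Rightarrow> 'a \<Rightarrow> real" where
  "hdist x y =
     arcosh (1 + 2 * (norm (x - y))\<^sup>2 / ((1 - (norm x)\<^sup>2) * (1 - (norm y)\<^sup>2)))"

definition hsetdist :: "'a::euclidean_space \<Rightarrow> 'a set \<Rightarrow> real" where
  "hsetdist x A = (INF a\<in>A. hdist x a)"

definition hnbhd :: "real \<Rightarrow> 'a::euclidean_space set \<Rightarrow> 'a set" where
  "hnbhd K A = {z \<in> hyp. \<exists>a\<in>A. hdist z a < K}"

definition geodesic_on :: "real set \<Rightarrow> (real \<Rightarrow> 'a::euclidean_space) \<Rightarrow> bool" where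
  "geodesic_on I c \<longleftrightarrow>
     (\<forall>t\<in>I. c t \<in> hyp) \<and> (\<forall>s\<in>I. \<forall>t\<in>I. hdist (c s) (c t) = \<bar>s - t\<bar>)"

definition geodesic_segment :: "'a::euclidean_space \<Rightarrow> 'a \<Rightarrow> 'a set" where
  "geodesic_segment x y =
     {c t |c t L. 0 \<le> L \<and> geodesic_on {0..L} c \<and> c 0 = x \<and> c L = y \<and> t \<in> {0..L}}"

definition geodesic_ray :: "(real \<Rightarrow> 'a::euclidean_space) \<Rightarrow> 'a \<Rightarrow> 'a \<Rightarrow> bool" where
  "geodesic_ray c x \<xi> \<longleftrightarrow> geodesic_on {0..} c \<and> c 0 = x \<and> (c \<longlongrightarrow> \<xi>) at_top"

definition geodesic_line :: "(real \<Rightarrow> 'a::euclidean_space) \<Rightarrow> 'a \<Rightarrow> 'a \<Rightarrow> bool" where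
  "geodesic_line c a b \<longleftrightarrow>
     geodesic_on UNIV c \<and> (c \<longlongrightarrow> a) at_bot \<and> (c \<longlongrightarrow> b) at_top"

text \<open>
  The arc-length parametrization of the ray from \<open>x\<close> to \<open>\<xi>\<close>. Its values on \<open>{0..}\<close> are uniquely
  determined; its values at negative arguments are arbitrary and never used below.
\<close>

definition hray :: "'a::euclidean_space \<Rightarrow> 'a \<Rightarrow> real \<Rightarrow> 'a" where
  "hray x \<xi> = (SOME c. geodesic_ray c x \<xi>)"

text \<open>
  The ball model is conformal, so the hyperbolic angle at \<open>x\<close> between two rays is the Euclidean
  angle between their initial velocities.
\<close>

definition visual_dist :: "'a::euclidean_space \<Rightarrow> 'a \<Rightarrow> 'a \<Rightarrow> real" where
  "visual_dist x \<xi> \<eta> =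
     (let u = vector_derivative (hray x \<xi>) (at 0 within {0..});
          v = vector_derivative (hray x \<eta>) (at 0 within {0..})
      in arccos ((u \<bullet> v) / (norm u * norm v)))"


section \<open>Kleinian groups\<close>

text \<open>
  The group is abstract and acts through \<open>\<phi>\<close>; the action need not be faithful.
  Discreteness of the image in the isometry group is part of properness.
\<close>

definition kleinian_group ::
  "('g, 'r) monoid_scheme \<Rightarrow> ('g \<Rightarrow> 'a::euclidean_space \<Rightarrow> 'a) \<Rightarrow> bool" where
  "kleinian_group G \<phi> \<longleftrightarrow>
     group_action G hyp \<phi> \<and>
     (\<forall>g\<in>carrier G. \<forall>x\<in>hyp. \<forall>y\<in>hyp. hdist (\<phi> g x) (\<phi> g y) = hdist x y) \<and>
     (\<forall>K. compact K \<and> K \<subseteq> hyp \<longrightarrow> finite {g \<in> carrier G. \<phi> g ` K \<inter> K \<noteq> {}})"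

definition limit_set ::
  "('g, 'r) monoid_scheme \<Rightarrow> ('g \<Rightarrow> 'a::euclidean_space \<Rightarrow> 'a) \<Rightarrow> 'a \<Rightarrow> 'a set" where
  "limit_set G \<phi> x\<^sub>0 = {z \<in> hyp \<union> hyp_boundary. z islimpt orbit G \<phi> x\<^sub>0}"

definition non_elementary ::
  "('g, 'r) monoid_scheme \<Rightarrow> ('g \<Rightarrow> 'a::euclidean_space \<Rightarrow> 'a) \<Rightarrow> 'a \<Rightarrow> bool" where
  "non_elementary G \<phi> x\<^sub>0 \<longleftrightarrow>
     infinite (limit_set G \<phi> x\<^sub>0) \<or> card (limit_set G \<phi> x\<^sub>0) > 2"

definition convex_cocompact ::
  "('g, 'r) monoid_scheme \<Rightarrow> ('g \<Rightarrow> 'a::euclidean_space \<Rightarrow> 'a) \<Rightarrow> 'a \<Rightarrow> bool" where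
  "convex_cocompact G \<phi> x\<^sub>0 \<longleftrightarrow>
     (\<exists>K>0. \<forall>g\<in>carrier G. \<forall>h\<in>carrier G.
        geodesic_segment (\<phi> g x\<^sub>0) (\<phi> h x\<^sub>0) \<subseteq> hnbhd K (orbit G \<phi> x\<^sub>0))"

definition critical_exponent ::
  "('g, 'r) monoid_scheme \<Rightarrow> ('g \<Rightarrow> 'a::euclidean_space \<Rightarrow> 'a) \<Rightarrow> 'a \<Rightarrow> ereal" where
  "critical_exponent G \<phi> x\<^sub>0 =
     Inf {ereal s |s. (\<lambda>g. exp (- s * hdist x\<^sub>0 (\<phi> g x\<^sub>0))) summable_on carrier G}"

definition ray_orbit_dist ::
  "('g, 'r) monoid_scheme \<Rightarrow> ('g \<Rightarrow> 'a::euclidean_space \<Rightarrow> 'a) \<Rightarrow> 'a \<Rightarrow> 'a \<Rightarrow> real \<Rightarrow> real" where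
  "ray_orbit_dist G \<phi> x\<^sub>0 \<xi> t = hsetdist (hray x\<^sub>0 \<xi> t) (orbit G \<phi> x\<^sub>0)"

definition conical_limit_set ::
  "('g, 'r) monoid_scheme \<Rightarrow> ('g \<Rightarrow> 'a::euclidean_space \<Rightarrow> 'a) \<Rightarrow> 'a \<Rightarrow> 'a set" where
  "conical_limit_set G \<phi> x\<^sub>0 =
     {\<xi> \<in> hyp_boundary. Liminf at_top (\<lambda>t. ereal (ray_orbit_dist G \<phi> x\<^sub>0 \<xi> t)) < \<infinity>}"

definition sublinear_limit_set ::
  "('g, 'r) monoid_scheme \<Rightarrow> ('g \<Rightarrow> 'a::euclidean_space \<Rightarrow> 'a) \<Rightarrow> 'a \<Rightarrow> 'a set" where
  "sublinear_limit_set G \<phi> x\<^sub>0 =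
     {\<xi> \<in> conical_limit_set G \<phi> x\<^sub>0. ((\<lambda>t. ray_orbit_dist G \<phi> x\<^sub>0 \<xi> t / t) \<longlongrightarrow> 0) at_top}"

text \<open>
  The closure of the orbit of a ray is taken in the space of geodesics, i.e. for uniform
  convergence on compact sets after a shift of the arc-length parameter: a line \<open>c\<close> lies in the
  closure if every bounded piece of \<open>c\<close> is approximated by a piece of a translate of the ray.
  A closure of the union of the translates as a point set in hyperbolic space would be a
  weaker condition, because it forgets directions.
\<close>

definition in_ray_orbit_closure ::
  "('g, 'r) monoid_scheme \<Rightarrow> ('g \<Rightarrow> 'a::euclidean_space \<Rightarrow> 'a) \<Rightarrow> 'a \<Rightarrow> 'a \<Rightarrow> (real \<Rightarrow> 'a) \<Rightarrow> bool"
where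
  "in_ray_orbit_closure G \<phi> x\<^sub>0 \<xi> c \<longleftrightarrow>
     (\<forall>R>0. \<forall>\<epsilon>>0. \<exists>g\<in>carrier G. \<exists>T\<ge>R. \<forall>t\<in>{-R..R}. hdist (\<phi> g (hray x\<^sub>0 \<xi> (T + t))) (c t) < \<epsilon>)"

definition myrberg_limit_set ::
  "('g, 'r) monoid_scheme \<Rightarrow> ('g \<Rightarrow> 'a::euclidean_space \<Rightarrow> 'a) \<Rightarrow> 'a \<Rightarrow> 'a set" where
  "myrberg_limit_set G \<phi> x\<^sub>0 =
     {\<xi> \<in> limit_set G \<phi> x\<^sub>0.
        \<forall>a\<in>limit_set G \<phi> x\<^sub>0. \<forall>b\<in>limit_set G \<phi> x\<^sub>0. a \<noteq> b \<longrightarrow>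
          (\<forall>c. geodesic_line c a b \<longrightarrow> in_ray_orbit_closure G \<phi> x\<^sub>0 \<xi> c)}"


section \<open>Hausdorff dimension\<close>

text \<open>
  Hausdorff measure and dimension of a subset of a space \<open>X\<close> with respect to an explicit metric
  \<open>d\<close>. Only exponents \<open>s > 0\<close> enter the dimension, so the convention for \<open>0 powr 0\<close> is irrelevant.
\<close>

definition metric_diam :: "('a \<Rightarrow> 'a \<Rightarrow> real) \<Rightarrow> 'a set \<Rightarrow> real" where
  "metric_diam d S = (if S = {} then 0 else SUP (x, y)\<in>S \<times> S. d x y)"

definition hausdorff_premeasure ::
  "'a set \<Rightarrow> ('a \<Rightarrow> 'a \<Rightarrow> real) \<Rightarrow> real \<Rightarrow> real \<Rightarrow> 'a set \<Rightarrow> ennreal" where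
  "hausdorff_premeasure X d s \<delta> A =
     (INF U \<in> {U :: nat \<Rightarrow> 'a set. A \<subseteq> (\<Union>i. U i) \<and>
                 (\<forall>i. U i \<subseteq> X \<and> (\<forall>x\<in>U i. \<forall>y\<in>U i. d x y \<le> \<delta>))}.
        \<Sum>i. ennreal (metric_diam d (U i) powr s))"

definition hausdorff_measure ::
  "'a set \<Rightarrow> ('a \<Rightarrow> 'a \<Rightarrow> real) \<Rightarrow> real \<Rightarrow> 'a set \<Rightarrow> ennreal" where
  "hausdorff_measure X d s A = (SUP \<delta>\<in>{0<..}. hausdorff_premeasure X d s \<delta> A)"

definition hausdorff_dim :: "'a set \<Rightarrow> ('a \<Rightarrow> 'a \<Rightarrow> real) \<Rightarrow> 'a set \<Rightarrow> ereal" where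
  "hausdorff_dim X d A = Inf {ereal s |s. 0 < s \<and> hausdorff_measure X d s A = 0}"

end

(*
  Upper bound: a conical limit point lies in the shadows of infinitely many orbit points, and the
  shadow of g has visual diameter O(exp (- d(x0, g x0))), so the orbital series bounds the
  Hausdorff measure.

  Lower bound, for s below the critical exponent: a non-elementary group has no global fixed point
  at infinity, so finitely many connecting elements f suffice to make any product g f h
  quasi-geodesic. Starting from a large separated part of one annulus of the orbit, this gives a
  tree of quasi-geodesics whose endpoints carry a mass of dimension larger than s. At sparse times
  the branching is interrupted in order to insert every element of the group once: this makes all
  endpoints Myrberg, while the inserted pieces are negligible compared with the time at which they
  occur, so the endpoints are sublinear and the dimension does not drop.
*)
theory Submission
  imports Defs "HOL-Probability.Infinite_Product_Measure"
begin

section \<open>Hyperboloid coordinates and the four-point inequality\<close>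

text \<open>Metric facts are computed on the hyperboloid: a point of the ball becomes a vector of
  Lorentz square 1, a boundary point a null vector, and distances, rays, horospheres and visual
  angles are all read off from the form \<open>lor\<close>. The coarse arguments rest on the
  four-point inequality alone. A branch is controlled by a bound on the Gromov product at each
  vertex between \<open>x\<^sub>0\<close> and the next vertex. This concerns one step at a time, yet
  with steps of length at least \<open>2 * C + 10\<close> the error does not grow along the branch.
  The connecting element has to depend on the whole prefix, so the children differ from vertex to
  vertex. Only their number and the bound on their lengths are the same on a level; this makes a
  branch a sequence of natural numbers and the mass a product measure. An inserted element refines
  the scale without adding mass, and the gap between s and a growth exponent still below the
  critical one pays for it.\<close>

definition hlift :: "'a::euclidean_space \<Rightarrow> real \<times> 'a" where
  "hlift x = ((1 + (norm x)\<^sup>2) / (1 - (norm x)\<^sup>2), (2 / (1 - (norm x)\<^sup>2)) *\<^sub>R x)"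

text \<open>The Lorentz form of signature (1, d). With this sign the hyperboloid is
  \<open>lor p p = 1\<close>, and on its upper sheet the form is \<open>cosh\<close> of the
  distance.\<close>

definition lor :: "real \<times> 'a::euclidean_space \<Rightarrow> real \<times> 'a \<Rightarrow> real" where
  "lor p q = fst p * fst q - snd p \<bullet> snd q"

text \<open>A light-like representative of a boundary point: the limit of nearby lifts rescaled to
  first coordinate 1.\<close>

definition nul :: "'a::euclidean_space \<Rightarrow> real \<times> 'a" where
  "nul \<xi> = (1, \<xi>)"

text \<open>Stereographic projection from (-1, 0), the inverse of \<open>hlift\<close> on the upper
  sheet.\<close>

definition hproj :: "real \<times> 'a::euclidean_space \<Rightarrow> 'a" where
  "hproj p = (1 / (1 + fst p)) *\<^sub>R snd p"

lemma lor_linear [simp]: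
  "lor (p + q) r = lor p r + lor q r" "lor r (p + q) = lor r p + lor r q"
  "lor (p - q) r = lor p r - lor q r" "lor r (p - q) = lor r p - lor r q"
  "lor (c *\<^sub>R p) r = c * lor p r" "lor r (c *\<^sub>R p) = c * lor r p"
  by (auto simp: lor_def algebra_simps inner_add_left inner_add_right inner_diff_left inner_diff_right)

lemma lor_commute: "lor p q = lor q p"
  by (simp add: lor_def inner_commute mult.commute)

lemma hyp_iff: "x \<in> hyp \<longleftrightarrow> norm x < 1"
  by (simp add: hyp_def)

lemma hyp_pos: "x \<in> hyp \<Longrightarrow> 1 - (norm x)\<^sup>2 > 0"
  by (simp add: hyp_iff power_less_one_iff)

lemma boundary_iff: "\<xi> \<in> hyp_boundary \<longleftrightarrow> norm \<xi> = 1"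
  by (simp add: hyp_boundary_def)

lemma zero_hyp [simp]: "0 \<in> hyp"
  by (simp add: hyp_iff)

lemma norm_diff_square: "(norm (x - y))\<^sup>2 = (norm x)\<^sup>2 + (norm y)\<^sup>2 - 2 * (x \<bullet> y)" for x y :: "'a::real_inner"
  by (simp add: power2_norm_eq_inner inner_diff_left inner_diff_right inner_commute)

lemma cosh_hdist_formula:
  assumes "x \<in> hyp" "y \<in> hyp"
  shows "cosh (hdist x y) = 1 + 2 * (norm (x - y))\<^sup>2 / ((1 - (norm x)\<^sup>2) * (1 - (norm y)\<^sup>2))"
  using hyp_pos[OF assms(1)] hyp_pos[OF assms(2)]
  by (simp add: hdist_def cosh_arcosh_real)

lemma lor_hlift:
  assumes "x \<in> hyp" "y \<in> hyp"
  shows "lor (hlift x) (hlift y) = cosh (hdist x y)"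
proof -
  define a b where "a = 1 - (norm x)\<^sup>2" and "b = 1 - (norm y)\<^sup>2"
  have "a > 0" "b > 0" using assms hyp_pos by (auto simp: a_def b_def)
  have *: "(norm x)\<^sup>2 = 1 - a" "(norm y)\<^sup>2 = 1 - b" by (auto simp: a_def b_def)
  have "lor (hlift x) (hlift y) = (2 - a) / a * ((2 - b) / b) - (2 / a) * (2 / b) * (x \<bullet> y)"
    unfolding lor_def hlift_def by (simp add: *)
  also have "\<dots> = 1 + 2 * (norm (x - y))\<^sup>2 / (a * b)"
    unfolding norm_diff_square * using \<open>a > 0\<close> \<open>b > 0\<close> by (simp add: field_simps)
  finally show ?thesis using cosh_hdist_formula[OF assms] by (simp add: a_def b_def)
qed

lemma hdist_nonneg [simp]:
  assumes "x \<in> hyp" "y \<in> hyp" shows "0 \<le> hdist x y"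
  using hyp_pos[OF assms(1)] hyp_pos[OF assms(2)] unfolding hdist_def
  by (intro arcosh_nonneg_real) simp

lemma hdist_commute: "hdist x y = hdist y x"
  by (simp add: hdist_def norm_minus_commute mult.commute)

lemma hdist_refl [simp]: "hdist x x = 0"
  by (simp add: hdist_def)

lemma cosh_eq_imp: "0 \<le> d \<Longrightarrow> cosh d = cosh u \<Longrightarrow> d = \<bar>u\<bar>" for d u :: real
  by (metis arcosh_cosh_real cosh_real_abs abs_ge_zero)

lemma cosh_le_imp: "0 \<le> d \<Longrightarrow> cosh d \<le> cosh u \<Longrightarrow> d \<le> \<bar>u\<bar>" for d u :: real
  by (metis cosh_real_abs abs_ge_zero cosh_real_strict_mono linorder_not_less)

lemma hdist_eq_0:
  assumes "x \<in> hyp" "y \<in> hyp" "hdist x y = 0" shows "x = y"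
  using cosh_hdist_formula[OF assms(1,2)] hyp_pos[OF assms(1)] hyp_pos[OF assms(2)] assms(3) by simp

lemma lor_hlift_self: "x \<in> hyp \<Longrightarrow> lor (hlift x) (hlift x) = 1"
  by (simp add: lor_hlift)

lemma fst_hlift_pos: "x \<in> hyp \<Longrightarrow> fst (hlift x) > 0"
  using hyp_pos[of x] by (simp add: hlift_def add_pos_nonneg)

lemma hproj_works:
  assumes "lor p p = 1" "fst p > 0"
  shows "hproj p \<in> hyp" "hlift (hproj p) = p"
proof -
  obtain t v where p: "p = (t, v)" by (cases p)
  have t: "t > 0" and v: "(norm v)\<^sup>2 = t\<^sup>2 - 1"
    using assms by (auto simp: p lor_def dot_square_norm power2_eq_square[of t])
  have n: "(norm (hproj p))\<^sup>2 = (t\<^sup>2 - 1) / (1 + t)\<^sup>2"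
    using t by (simp add: hproj_def p v power_mult_distrib power_divide)
  have e: "(t\<^sup>2 - 1) / (1 + t)\<^sup>2 = (t - 1) / (t + 1)"
    using t by (simp add: divide_simps power2_eq_square) (simp add: algebra_simps)
  have n1: "1 - (norm (hproj p))\<^sup>2 = 2 / (t + 1)" and n2: "1 + (norm (hproj p))\<^sup>2 = 2 * t / (t + 1)"
    using t by (auto simp: n e field_simps)
  have "1 - (norm (hproj p))\<^sup>2 > 0" using n1 t by simp
  then show "hproj p \<in> hyp" by (simp add: hyp_iff power_less_one_iff)
  show "hlift (hproj p) = p"
    unfolding hlift_def n1 n2 using t by (simp add: hproj_def p add.commute)
qed

text \<open>On the orthogonal complement of a timelike vector the form is negative semidefinite, by
  the Euclidean Cauchy-Schwarz inequality for the space coordinates. For a semidefinite form the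
  usual argument then applies.\<close>

lemma lor_Cauchy_Schwarz:
  fixes Y U W :: "real \<times> 'a::euclidean_space"
  assumes "lor Y Y = 1" "lor U Y = 0" "lor W Y = 0"
  shows "(lor U W)\<^sup>2 \<le> lor U U * lor W W"
proof -
  have nonpos: "lor U U \<le> 0" if "lor U Y = 0" for U
  proof -
    have 1: "(fst Y)\<^sup>2 = 1 + (norm (snd Y))\<^sup>2"
      using assms(1) by (simp add: lor_def dot_square_norm power2_eq_square[of "fst Y"])
    have "fst U * fst Y = snd U \<bullet> snd Y" using that by (simp add: lor_def)
    then have "(fst U * fst Y)\<^sup>2 \<le> (norm (snd U))\<^sup>2 * (norm (snd Y))\<^sup>2"
      by (simp add: Cauchy_Schwarz_ineq2 power2_norm_eq_inner Cauchy_Schwarz_ineq)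
    also have "\<dots> \<le> (norm (snd U))\<^sup>2 * (fst Y)\<^sup>2" by (intro mult_left_mono) (auto simp: 1)
    finally have "(fst U)\<^sup>2 * (fst Y)\<^sup>2 \<le> (norm (snd U))\<^sup>2 * (fst Y)\<^sup>2"
      by (simp add: power_mult_distrib)
    then have "(fst U)\<^sup>2 \<le> (norm (snd U))\<^sup>2"
      by (rule mult_right_le_imp_le) (simp add: 1 add_pos_nonneg)
    then show ?thesis by (simp add: lor_def dot_square_norm power2_eq_square[of "fst U"])
  qed
  define a b c where "a = lor U U" "b = lor U W" "c = lor W W"
  have a: "a \<le> 0" and c: "c \<le> 0" using assms nonpos by (auto simp: a_b_c_def)
  have "lor (c *\<^sub>R U - b *\<^sub>R W) (c *\<^sub>R U - b *\<^sub>R W) \<le> 0"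
    by (rule nonpos) (simp add: assms)
  then have 1: "c * (a * c - b * b) \<le> 0"
    by (simp add: a_b_c_def[symmetric] lor_commute[of W U] algebra_simps)
  have "lor (a *\<^sub>R W - b *\<^sub>R U) (a *\<^sub>R W - b *\<^sub>R U) \<le> 0"
    by (rule nonpos) (simp add: assms)
  then have 2: "a * (a * c - b * b) \<le> 0"
    by (simp add: a_b_c_def[symmetric] lor_commute[of W U] algebra_simps)
  have "lor (U + W) (U + W) \<le> 0" by (rule nonpos) (simp add: assms)
  then have 3: "a + 2 * b + c \<le> 0"
    by (simp add: a_b_c_def[symmetric] lor_commute[of W U] algebra_simps)
  have "lor (U - W) (U - W) \<le> 0" by (rule nonpos) (simp add: assms)
  then have 4: "a - 2 * b + c \<le> 0"
    by (simp add: a_b_c_def[symmetric] lor_commute[of W U] algebra_simps)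
  have "b * b \<le> a * c"
  \<comment> \<open>For \<open>a = c = 0\<close> the first two combinations say nothing; then
    \<open>U + W\<close> and \<open>U - W\<close> force \<open>b = 0\<close>.\<close>
  proof (cases "a = 0 \<and> c = 0")
    case True then show ?thesis using 3 4 by simp
  next
    case False
    show ?thesis
    proof (rule ccontr)
      assume "\<not> b * b \<le> a * c"
      then have n: "a * c - b * b < 0" by simp
      show False using False a c 1 2 mult_neg_neg[OF _ n] by (metis linorder_not_less order_le_less)
    qed
  qed
  then show ?thesis by (simp add: a_b_c_def power2_eq_square)
qed

text \<open>Removing from the lifts of \<open>x\<close> and \<open>z\<close> their components along
  the lift of \<open>y\<close> leaves vectors whose Lorentz squares are minus the squares of
  \<open>sinh a\<close> and \<open>sinh b\<close>. Cauchy-Schwarz bounds their product, and the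
  addition theorem for \<open>cosh\<close> concludes.\<close>

lemma hdist_triangle:
  assumes "x \<in> hyp" "y \<in> hyp" "z \<in> hyp"
  shows "hdist x z \<le> hdist x y + hdist y z"
proof -
  define X Y Z where "X = hlift x" "Y = hlift y" "Z = hlift z"
  define a b where "a = hdist x y" "b = hdist y z"
  have ab: "a \<ge> 0" "b \<ge> 0" using assms by (auto simp: a_b_def)
  have XY: "lor X Y = cosh a" "lor Y X = cosh a" "lor Y Z = cosh b" "lor Z Y = cosh b"
     "lor X X = 1" "lor Y Y = 1" "lor Z Z = 1"
    using assms by (auto simp: X_Y_Z_def a_b_def lor_hlift hdist_commute)
  have cosh_sq: "cosh t * cosh t = 1 + (sinh t)\<^sup>2" for t :: real
    using cosh_square_eq[of t] by (simp add: power2_eq_square)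
  define U W where "U = X - cosh a *\<^sub>R Y" "W = Z - cosh b *\<^sub>R Y"
  have UU: "lor U U = - (sinh a)\<^sup>2" and WW: "lor W W = - (sinh b)\<^sup>2"
    and UW: "lor U W = lor X Z - cosh a * cosh b"
    unfolding U_W_def by (simp_all add: XY cosh_sq algebra_simps)
  have "(lor U W)\<^sup>2 \<le> lor U U * lor W W"
    by (rule lor_Cauchy_Schwarz[of Y]) (auto simp: U_W_def XY)
  then have "(lor U W)\<^sup>2 \<le> (sinh a * sinh b)\<^sup>2" by (simp add: UU WW power_mult_distrib)
  then have "\<bar>lor U W\<bar> \<le> \<bar>sinh a * sinh b\<bar>" by (simp only: abs_le_square_iff)
  then have "lor U W \<le> sinh a * sinh b" using ab by simp
  then have "cosh (hdist x z) \<le> cosh (a + b)"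
    using lor_hlift[OF assms(1,3)] UW by (simp add: X_Y_Z_def cosh_add)
  from cosh_le_imp[OF _ this] show ?thesis using ab assms by (simp add: a_b_def)
qed

lemma sinh_half_square: "(sinh (d / 2))\<^sup>2 = (cosh d - 1) / 2" for d :: real
proof -
  have "cosh (d/2 + d/2) = cosh (d/2) * cosh (d/2) + sinh (d/2) * sinh (d/2)" by (rule cosh_add)
  then show ?thesis by (simp add: cosh_square_eq power2_eq_square[symmetric])
qed

text \<open>The conformal factors on the right occur equally in all three products of Ptolemy's
  inequality, which therefore passes from Euclidean distances to
  \<open>sinh (hdist x y / 2)\<close>.\<close>

lemma norm_diff_hyp:
  assumes "x \<in> hyp" "y \<in> hyp"
  shows "norm (x - y) = sinh (hdist x y / 2) * (sqrt (1 - (norm x)\<^sup>2) * sqrt (1 - (norm y)\<^sup>2))"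
proof (rule power2_eq_imp_eq)
  show "(norm (x - y))\<^sup>2 = (sinh (hdist x y / 2) * (sqrt (1 - (norm x)\<^sup>2) * sqrt (1 - (norm y)\<^sup>2)))\<^sup>2"
    unfolding power_mult_distrib sinh_half_square cosh_hdist_formula[OF assms]
    using hyp_pos[OF assms(1)] hyp_pos[OF assms(2)] by simp
  show "0 \<le> sinh (hdist x y / 2) * (sqrt (1 - (norm x)\<^sup>2) * sqrt (1 - (norm y)\<^sup>2))"
    using assms hyp_pos[OF assms(1)] hyp_pos[OF assms(2)] by (auto intro!: mult_nonneg_nonneg)
qed simp

text \<open>Inversion at \<open>w\<close> divides the distance of two points by the product of their
  distances from \<open>w\<close>, so this is the triangle inequality for the inverted
  points.\<close>

lemma Ptolemy_inequality:
  fixes x y z w :: "'a::real_inner"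
  shows "norm (x - y) * norm (z - w) \<le> norm (x - z) * norm (y - w) + norm (x - w) * norm (y - z)"
proof -
  have inv: "norm (x /\<^sub>R (norm x)\<^sup>2 - y /\<^sub>R (norm y)\<^sup>2) = norm (x - y) / (norm x * norm y)"
    if "x \<noteq> 0" "y \<noteq> 0" for x y :: 'a
  proof (rule power2_eq_imp_eq)
    show "(norm (x /\<^sub>R (norm x)\<^sup>2 - y /\<^sub>R (norm y)\<^sup>2))\<^sup>2 = (norm (x - y) / (norm x * norm y))\<^sup>2"
    proof -
      define a b c where "a = norm x" "b = norm y" "c = x \<bullet> y"
      have ab: "a \<noteq> 0" "b \<noteq> 0" using that by (auto simp: a_b_c_def)
      have "(norm (x /\<^sub>R (norm x)\<^sup>2 - y /\<^sub>R (norm y)\<^sup>2))\<^sup>2 = (a / a\<^sup>2)\<^sup>2 + (b / b\<^sup>2)\<^sup>2 - 2 * (c / (a\<^sup>2 * b\<^sup>2))"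
        unfolding norm_diff_square a_b_c_def by (simp add: divide_inverse mult.commute mult.left_commute)
      also have "\<dots> = (a\<^sup>2 + b\<^sup>2 - 2 * c) / (a\<^sup>2 * b\<^sup>2)"
        using ab by (simp add: divide_simps) (simp add: eval_nat_numeral algebra_simps)
      also have "\<dots> = (norm (x - y) / (norm x * norm y))\<^sup>2"
        by (simp add: norm_diff_square a_b_c_def power_divide power_mult_distrib)
      finally show ?thesis .
    qed
  qed auto
  have base: "norm (x - y) * norm z \<le> norm (x - z) * norm y + norm x * norm (y - z)" for x y z :: 'a
  proof (cases "x = 0 \<or> y = 0 \<or> z = 0")
    case True
    then show ?thesis by (auto simp: norm_minus_commute mult.commute)
  next
    case False
    then have nz: "x \<noteq> 0" "y \<noteq> 0" "z \<noteq> 0" by auto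
    have "norm (x /\<^sub>R (norm x)\<^sup>2 - y /\<^sub>R (norm y)\<^sup>2)
       \<le> norm (x /\<^sub>R (norm x)\<^sup>2 - z /\<^sub>R (norm z)\<^sup>2) + norm (z /\<^sub>R (norm z)\<^sup>2 - y /\<^sub>R (norm y)\<^sup>2)"
      using norm_triangle_ineq[of "x /\<^sub>R (norm x)\<^sup>2 - z /\<^sub>R (norm z)\<^sup>2" "z /\<^sub>R (norm z)\<^sup>2 - y /\<^sub>R (norm y)\<^sup>2"]
      by simp
    then have "norm (x - y) / (norm x * norm y) \<le> norm (x - z) / (norm x * norm z) + norm (z - y) / (norm z * norm y)"
      using nz by (simp add: inv)
    then show ?thesis using nz by (simp add: field_simps norm_minus_commute)
  qed
  have "norm ((x - w) - (y - w)) * norm (z - w)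
      \<le> norm ((x - w) - (z - w)) * norm (y - w) + norm (x - w) * norm ((y - w) - (z - w))"
    by (rule base)
  then show ?thesis by simp
qed

text \<open>Ptolemy's inequality for \<open>sinh (hdist x y / 2)\<close>, which is comparable with
  \<open>exp (hdist x y / 2)\<close> once the distance is at least 1; shorter distances are handled
  by the triangle inequality. The comparison loses a factor 8, at most \<open>exp 3\<close>, and the
  exponents are halved: hence the 6.\<close>

lemma four_point:
  assumes "x \<in> hyp" "y \<in> hyp" "z \<in> hyp" "w \<in> hyp"
  shows "hdist x y + hdist z w \<le> max (hdist x z + hdist y w) (hdist x w + hdist y z) + 6"
proof -
  define M where "M = max (hdist x z + hdist y w) (hdist x w + hdist y z)"
  define r where "r x = sqrt (1 - (norm x)\<^sup>2)" for x :: 'a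
  have r: "r x > 0" "r y > 0" "r z > 0" "r w > 0" using assms using hyp_pos[of x] hyp_pos[of y] hyp_pos[of z] hyp_pos[of w] by (simp_all add: r_def)
  define S where "S x y = sinh (hdist x y / 2)" for x y :: 'a
  have n: "norm (x - y) = S x y * (r x * r y)" if "x \<in> hyp" "y \<in> hyp" for x y
    using norm_diff_hyp[OF that] by (simp add: S_def r_def)
  have "norm (x - y) * norm (z - w) \<le> norm (x - z) * norm (y - w) + norm (x - w) * norm (y - z)"
    by (rule Ptolemy_inequality)
  then have "(S x y * S z w) * (r x * r y * r z * r w)
      \<le> (S x z * S y w + S x w * S y z) * (r x * r y * r z * r w)"
    using assms by (simp add: n algebra_simps)
  then have P: "S x y * S z w \<le> S x z * S y w + S x w * S y z"
    by (rule mult_right_le_imp_le) (use r in auto)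
  have up: "S a b \<le> exp (hdist a b / 2) / 2" "S a b \<ge> 0" if "a \<in> hyp" "b \<in> hyp" for a b
    using that by (auto simp: S_def sinh_def)
  have prod: "S a b * S c d \<le> exp (M / 2) / 4"
    if "a \<in> hyp" "b \<in> hyp" "c \<in> hyp" "d \<in> hyp" "hdist a b + hdist c d \<le> M" for a b c d
  proof -
    have "S a b * S c d \<le> (exp (hdist a b / 2) / 2) * (exp (hdist c d / 2) / 2)"
      using up that by (intro mult_mono) auto
    also have "\<dots> = exp ((hdist a b + hdist c d) / 2) / 4" by (simp add: exp_add[symmetric] add_divide_distrib)
    also have "\<dots> \<le> exp (M / 2) / 4" using that by simp
    finally show ?thesis .
  qed
  have lo: "S a b \<ge> exp (hdist a b / 2) / 4" if "hdist a b \<ge> 1" for a b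
  proof -
    have "exp (- (hdist a b / 2)) \<le> exp (hdist a b / 2) * exp (-1)"
      unfolding exp_add[symmetric] using that by simp
    also have "exp (-1) \<le> (1/2 :: real)"
      using exp_ge_add_one_self[of 1] by (simp add: exp_minus field_simps)
    finally have "exp (- (hdist a b / 2)) \<le> exp (hdist a b / 2) / 2" by simp
    then show ?thesis by (simp add: S_def sinh_def)
  qed
  have tri: "hdist a b \<le> hdist a c + hdist c b" if "a \<in> hyp" "b \<in> hyp" "c \<in> hyp" for a b c
    using hdist_triangle that by blast
  consider "hdist x y \<le> 1" | "hdist z w \<le> 1" | "hdist x y \<ge> 1" "hdist z w \<ge> 1" by linarith
  then have "hdist x y + hdist z w \<le> M + 6"
  proof cases
    case 1
    have "hdist z w \<le> hdist z x + (hdist x y + hdist y w)"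
      using tri[of z w x] tri[of x w y] assms by linarith
    with 1 show ?thesis using assms by (simp add: M_def hdist_commute[of z x])
  next
    case 2
    have "hdist x y \<le> hdist x z + (hdist z w + hdist w y)"
      using tri[of x y z] tri[of z y w] assms by linarith
    with 2 show ?thesis using assms by (simp add: M_def hdist_commute[of w y])
  next
    case 3
    have "exp ((hdist x y + hdist z w) / 2) / 16 = (exp (hdist x y / 2) / 4) * (exp (hdist z w / 2) / 4)"
      by (simp add: exp_add[symmetric] add_divide_distrib)
    also have "\<dots> \<le> S x y * S z w" using lo 3 up assms by (intro mult_mono) auto
    also have "\<dots> \<le> exp (M / 2) / 4 + exp (M / 2) / 4"
      using P prod[of x z y w] prod[of x w y z] assms by (auto simp: M_def)
    finally have le: "exp ((hdist x y + hdist z w) / 2) \<le> 8 * exp (M / 2)" by simp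
    have "(8::real) \<le> exp 3"
    proof -
      have "(2::real) ^ 3 \<le> exp 1 ^ 3"
        using exp_ge_add_one_self[of "1::real"] by (intro power_mono) auto
      then show ?thesis by (simp flip: exp_of_nat_mult)
    qed
    then have "8 * exp (M / 2) \<le> exp (3 + M / 2)" by (simp add: exp_add)
    with le have "exp ((hdist x y + hdist z w) / 2) \<le> exp (3 + M / 2)" by linarith
    then show ?thesis by simp
  qed
  then show ?thesis by (simp add: M_def)
qed

text \<open>The Gromov product seen from \<open>p\<close>: up to a bounded error, the distance from
  \<open>p\<close> to the geodesic between \<open>x\<close> and \<open>y\<close>.\<close>

definition gp :: "'a::euclidean_space \<Rightarrow> 'a \<Rightarrow> 'a \<Rightarrow> real" where
  "gp p x y = (hdist p x + hdist p y - hdist x y) / 2"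

lemma gp_hyperbolic:
  assumes "p \<in> hyp" "x \<in> hyp" "y \<in> hyp" "z \<in> hyp"
  shows "min (gp p x y) (gp p y z) \<le> gp p x z + 3"
  using four_point[of x z y p] assms
  by (auto simp: gp_def hdist_commute min_def max_def field_simps split: if_splits)

lemma gp_nonneg: "p \<in> hyp \<Longrightarrow> x \<in> hyp \<Longrightarrow> y \<in> hyp \<Longrightarrow> 0 \<le> gp p x y"
  using hdist_triangle[of x p y] by (simp add: gp_def hdist_commute)

lemma gp_le: "p \<in> hyp \<Longrightarrow> x \<in> hyp \<Longrightarrow> y \<in> hyp \<Longrightarrow> gp p x y \<le> hdist p x"
  using hdist_triangle[of p x y] by (simp add: gp_def hdist_commute)

section \<open>Geodesic rays and the visual metric\<close>

text \<open>The exponential of the usual Busemann function, normalised to 1 at the origin; its level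
  sets are the horospheres at \<open>\<xi>\<close>. Unlike its logarithm it is linear in the
  lift.\<close>

definition busemann :: "'a::euclidean_space \<Rightarrow> 'a \<Rightarrow> real" where
  "busemann \<xi> x = lor (hlift x) (nul \<xi>)"

text \<open>The lift of the ray from \<open>x\<close> to \<open>\<xi>\<close>: the coefficient of
  the null vector is the one that keeps the Lorentz square equal to 1.\<close>

definition rvec :: "'a::euclidean_space \<Rightarrow> 'a \<Rightarrow> real \<Rightarrow> real \<times> 'a" where
  "rvec x \<xi> t = exp (- t) *\<^sub>R hlift x + (sinh t / busemann \<xi> x) *\<^sub>R nul \<xi>"

definition ray_pt :: "'a::euclidean_space \<Rightarrow> 'a \<Rightarrow> real \<Rightarrow> 'a" where
  "ray_pt x \<xi> t = hproj (rvec x \<xi> t)"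

lemma busemann_formula:
  assumes "x \<in> hyp" "\<xi> \<in> hyp_boundary"
  shows "busemann \<xi> x = (norm (x - \<xi>))\<^sup>2 / (1 - (norm x)\<^sup>2)"
proof -
  define a where "a = 1 - (norm x)\<^sup>2"
  have a: "a > 0" "(norm x)\<^sup>2 = 1 - a" using hyp_pos[OF assms(1)] by (auto simp: a_def)
  show ?thesis using a(1) assms(2)
    by (simp add: busemann_def lor_def hlift_def nul_def norm_diff_square boundary_iff a(2) field_simps)
qed

lemma busemann_pos:
  assumes "x \<in> hyp" "\<xi> \<in> hyp_boundary" shows "busemann \<xi> x > 0"
proof -
  have "x \<noteq> \<xi>" using assms by (auto simp: hyp_iff boundary_iff)
  then show ?thesis using busemann_formula[OF assms] hyp_pos[OF assms(1)] by simp
qed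

lemma lor_nul: "lor (nul \<xi>) (nul \<eta>) = 1 - \<xi> \<bullet> \<eta>"
  by (simp add: lor_def nul_def)

lemma lor_nul_norm:
  assumes "\<xi> \<in> hyp_boundary" "\<eta> \<in> hyp_boundary"
  shows "lor (nul \<xi>) (nul \<eta>) = (norm (\<xi> - \<eta>))\<^sup>2 / 2"
  using assms by (simp add: lor_nul norm_diff_square boundary_iff)

lemma lor_nul_self: "\<xi> \<in> hyp_boundary \<Longrightarrow> lor (nul \<xi>) (nul \<xi>) = 0"
  by (simp add: lor_nul_norm)

lemma exp_sinh_cosh_identity:
  "exp (-s) * exp (-t) + exp (-s) * sinh t + exp (-t) * sinh s = cosh (s - t)" for s t :: real
proof -
  have s: "exp (-s) = cosh s - sinh s" and t: "exp (-t) = cosh t - sinh t"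
    by (simp_all add: cosh_def sinh_def field_simps)
  show ?thesis unfolding s t cosh_diff by (simp add: algebra_simps)
qed

lemma lor_rvec:
  assumes "x \<in> hyp" "\<xi> \<in> hyp_boundary"
  shows "lor (rvec x \<xi> s) (rvec x \<xi> t) = cosh (s - t)"
proof -
  have b: "busemann \<xi> x \<noteq> 0" using busemann_pos[OF assms] by simp
  have "lor (rvec x \<xi> s) (rvec x \<xi> t) = exp (-s) * exp (-t) + exp (-s) * sinh t + exp (-t) * sinh s"
    using b by (simp add: rvec_def lor_hlift_self[OF assms(1)] lor_nul_self[OF assms(2)]
       busemann_def lor_commute[of "nul \<xi>" "hlift x"] algebra_simps)
  also have "\<dots> = cosh (s - t)" by (rule exp_sinh_cosh_identity)
  finally show ?thesis .
qed

lemma rvec_zero [simp]: "rvec x \<xi> 0 = hlift x"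
  by (simp add: rvec_def)

lemma fst_rvec_pos:
  assumes "x \<in> hyp" "\<xi> \<in> hyp_boundary" "t \<ge> 0"
  shows "fst (rvec x \<xi> t) > 0"
proof -
  have "0 < exp (- t) * fst (hlift x)" using fst_hlift_pos[OF assms(1)] by simp
  moreover have "0 \<le> sinh t / busemann \<xi> x" using busemann_pos[OF assms(1,2)] assms(3) by simp
  ultimately show ?thesis by (simp add: rvec_def nul_def)
qed

lemma ray_pt_hyp:
  assumes "x \<in> hyp" "\<xi> \<in> hyp_boundary" "t \<ge> 0"
  shows "ray_pt x \<xi> t \<in> hyp" "hlift (ray_pt x \<xi> t) = rvec x \<xi> t"
  unfolding ray_pt_def using lor_rvec[OF assms(1,2), of t t] fst_rvec_pos[OF assms]
  by (auto intro: hproj_works)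

lemma hproj_hlift: "x \<in> hyp \<Longrightarrow> hproj (hlift x) = x"
  using hyp_pos[of x] by (simp add: hproj_def hlift_def field_simps)

lemma ray_pt_zero [simp]: "x \<in> hyp \<Longrightarrow> ray_pt x \<xi> 0 = x"
  by (simp add: ray_pt_def hproj_hlift)

lemma hdist_ray_pt:
  assumes "x \<in> hyp" "\<xi> \<in> hyp_boundary" "s \<ge> 0" "t \<ge> 0"
  shows "hdist (ray_pt x \<xi> s) (ray_pt x \<xi> t) = \<bar>s - t\<bar>"
proof (rule cosh_eq_imp)
  show "cosh (hdist (ray_pt x \<xi> s) (ray_pt x \<xi> t)) = cosh (s - t)"
    using assms by (simp add: lor_hlift[symmetric] ray_pt_hyp lor_rvec)
qed (use assms ray_pt_hyp in \<open>auto intro!: hdist_nonneg\<close>)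

text \<open>For large arguments \<open>hproj\<close> is almost homogeneous of degree 0, so only the
  limiting direction of \<open>P n\<close> matters.\<close>

lemma tendsto_hproj:
  fixes P :: "'b \<Rightarrow> real \<times> 'a::euclidean_space"
  assumes "filterlim \<sigma> at_top F" "((\<lambda>n. (1 / \<sigma> n) *\<^sub>R P n) \<longlongrightarrow> N) F" "fst N > 0"
  shows "((\<lambda>n. hproj (P n)) \<longlongrightarrow> (1 / fst N) *\<^sub>R snd N) F"
proof -
  have 1: "((\<lambda>n. 1 / \<sigma> n) \<longlongrightarrow> 0) F"
    using assms(1) tendsto_divide_0 tendsto_const filterlim_at_top_imp_at_infinity by blast
  have "((\<lambda>n. (1 / (1 / \<sigma> n + fst ((1 / \<sigma> n) *\<^sub>R P n))) *\<^sub>R snd ((1 / \<sigma> n) *\<^sub>R P n)) \<longlongrightarrow>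
      (1 / (0 + fst N)) *\<^sub>R snd N) F"
    by (intro tendsto_intros 1 assms(2)) (use assms(3) in auto)
  moreover have "eventually (\<lambda>n. (1 / (1 / \<sigma> n + fst ((1 / \<sigma> n) *\<^sub>R P n))) *\<^sub>R snd ((1 / \<sigma> n) *\<^sub>R P n) = hproj (P n)) F"
  proof -
    have "eventually (\<lambda>n. \<sigma> n > 0) F" using assms(1) by (simp add: filterlim_at_top_dense)
    then show ?thesis
    proof eventually_elim
      case (elim n)
      have "1 / \<sigma> n + fst ((1 / \<sigma> n) *\<^sub>R P n) = (1 + fst (P n)) / \<sigma> n" by (simp add: add_divide_distrib)
      then show ?case using elim by (simp add: hproj_def)
    qed
  qed
  ultimately show ?thesis by (simp add: tendsto_cong)
qed

lemma ray_pt_tendsto: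
  assumes "x \<in> hyp" "\<xi> \<in> hyp_boundary"
  shows "(ray_pt x \<xi> \<longlongrightarrow> \<xi>) at_top"
proof -
  define b where "b = busemann \<xi> x"
  have b: "b > 0" using busemann_pos[OF assms] by (simp add: b_def)
  have 1: "((\<lambda>t::real. exp (-t) / sinh t) \<longlongrightarrow> 0) at_top"
    by real_asymp
  have "((\<lambda>t. (exp (-t) / sinh t) *\<^sub>R hlift x + (1 / b) *\<^sub>R nul \<xi>) \<longlongrightarrow> 0 *\<^sub>R hlift x + (1 / b) *\<^sub>R nul \<xi>) at_top"
    by (intro tendsto_intros 1)
  moreover have "eventually (\<lambda>t. (exp (-t) / sinh t) *\<^sub>R hlift x + (1 / b) *\<^sub>R nul \<xi> = (1 / sinh t) *\<^sub>R rvec x \<xi> t) at_top"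
    using eventually_gt_at_top[of 0] by eventually_elim (simp add: rvec_def b_def[symmetric] scaleR_add_right)
  ultimately have "((\<lambda>t. (1 / sinh t) *\<^sub>R rvec x \<xi> t) \<longlongrightarrow> (1 / b) *\<^sub>R nul \<xi>) at_top"
    by (simp add: tendsto_cong)
  from tendsto_hproj[OF sinh_real_at_top this] b show ?thesis
    by (simp add: ray_pt_def[abs_def] nul_def)
qed

lemma geodesic_ray_ray_pt:
  assumes "x \<in> hyp" "\<xi> \<in> hyp_boundary"
  shows "geodesic_ray (ray_pt x \<xi>) x \<xi>"
  using assms by (auto simp: geodesic_ray_def geodesic_on_def ray_pt_hyp hdist_ray_pt ray_pt_tendsto)

text \<open>This is what turns limits of \<open>cosh\<close> of distances, suitably rescaled, into
  values of \<open>lor\<close> on null vectors.\<close>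

lemma hlift_at_boundary:
  fixes X :: "'b \<Rightarrow> 'a::euclidean_space"
  assumes X: "\<And>n. X n \<in> hyp" and lim: "(X \<longlongrightarrow> \<xi>) F" and \<xi>: "\<xi> \<in> hyp_boundary"
  shows "filterlim (\<lambda>n. fst (hlift (X n))) at_top F"
    and "((\<lambda>n. (1 / fst (hlift (X n))) *\<^sub>R hlift (X n)) \<longlongrightarrow> nul \<xi>) F"
proof -
  have n: "((\<lambda>n. 1 - (norm (X n))\<^sup>2) \<longlongrightarrow> 1 - (norm \<xi>)\<^sup>2) F" by (intro tendsto_intros lim)
  have "filterlim (\<lambda>n. 1 - (norm (X n))\<^sup>2) (at_right 0) F"
    unfolding filterlim_at using n \<xi> hyp_pos[OF X] by (auto simp: boundary_iff less_imp_neq)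
  from filterlim_compose[OF filterlim_inverse_at_top_right this]
  have "filterlim (\<lambda>n. inverse (1 - (norm (X n))\<^sup>2)) at_top F" .
  then show "filterlim (\<lambda>n. fst (hlift (X n))) at_top F"
  proof (rule filterlim_at_top_mono, intro always_eventually allI)
    show "inverse (1 - (norm (X n))\<^sup>2) \<le> fst (hlift (X n))" for n
      using hyp_pos[OF X[of n]] by (simp add: hlift_def field_simps)
  qed
  have e: "(1 / fst (hlift (X n))) *\<^sub>R hlift (X n) = (1, (2 / (1 + (norm (X n))\<^sup>2)) *\<^sub>R X n)" for n
  proof -
    have "1 + (norm (X n))\<^sup>2 > 0" by (simp add: add_pos_nonneg)
    moreover have "(1 / (b / a)) *\<^sub>R (b / a, (2 / a) *\<^sub>R x) = (1, (2 / b) *\<^sub>R x)" if "a > 0" "b > 0" for a b :: real and x :: 'a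
      using that by simp
    ultimately show ?thesis using hyp_pos[OF X[of n]] unfolding hlift_def fst_conv by blast
  qed
  have "((\<lambda>n. (1::real, (2 / (1 + (norm (X n))\<^sup>2)) *\<^sub>R X n)) \<longlongrightarrow> (1, (2 / (1 + (norm \<xi>)\<^sup>2)) *\<^sub>R \<xi>)) F"
    by (intro tendsto_intros lim) (simp add: boundary_iff[THEN iffD1, OF \<xi>])
  then show "((\<lambda>n. (1 / fst (hlift (X n))) *\<^sub>R hlift (X n)) \<longlongrightarrow> nul \<xi>) F"
    using \<xi> unfolding e by (simp add: nul_def boundary_iff)
qed

lemma tendsto_lor:
  "(P \<longlongrightarrow> p) F \<Longrightarrow> (Q \<longlongrightarrow> q) F \<Longrightarrow> ((\<lambda>n. lor (P n) (Q n)) \<longlongrightarrow> lor p q) F"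
  unfolding lor_def by (intro tendsto_intros)

lemma cosh_hdist_at_boundary:
  assumes "\<And>n. X n \<in> hyp" "(X \<longlongrightarrow> \<xi>) F" "\<xi> \<in> hyp_boundary" "y \<in> hyp"
  shows "((\<lambda>n. cosh (hdist y (X n)) / fst (hlift (X n))) \<longlongrightarrow> busemann \<xi> y) F"
proof -
  have "((\<lambda>n. lor (hlift y) ((1 / fst (hlift (X n))) *\<^sub>R hlift (X n))) \<longlongrightarrow> lor (hlift y) (nul \<xi>)) F"
    by (intro tendsto_lor hlift_at_boundary assms tendsto_const)
  then show ?thesis using assms by (simp add: lor_hlift busemann_def)
qed

text \<open>A limit inside the ball would keep the distance from \<open>c s\<close> bounded, while
  it equals \<open>t - s\<close>.\<close>

lemma geodesic_ray_boundary:
  assumes "geodesic_on {s..} c" "(c \<longlongrightarrow> \<xi>) at_top"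
  shows "\<xi> \<in> hyp_boundary"
proof -
  have c: "c t \<in> hyp" "hdist (c s) (c t) = t - s" if "t \<ge> s" for t
    using assms(1) that by (auto simp: geodesic_on_def)
  have ev: "eventually (\<lambda>t. t \<ge> s) at_top" by (rule eventually_ge_at_top)
  have n: "((\<lambda>t. norm (c t)) \<longlongrightarrow> norm \<xi>) at_top" by (intro tendsto_intros assms)
  have "norm \<xi> \<le> 1"
  proof (rule tendsto_upperbound[OF n])
    show "\<forall>\<^sub>F t in at_top. norm (c t) \<le> 1"
      using ev by eventually_elim (use c(1) in \<open>auto simp: hyp_iff less_imp_le\<close>)
  qed simp
  moreover have False if "norm \<xi> < 1"
  proof -
    have xi: "1 - (norm \<xi>)\<^sup>2 \<noteq> 0" using that hyp_pos[of \<xi>] by (simp add: hyp_iff)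
    have "1 - (norm (c s))\<^sup>2 \<noteq> 0" using hyp_pos[of "c s"] c[of s] by simp
    then have lim: "((\<lambda>t. 1 + 2 * (norm (c s - c t))\<^sup>2 / ((1 - (norm (c s))\<^sup>2) * (1 - (norm (c t))\<^sup>2))) \<longlongrightarrow>
          1 + 2 * (norm (c s - \<xi>))\<^sup>2 / ((1 - (norm (c s))\<^sup>2) * (1 - (norm \<xi>)\<^sup>2))) at_top"
      by (intro tendsto_intros assms) (use xi in auto)
    have "eventually (\<lambda>t. 1 + 2 * (norm (c s - c t))\<^sup>2 / ((1 - (norm (c s))\<^sup>2) * (1 - (norm (c t))\<^sup>2)) = cosh (t - s)) at_top"
      using ev by eventually_elim (use c in \<open>simp add: cosh_hdist_formula[symmetric]\<close>)
    with lim have "((\<lambda>t. cosh (t - s)) \<longlongrightarrow> 1 + 2 * (norm (c s - \<xi>))\<^sup>2 / ((1 - (norm (c s))\<^sup>2) * (1 - (norm \<xi>)\<^sup>2))) at_top"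
      by (simp add: tendsto_cong)
    moreover have "filterlim (\<lambda>t. cosh (t - s)) at_top at_top"
      by (rule filterlim_compose[OF cosh_real_at_top]) (real_asymp)
    ultimately show False
      using not_tendsto_and_filterlim_at_infinity[OF trivial_limit_at_top_linorder] filterlim_at_top_imp_at_infinity by blast
  qed
  ultimately show ?thesis by (force simp: boundary_iff)
qed

text \<open>A far point of the geodesic is nearer to \<open>c r\<close> than to \<open>c s\<close>
  by exactly \<open>r - s\<close>, and the ratio of the two values of \<open>cosh\<close> tends to
  the ratio of the Busemann values.\<close>

lemma busemann_along_geodesic:
  assumes "geodesic_on {s..} c" "(c \<longlongrightarrow> \<xi>) at_top" "r \<ge> s"
  shows "busemann \<xi> (c r) = exp (- (r - s)) * busemann \<xi> (c s)"
proof -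
  have \<xi>: "\<xi> \<in> hyp_boundary" using geodesic_ray_boundary assms by blast
  have c: "c t \<in> hyp" "t \<ge> r \<Longrightarrow> hdist (c r) (c t) = t - r" "hdist (c s) (c t) = t - s" if "t \<ge> s" for t
    using assms(1,3) that by (auto simp: geodesic_on_def)
  \<comment> \<open>Nothing is known about \<open>c\<close> before \<open>s\<close>;
    \<open>X\<close> is a modification that stays in \<open>hyp\<close> for all arguments.\<close>
  define X where "X t = (if t \<ge> s then c t else c s)" for t
  have Xh: "X t \<in> hyp" for t using c(1) by (simp add: X_def)
  have ev: "eventually (\<lambda>t. t \<ge> r) at_top" by (rule eventually_ge_at_top)
  then have evX: "eventually (\<lambda>t. c t = X t) at_top" by eventually_elim (use assms(3) in \<open>simp add: X_def\<close>)
  have Xl: "(X \<longlongrightarrow> \<xi>) at_top" using assms(2) tendsto_cong[OF evX] by blast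
  have 1: "((\<lambda>n. cosh (hdist (c r) (X n)) / fst (hlift (X n))) \<longlongrightarrow> busemann \<xi> (c r)) at_top"
   and 2: "((\<lambda>n. cosh (hdist (c s) (X n)) / fst (hlift (X n))) \<longlongrightarrow> busemann \<xi> (c s)) at_top"
    using c assms(3) by (auto intro!: cosh_hdist_at_boundary Xh Xl \<xi>)
  have b: "busemann \<xi> (c s) > 0" by (rule busemann_pos) (use c \<xi> in auto)
  from tendsto_divide[OF 1 2] b
  have 3: "((\<lambda>n. cosh (hdist (c r) (X n)) / fst (hlift (X n)) / (cosh (hdist (c s) (X n)) / fst (hlift (X n)))) \<longlongrightarrow>
     busemann \<xi> (c r) / busemann \<xi> (c s)) at_top" by simp
  have "eventually (\<lambda>n. cosh (hdist (c r) (X n)) / fst (hlift (X n)) / (cosh (hdist (c s) (X n)) / fst (hlift (X n)))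
      = cosh (n - r) / cosh (n - s)) at_top"
    using ev
  proof eventually_elim
    case (elim n)
    have "X n = c n" using elim assms(3) by (simp add: X_def)
    then show ?case using fst_hlift_pos[OF Xh[of n]] c[of n] elim assms(3) by simp
  qed
  with 3 have 4: "((\<lambda>n. cosh (n - r) / cosh (n - s)) \<longlongrightarrow> busemann \<xi> (c r) / busemann \<xi> (c s)) at_top"
    by (simp add: tendsto_cong)
  have "((\<lambda>n::real. cosh (n - r) / cosh (n - s)) \<longlongrightarrow> exp (- (r - s))) at_top"
  proof -
    have e: "cosh (n - r) / cosh (n - s) = (exp (-r) + exp r * exp (-2*n)) / (exp (-s) + exp s * exp (-2*n))" for n :: real
    proof -
      have "cosh (n - u) = exp n / 2 * (exp (-u) + exp u * exp (-2*n))" for u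
        by (simp add: cosh_def exp_diff exp_minus field_simps flip: exp_add)
      from this[of r] this[of s] show ?thesis
        by (metis (no_types, opaque_lifting) exp_gt_zero half_gt_zero_iff mult_divide_mult_cancel_left_if order_less_irrefl)
    qed
    have z: "((\<lambda>n::real. exp (-2*n)) \<longlongrightarrow> 0) at_top" by real_asymp
    have "((\<lambda>n::real. (exp (-r) + exp r * exp (-2*n)) / (exp (-s) + exp s * exp (-2*n))) \<longlongrightarrow> (exp (-r) + exp r * 0) / (exp (-s) + exp s * 0)) at_top"
      by (intro tendsto_intros z) simp
    then show ?thesis unfolding e by (simp add: exp_minus exp_diff field_simps)
  qed
  with 4 have "busemann \<xi> (c r) / busemann \<xi> (c s) = exp (- (r - s))"
    using tendsto_unique trivial_limit_at_top_linorder by blast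
  then show ?thesis using b by (simp add: field_simps)
qed

text \<open>The two data determine the form of the lift of \<open>z\<close> with
  \<open>rvec\<close>, and its value is 1, so the two points are at distance 0. This gives the
  uniqueness of rays and, later, the equivariance of rays towards a fixed boundary point.\<close>

lemma ray_pt_unique:
  assumes "y \<in> hyp" "z \<in> hyp" "\<xi> \<in> hyp_boundary" "t \<ge> 0"
    and "hdist y z = t" "busemann \<xi> z = exp (- t) * busemann \<xi> y"
  shows "z = ray_pt y \<xi> t"
proof -
  define w where "w = ray_pt y \<xi> t"
  have w: "w \<in> hyp" "hlift w = rvec y \<xi> t" unfolding w_def by (intro ray_pt_hyp assms)+
  have b: "busemann \<xi> y > 0" using busemann_pos assms by blast
  have "cosh (hdist z w) = lor (hlift z) (rvec y \<xi> t)" using w assms by (simp add: lor_hlift flip: w(2))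
  also have "\<dots> = exp (-t) * cosh t + sinh t * exp (-t)"
    using b assms by (simp add: rvec_def lor_hlift flip: busemann_def) (simp add: hdist_commute)
  also have "\<dots> = 1" by (simp add: cosh_def sinh_def exp_minus field_simps)
  finally have "hdist z w = 0" using cosh_eq_imp[of "hdist z w" 0] assms w by simp
  then show ?thesis using hdist_eq_0 assms w w_def by blast
qed

lemma geodesic_eq_ray_pt:
  assumes "geodesic_on {s..} c" "(c \<longlongrightarrow> \<xi>) at_top" "t \<ge> s"
  shows "c t = ray_pt (c s) \<xi> (t - s)"
proof (rule ray_pt_unique)
  show "\<xi> \<in> hyp_boundary" using geodesic_ray_boundary assms by blast
  show "busemann \<xi> (c t) = exp (- (t - s)) * busemann \<xi> (c s)"
    by (rule busemann_along_geodesic) fact+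
qed (use assms in \<open>auto simp: geodesic_on_def\<close>)

lemma hray_eq:
  assumes "x \<in> hyp" "\<xi> \<in> hyp_boundary" "t \<ge> 0"
  shows "hray x \<xi> t = ray_pt x \<xi> t"
proof -
  have "geodesic_ray (hray x \<xi>) x \<xi>"
    unfolding hray_def by (rule someI[of "\<lambda>c. geodesic_ray c x \<xi>", OF geodesic_ray_ray_pt[OF assms(1,2)]])
  then show ?thesis using geodesic_eq_ray_pt[of 0 "hray x \<xi>" \<xi> t] assms by (simp add: geodesic_ray_def)
qed

text \<open>This turns out to be 1 minus the cosine of the angle at \<open>x\<close> between the two
  rays.\<close>

definition vis_gap :: "'a::euclidean_space \<Rightarrow> 'a \<Rightarrow> 'a \<Rightarrow> real" where
  "vis_gap x \<xi> \<eta> = lor (nul \<xi>) (nul \<eta>) / (busemann \<xi> x * busemann \<eta> x)"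

text \<open>The hyperbolic law of cosines at the vertex \<open>x\<close>, once
  \<open>vis_gap\<close> is read as 1 minus the cosine of the angle.\<close>

lemma cosh_hdist_rays:
  assumes "x \<in> hyp" "\<xi> \<in> hyp_boundary" "\<eta> \<in> hyp_boundary" "s \<ge> 0" "t \<ge> 0"
  shows "cosh (hdist (ray_pt x \<xi> s) (ray_pt x \<eta> t)) = cosh (s - t) + vis_gap x \<xi> \<eta> * sinh s * sinh t"
proof -
  have b: "busemann \<xi> x > 0" "busemann \<eta> x > 0" using busemann_pos assms by blast+
  have "cosh (hdist (ray_pt x \<xi> s) (ray_pt x \<eta> t)) = lor (rvec x \<xi> s) (rvec x \<eta> t)"
    using assms by (simp add: ray_pt_hyp flip: lor_hlift)
  also have "\<dots> = exp (-s) * exp (-t) + exp (-s) * sinh t + exp (-t) * sinh s + vis_gap x \<xi> \<eta> * sinh s * sinh t"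
    using b by (simp add: rvec_def lor_hlift_self[OF assms(1)] vis_gap_def
       busemann_def lor_commute[of "nul \<xi>" "hlift x"] algebra_simps)
  also have "exp (-s) * exp (-t) + exp (-s) * sinh t + exp (-t) * sinh s = cosh (s - t)"
    by (rule exp_sinh_cosh_identity)
  finally show ?thesis .
qed

text \<open>\<open>U\<close> is the initial velocity of the lifted ray, and the right side is its
  image under the differential of \<open>hproj\<close>.\<close>

lemma hray_derivative:
  assumes "x \<in> hyp" "\<xi> \<in> hyp_boundary"
  defines "U \<equiv> (1 / busemann \<xi> x) *\<^sub>R nul \<xi> - hlift x"
  shows "vector_derivative (hray x \<xi>) (at 0 within {0..}) = (1 / (1 + fst (hlift x))) *\<^sub>R (snd U - fst U *\<^sub>R x)"
proof -
  define X where "X = hlift x"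
  define b where "b = busemann \<xi> x"
  have X: "fst X > 0" using fst_hlift_pos[OF assms(1)] by (simp add: X_def)
  have x: "x = (1 / (1 + fst X)) *\<^sub>R snd X" using hproj_hlift[OF assms(1)] by (simp add: X_def hproj_def)
  define T where "T t = exp (-t) * fst X + sinh t / b" for t
  define V where "V t = exp (-t) *\<^sub>R snd X + (sinh t / b) *\<^sub>R \<xi>" for t
  have rp: "ray_pt x \<xi> t = (1 / (1 + T t)) *\<^sub>R V t" for t
    by (simp add: ray_pt_def hproj_def rvec_def T_def V_def X_def b_def nul_def)
  have U: "fst U = 1 / b - fst X" "snd U = (1 / b) *\<^sub>R \<xi> - snd X"
    by (auto simp: U_def X_def b_def nul_def)
  have T: "(T has_real_derivative fst U) (at 0 within {0..})"
    unfolding T_def U using busemann_pos[OF assms(1,2)] by (auto intro!: derivative_eq_intros simp: b_def)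
  have V: "(V has_vector_derivative snd U) (at 0 within {0..})"
    unfolding V_def U using busemann_pos[OF assms(1,2)] by (auto intro!: derivative_eq_intros simp: has_real_derivative_iff_has_vector_derivative[symmetric] b_def)
  have T0: "T 0 = fst X" and V0: "V 0 = snd X" by (auto simp: T_def V_def)
  have "((\<lambda>t. 1 / (1 + T t)) has_real_derivative - fst U / (1 + fst X)\<^sup>2) (at 0 within {0..})"
    using X by (auto intro!: derivative_eq_intros T simp: T0 power2_eq_square)
  from has_vector_derivative_scaleR[OF this V]
  have "((\<lambda>t. (1 / (1 + T t)) *\<^sub>R V t) has_vector_derivative
      (1 / (1 + T 0)) *\<^sub>R snd U + (- fst U / (1 + fst X)\<^sup>2) *\<^sub>R V 0) (at 0 within {0..})" by simp
  also have "(1 / (1 + T 0)) *\<^sub>R snd U + (- fst U / (1 + fst X)\<^sup>2) *\<^sub>R V 0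
     = (1 / (1 + fst X)) *\<^sub>R (snd U - fst U *\<^sub>R x)"
  proof -
    have "fst U *\<^sub>R x = (fst U / (1 + fst X)) *\<^sub>R snd X" by (subst x) simp
    then show ?thesis by (simp add: T0 V0 scaleR_diff_right power2_eq_square)
  qed
  finally have "((\<lambda>t. (1 / (1 + T t)) *\<^sub>R V t) has_vector_derivative
      (1 / (1 + fst X)) *\<^sub>R (snd U - fst U *\<^sub>R x)) (at 0 within {0..})" .
  then have "(hray x \<xi> has_vector_derivative (1 / (1 + fst X)) *\<^sub>R (snd U - fst U *\<^sub>R x)) (at 0 within {0..})"
    by (rule has_vector_derivative_transform[rotated 2]) (use assms in \<open>auto simp: hray_eq rp\<close>)
  moreover have "at (0::real) within {0..} \<noteq> bot"
    using trivial_limit_at_right_real[of 0] by (metis at_within_Ici_at_right)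
  ultimately show ?thesis
    by (simp add: X_def vector_derivative_within)
qed

text \<open>The differential of \<open>hproj\<close> is a similarity: up to the factor
  \<open>k\<^sup>2\<close>, the inner product of two images is minus the Lorentz form of the tangent
  vectors. The Euclidean angle is thus the Lorentz angle of the velocities \<open>U\<close>, which
  have Lorentz square -1.\<close>

lemma cos_visual_dist:
  assumes "x \<in> hyp" "\<xi> \<in> hyp_boundary" "\<eta> \<in> hyp_boundary"
  shows "0 \<le> visual_dist x \<xi> \<eta>" "visual_dist x \<xi> \<eta> \<le> pi" "cos (visual_dist x \<xi> \<eta>) = 1 - vis_gap x \<xi> \<eta>"
proof -
  define X where "X = hlift x"
  define U where "U \<zeta> = (1 / busemann \<zeta> x) *\<^sub>R nul \<zeta> - X" for \<zeta>
  define k where "k = 1 / (1 + fst X)"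
  have X: "fst X > 0" using fst_hlift_pos[OF assms(1)] by (simp add: X_def)
  have XX: "lor X X = 1" using lor_hlift_self[OF assms(1)] by (simp add: X_def)
  have x: "x = k *\<^sub>R snd X" using hproj_hlift[OF assms(1)] by (simp add: X_def hproj_def k_def)
  have k: "k > 0" "1 = k * (1 + fst X)" using X by (auto simp: k_def)
  define u where "u \<zeta> = snd (U \<zeta>) - fst (U \<zeta>) *\<^sub>R x" for \<zeta>
  have der: "vector_derivative (hray x \<zeta>) (at 0 within {0..}) = k *\<^sub>R u \<zeta>" if "\<zeta> \<in> hyp_boundary" for \<zeta>
    using hray_derivative[OF assms(1) that] by (simp add: k_def u_def U_def X_def)
  have UX: "lor (U \<zeta>) X = 0" if "\<zeta> \<in> hyp_boundary" for \<zeta>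
    using busemann_pos[OF assms(1) that] XX
    by (simp add: U_def X_def busemann_def lor_commute[of "nul \<zeta>"])
  have inner: "u \<zeta> \<bullet> u \<theta> = - lor (U \<zeta>) (U \<theta>)" if "\<zeta> \<in> hyp_boundary" "\<theta> \<in> hyp_boundary" for \<zeta> \<theta>
  proof -
    define p q where "p = U \<zeta>" "q = U \<theta>"
    have 1: "snd p \<bullet> snd X = fst p * fst X" "snd q \<bullet> snd X = fst q * fst X"
      using UX[OF that(1)] UX[OF that(2)] by (auto simp: p_q_def lor_def)
    have 2: "snd X \<bullet> snd X = (fst X)\<^sup>2 - 1" using XX by (simp add: lor_def power2_eq_square)
    have "u \<zeta> \<bullet> u \<theta> = snd p \<bullet> snd q - fst q * k * (snd p \<bullet> snd X) - fst p * k * (snd q \<bullet> snd X)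
        + fst p * fst q * k\<^sup>2 * (snd X \<bullet> snd X)"
      unfolding u_def p_q_def[symmetric] x
      by (simp add: inner_diff_left inner_diff_right inner_commute power2_eq_square algebra_simps)
    also have "\<dots> = snd p \<bullet> snd q + fst p * fst q * (- 2 * k * fst X + k\<^sup>2 * ((fst X)\<^sup>2 - 1))"
      unfolding 1 2 by (simp add: algebra_simps)
    also have "- 2 * k * fst X + k\<^sup>2 * ((fst X)\<^sup>2 - 1) = -1"
    proof -
      have "k\<^sup>2 * ((fst X)\<^sup>2 - 1) = (k * (1 + fst X)) * (k * (fst X - 1))"
        by (simp add: power2_eq_square algebra_simps)
      also have "\<dots> = k * (fst X - 1)" using k by simp
      finally have "- 2 * k * fst X + k\<^sup>2 * ((fst X)\<^sup>2 - 1) = - (k * (1 + fst X))" by (simp add: algebra_simps)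
      with k show ?thesis by simp
    qed
    finally show ?thesis by (simp add: p_q_def lor_def)
  qed
  have UU: "lor (U \<zeta>) (U \<theta>) = vis_gap x \<zeta> \<theta> - 1" if "\<zeta> \<in> hyp_boundary" "\<theta> \<in> hyp_boundary" for \<zeta> \<theta>
    using busemann_pos[OF assms(1) that(1)] busemann_pos[OF assms(1) that(2)] XX
    by (simp add: U_def vis_gap_def X_def busemann_def lor_commute[of "nul \<zeta>" "hlift x"] field_simps)
  have nrm: "norm (u \<zeta>) = 1" if "\<zeta> \<in> hyp_boundary" for \<zeta>
    using inner[OF that that] UU[OF that that] lor_nul_self[OF that]
    by (simp add: norm_eq_sqrt_inner vis_gap_def)
  have e: "(k *\<^sub>R u \<xi>) \<bullet> (k *\<^sub>R u \<eta>) / (norm (k *\<^sub>R u \<xi>) * norm (k *\<^sub>R u \<eta>)) = 1 - vis_gap x \<xi> \<eta>"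
    using k(1) assms by (simp add: nrm inner UU)
  have V: "visual_dist x \<xi> \<eta> = arccos (1 - vis_gap x \<xi> \<eta>)"
    using e unfolding visual_dist_def Let_def by (simp add: der assms)
  have "\<bar>u \<xi> \<bullet> u \<eta>\<bar> \<le> 1" using Cauchy_Schwarz_ineq2[of "u \<xi>" "u \<eta>"] by (simp add: nrm assms)
  then have "\<bar>1 - vis_gap x \<xi> \<eta>\<bar> \<le> 1" by (simp add: inner UU assms)
  then have "-1 \<le> 1 - vis_gap x \<xi> \<eta>" "1 - vis_gap x \<xi> \<eta> \<le> 1" by linarith+
  then show "0 \<le> visual_dist x \<xi> \<eta>" "visual_dist x \<xi> \<eta> \<le> pi" "cos (visual_dist x \<xi> \<eta>) = 1 - vis_gap x \<xi> \<eta>"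
    unfolding V by (auto simp: arccos_lbound arccos_ubound cos_arccos)
qed

section \<open>Gromov products at infinity\<close>

lemma exp_le_two_cosh: "exp t \<le> 2 * cosh t" for t :: real
  by (simp add: cosh_def)

lemma sqrt_hyp_le:
  assumes "x \<in> hyp" shows "sqrt (1 - (norm x)\<^sup>2) \<le> 2 * exp (- (hdist 0 x / 2))"
proof -
  have "cosh (hdist 0 x) = 1 + 2 * (norm x)\<^sup>2 / (1 - (norm x)\<^sup>2)"
    using cosh_hdist_formula[OF zero_hyp assms] by simp
  then have "1 - (norm x)\<^sup>2 = 2 / (cosh (hdist 0 x) + 1)"
  proof -
    have "a = 2 / (c + 1)" if "c = 1 + 2 * (1 - a) / a" "a > 0" for a c :: real
    proof -
      have "a * (c + 1) = 2" using that by (simp add: field_simps)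
      then show ?thesis using that(2) by (metis nonzero_mult_div_cancel_right mult_zero_right zero_neq_numeral)
    qed
    from this[of "cosh (hdist 0 x)" "1 - (norm x)\<^sup>2"] show ?thesis
      using hyp_pos[OF assms] \<open>cosh (hdist 0 x) = _\<close> by simp
  qed
  also have "\<dots> \<le> 2 / (exp (hdist 0 x) / 2)"
  proof (intro divide_left_mono)
    show "exp (hdist 0 x) / 2 \<le> cosh (hdist 0 x) + 1"
      using exp_le_two_cosh[of "hdist 0 x"] by linarith
  qed (auto simp: add_pos_pos)
  also have "\<dots> = (2 * exp (- (hdist 0 x / 2)))\<^sup>2"
    by (simp add: power_mult_distrib exp_minus power2_eq_square field_simps flip: exp_add)
  finally show ?thesis by (intro real_le_lsqrt) auto
qed

text \<open>The bridge from coarse geometry to the topology of the closed ball: sequences whose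
  Gromov products tend to infinity become Cauchy.\<close>

lemma norm_diff_le_gp:
  assumes "x \<in> hyp" "y \<in> hyp" shows "norm (x - y) \<le> 2 * exp (- gp 0 x y)"
proof -
  have "sinh (hdist x y / 2) \<le> exp (hdist x y / 2) / 2" by (simp add: sinh_def)
  then have "norm (x - y) \<le> (exp (hdist x y / 2) / 2) * ((2 * exp (- (hdist 0 x / 2))) * (2 * exp (- (hdist 0 y / 2))))"
    unfolding norm_diff_hyp[OF assms]
    using sqrt_hyp_le[OF assms(1)] sqrt_hyp_le[OF assms(2)] hyp_pos[OF assms(1)] hyp_pos[OF assms(2)]
    by (intro mult_mono) auto
  also have "\<dots> = 2 * exp (hdist x y / 2 + (- (hdist 0 x / 2)) + (- (hdist 0 y / 2)))"
    by (simp only: exp_add)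
  also have "hdist x y / 2 + (- (hdist 0 x / 2)) + (- (hdist 0 y / 2)) = - gp 0 x y"
    by (simp add: gp_def field_simps)
  finally show ?thesis .
qed

lemma norm_less_of_hdist_le:
  "\<exists>r<1. \<forall>x::'a::euclidean_space. x \<in> hyp \<longrightarrow> hdist 0 x \<le> R \<longrightarrow> norm x \<le> r"
proof -
  define k where "k = 2 / (cosh R + 1)"
  have k: "0 < k" "k \<le> 1" using cosh_real_ge_1[of R] by (auto simp: k_def field_simps)
  show ?thesis
  proof (intro exI[of _ "sqrt (1 - k)"] conjI allI impI)
    show "sqrt (1 - k) < 1" using k by simp
    fix x :: 'a assume x: "x \<in> hyp" "hdist 0 x \<le> R"
    have "cosh (hdist 0 x) \<le> cosh R" using x hdist_nonneg[OF zero_hyp x(1)]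
      by (metis cosh_real_nonneg_le_iff order_trans)
    then have "1 + 2 * (norm x)\<^sup>2 / (1 - (norm x)\<^sup>2) \<le> cosh R"
      using cosh_hdist_formula[OF zero_hyp x(1)] by simp
    then have "(norm x)\<^sup>2 \<le> 1 - k"
      using hyp_pos[OF x(1)] cosh_real_ge_1[of R] by (simp add: k_def field_simps)
    then show "norm x \<le> sqrt (1 - k)" by (simp add: real_le_rsqrt)
  qed
qed

text \<open>By \<open>norm_diff_hyp\<close> the Euclidean size of a hyperbolic ball of fixed radius
  is at most a multiple of the conformal factor at its centre, which tends to 0 at the
  boundary.\<close>

lemma tendsto_boundary_bounded:
  fixes X Y :: "'b \<Rightarrow> 'a::euclidean_space"
  assumes X: "\<And>n. X n \<in> hyp" and Y: "\<And>n. Y n \<in> hyp" and \<xi>: "\<xi> \<in> hyp_boundary" and lim: "(X \<longlongrightarrow> \<xi>) F"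
    and K: "\<And>n. hdist (X n) (Y n) \<le> K"
  shows "(Y \<longlongrightarrow> \<xi>) F"
proof -
  have "((\<lambda>n. sinh (K / 2) * sqrt (1 - (norm (X n))\<^sup>2)) \<longlongrightarrow> sinh (K/2) * sqrt (1 - (norm \<xi>)\<^sup>2)) F"
    by (intro tendsto_intros lim)
  then have z: "((\<lambda>n. sinh (K / 2) * sqrt (1 - (norm (X n))\<^sup>2)) \<longlongrightarrow> 0) F"
    using \<xi> by (simp add: boundary_iff)
  have "norm (X n - Y n) \<le> sinh (K / 2) * sqrt (1 - (norm (X n))\<^sup>2)" for n
  proof -
    have "sqrt (1 - (norm (Y n))\<^sup>2) \<le> 1" by simp
    then have "norm (X n - Y n) \<le> sinh (hdist (X n) (Y n) / 2) * (sqrt (1 - (norm (X n))\<^sup>2) * 1)"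
      unfolding norm_diff_hyp[OF X Y] using hyp_pos[OF X, of n] X[of n] Y[of n]
      by (intro mult_left_mono) auto
    also have "\<dots> \<le> sinh (K / 2) * (sqrt (1 - (norm (X n))\<^sup>2) * 1)"
      using hyp_pos[OF X, of n] K[of n] by (intro mult_right_mono) auto
    finally show ?thesis by simp
  qed
  then have "((\<lambda>n. X n - Y n) \<longlongrightarrow> 0) F"
    by (intro Lim_null_comparison[OF _ z]) simp
  from tendsto_diff[OF lim this] show ?thesis by simp
qed

text \<open>Up to a factor, \<open>exp (- 2 * gp p x y)\<close> is a quotient of values of
  \<open>cosh\<close>. After rescaling, its numerator tends to the form of the null vector with
  itself, which is 0.\<close>

lemma gp_at_boundary:
  fixes X Y :: "'b \<Rightarrow> 'a::euclidean_space"
  assumes X: "\<And>n. X n \<in> hyp" "(X \<longlongrightarrow> \<xi>) F" and Y: "\<And>n. Y n \<in> hyp" "(Y \<longlongrightarrow> \<xi>) F"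
    and \<xi>: "\<xi> \<in> hyp_boundary" and p: "p \<in> hyp"
  shows "filterlim (\<lambda>n. gp p (X n) (Y n)) at_top F"
proof -
  define x y where "x n = fst (hlift (X n))" and "y n = fst (hlift (Y n))" for n
  have pos: "x n > 0" "y n > 0" for n using X Y fst_hlift_pos by (auto simp: x_def y_def)
  have b: "busemann \<xi> p > 0" by (rule busemann_pos) fact+
  have 1: "((\<lambda>n. cosh (hdist p (X n)) / x n) \<longlongrightarrow> busemann \<xi> p) F"
    and 2: "((\<lambda>n. cosh (hdist p (Y n)) / y n) \<longlongrightarrow> busemann \<xi> p) F"
    unfolding x_def y_def by (intro cosh_hdist_at_boundary assms)+
  have "((\<lambda>n. lor ((1 / x n) *\<^sub>R hlift (X n)) ((1 / y n) *\<^sub>R hlift (Y n))) \<longlongrightarrow> lor (nul \<xi>) (nul \<xi>)) F"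
    unfolding x_def y_def by (intro tendsto_lor hlift_at_boundary assms)
  then have 3: "((\<lambda>n. cosh (hdist (X n) (Y n)) / (x n * y n)) \<longlongrightarrow> 0) F"
    using X Y \<xi> by (simp add: lor_hlift lor_nul_self field_simps)
  have "((\<lambda>n. 2 * (cosh (hdist (X n) (Y n)) / (x n * y n) /
         ((cosh (hdist p (X n)) / x n) * (cosh (hdist p (Y n)) / y n)))) \<longlongrightarrow> 2 * (0 / (busemann \<xi> p * busemann \<xi> p))) F"
    by (intro tendsto_intros 1 2 3) (use b in auto)
  then have 4: "((\<lambda>n. 2 * (cosh (hdist (X n) (Y n)) / (x n * y n) /
         ((cosh (hdist p (X n)) / x n) * (cosh (hdist p (Y n)) / y n)))) \<longlongrightarrow> 0) F" by simp
  have le: "exp (- 2 * gp p (X n) (Y n)) \<le> 2 * (cosh (hdist (X n) (Y n)) / (x n * y n) /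
         ((cosh (hdist p (X n)) / x n) * (cosh (hdist p (Y n)) / y n)))" for n
  proof -
    have ch: "cosh u \<le> exp u" if "u \<ge> 0" for u :: real using that by (simp add: cosh_def)
    have "exp (- 2 * gp p (X n) (Y n)) = exp (hdist (X n) (Y n)) / (exp (hdist p (X n)) * exp (hdist p (Y n)))"
      unfolding gp_def by (simp add: exp_diff exp_add[symmetric] flip: exp_diff)
    also have "\<dots> \<le> (2 * cosh (hdist (X n) (Y n))) / (cosh (hdist p (X n)) * cosh (hdist p (Y n)))"
    proof (rule frac_le)
      show "exp (hdist (X n) (Y n)) \<le> 2 * cosh (hdist (X n) (Y n))" by (simp add: cosh_def)
      show "cosh (hdist p (X n)) * cosh (hdist p (Y n)) \<le> exp (hdist p (X n)) * exp (hdist p (Y n))"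
        using X Y p by (intro mult_mono ch) auto
    qed auto
    also have "\<dots> = 2 * (cosh (hdist (X n) (Y n)) / (x n * y n) /
         ((cosh (hdist p (X n)) / x n) * (cosh (hdist p (Y n)) / y n)))"
      using pos[of n] by simp
    finally show ?thesis .
  qed
  have "((\<lambda>n. exp (- 2 * gp p (X n) (Y n))) \<longlongrightarrow> 0) F"
    by (rule tendsto_sandwich[OF _ _ tendsto_const 4]) (use le in auto)
  note lim = order_tendstoD(2)[OF this]
  show ?thesis unfolding filterlim_at_top
  proof
    fix Z
    have "eventually (\<lambda>n. exp (- 2 * gp p (X n) (Y n)) < exp (- 2 * Z)) F" by (rule lim) simp
    then show "eventually (\<lambda>n. Z \<le> gp p (X n) (Y n)) F" by eventually_elim simp
  qed
qed

lemma gp_basepoint: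
  assumes "p \<in> hyp" "q \<in> hyp" "x \<in> hyp" "y \<in> hyp"
  shows "gp q x y \<le> gp p x y + hdist q p"
  using hdist_triangle[of q p x] hdist_triangle[of q p y] assms unfolding gp_def by argo

text \<open>The sequence is Cauchy by \<open>norm_diff_le_gp\<close>; the case \<open>m = k\<close>
  makes the distances from \<open>z\<close> tend to infinity, so the limit has norm 1.\<close>

lemma gp_convergent:
  fixes p :: "nat \<Rightarrow> 'a::euclidean_space"
  assumes p: "\<And>n. p n \<in> hyp" and o: "z \<in> hyp" and f: "filterlim f at_top sequentially"
    and g: "\<And>m k. m \<le> k \<Longrightarrow> f m \<le> gp z (p m) (p k)"
  shows "\<exists>\<xi>\<in>hyp_boundary. p \<longlonglongrightarrow> \<xi>"
proof -
  define c where "c = hdist z 0"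
  have g0: "f m - c \<le> gp 0 (p m) (p k)" if "m \<le> k" for m k
    using g[OF that] gp_basepoint[of 0 z "p m" "p k"] p o by (simp add: c_def)
  have lim: "(\<lambda>m. 2 * exp (c - f m)) \<longlonglongrightarrow> 0"
  proof -
    have "filterlim (\<lambda>m. c - f m) at_bot sequentially"
      unfolding filterlim_at_bot
    proof
      fix Z
      have "eventually (\<lambda>n. c - Z \<le> f n) sequentially" using f by (simp add: filterlim_at_top)
      then show "eventually (\<lambda>n. c - f n \<le> Z) sequentially" by eventually_elim simp
    qed
    from tendsto_mult[OF tendsto_const[of 2] filterlim_compose[OF exp_at_bot this]] show ?thesis by simp
  qed
  have nd: "norm (p m - p k) \<le> 2 * exp (c - f m)" if "m \<le> k" for m k
  proof -
    have "norm (p m - p k) \<le> 2 * exp (- gp 0 (p m) (p k))" by (intro norm_diff_le_gp p)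
    also have "\<dots> \<le> 2 * exp (c - f m)" using g0[OF that] by simp
    finally show ?thesis .
  qed
  have "Cauchy p"
  proof (rule CauchyI')
    fix e :: real assume "e > 0"
    from order_tendstoD(2)[OF lim this] obtain M where M: "\<And>m. m \<ge> M \<Longrightarrow> 2 * exp (c - f m) < e"
      by (auto simp: eventually_sequentially)
    show "\<exists>M. \<forall>m\<ge>M. \<forall>n>m. dist (p m) (p n) < e"
    proof (intro exI allI impI)
      fix m n assume "M \<le> m" "m < n"
      then show "dist (p m) (p n) < e" using M[of m] nd[of m n] by (simp add: dist_norm)
    qed
  qed
  then obtain \<xi> where \<xi>: "p \<longlonglongrightarrow> \<xi>" using Cauchy_convergent convergent_def by blast
  have "(\<lambda>n. norm (sqrt (1 - (norm (p n))\<^sup>2))) \<longlonglongrightarrow> norm (sqrt (1 - (norm \<xi>)\<^sup>2))"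
    by (intro tendsto_intros \<xi>)
  moreover have "(\<lambda>n. norm (sqrt (1 - (norm (p n))\<^sup>2))) \<longlonglongrightarrow> 0"
  proof (rule tendsto_sandwich[OF _ _ tendsto_const])
    show "eventually (\<lambda>n. norm (sqrt (1 - (norm (p n))\<^sup>2)) \<le> 2 * exp ((c - f n) / 2)) sequentially"
    proof (intro always_eventually allI)
      fix n
      have "f n - c \<le> hdist 0 (p n)" using g0[of n n] by (simp add: gp_def)
      then have "2 * exp (- (hdist 0 (p n) / 2)) \<le> 2 * exp ((c - f n) / 2)" by simp
      then show "norm (sqrt (1 - (norm (p n))\<^sup>2)) \<le> 2 * exp ((c - f n) / 2)"
        using order_trans[OF sqrt_hyp_le[OF p[of n]]] hyp_pos[OF p[of n]] by simp
    qed
    have "(\<lambda>m. 2 * sqrt (2 * exp (c - f m) / 2)) \<longlonglongrightarrow> 2 * sqrt (0 / 2)" by (intro tendsto_intros lim) simp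
    moreover have "sqrt (2 * exp (c - f m) / 2) = exp ((c - f m) / 2)" for m
      by (rule real_sqrt_unique) (auto simp: power2_eq_square simp flip: exp_add)
    ultimately show "(\<lambda>n. 2 * exp ((c - f n) / 2)) \<longlonglongrightarrow> 0" by simp
  qed simp
  ultimately have "norm (sqrt (1 - (norm \<xi>)\<^sup>2)) = 0" using LIMSEQ_unique by blast
  then have "(norm \<xi>)\<^sup>2 = 1" by simp
  then have "\<xi> \<in> hyp_boundary" by (simp add: boundary_iff power2_eq_1_iff) (smt (verit) norm_ge_zero)
  with \<xi> show ?thesis by blast
qed

text \<open>The bound \<open>C\<close> says that \<open>p\<close> is near the segments from
  \<open>z\<close> to \<open>X n\<close>. Passing from \<open>X n\<close> to a late point of the ray
  and from there to the point at time \<open>hdist z p\<close> uses hyperbolicity twice, at the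
  price of 3 each; a loss in the Gromov product counts twice in the distance, whence
  \<open>2 * C + 12\<close>.\<close>

lemma ray_near_point:
  assumes o: "z \<in> hyp" and \<xi>: "\<xi> \<in> hyp_boundary" and X: "\<And>n. X n \<in> hyp" "X \<longlonglongrightarrow> \<xi>" and p: "p \<in> hyp"
    and C: "eventually (\<lambda>n. gp p z (X n) \<le> C) sequentially"
  shows "hdist p (ray_pt z \<xi> (hdist z p)) \<le> 2 * C + 12"
proof -
  define t where "t = hdist z p"
  have t: "t \<ge> 0" using o p by (simp add: t_def)
  define c where "c s = ray_pt z \<xi> s" for s
  have c: "c s \<in> hyp" "hdist z (c s) = s" if "s \<ge> 0" for s
    using that hdist_ray_pt[OF o \<xi>, of 0 s] ray_pt_hyp[OF o \<xi>] o by (auto simp: c_def)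
  have "filterlim real at_top sequentially" by (rule filterlim_real_sequentially)
  then have "(\<lambda>n. c (real n)) \<longlonglongrightarrow> \<xi>" unfolding c_def
    using filterlim_compose[OF ray_pt_tendsto[OF o \<xi>]] by blast
  then have "filterlim (\<lambda>n. gp z (X n) (c (real n))) at_top sequentially"
    by (intro gp_at_boundary[OF X(1) X(2) _ _ \<xi> o] c) auto
  then have "eventually (\<lambda>n. t \<le> gp z (X n) (c (real n))) sequentially" by (simp add: filterlim_at_top)
  then have "eventually (\<lambda>n. t \<le> gp z (X n) (c (real n)) \<and> gp p z (X n) \<le> C \<and> t \<le> real n) sequentially"
    using C filterlim_real_sequentially[unfolded filterlim_at_top, rule_format, of t] by (intro eventually_conj)
  from eventually_happens'[OF sequentially_bot this]
  obtain n where n: "t \<le> gp z (X n) (c (real n))" "gp p z (X n) \<le> C" "t \<le> real n"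
    by blast
  have 1: "gp z p (X n) \<ge> t - C"
    using n(2) by (simp add: gp_def t_def hdist_commute field_simps)
  have "hdist (c (real n)) (c t) = real n - t" using hdist_ray_pt[OF o \<xi>, of "real n" t] n(3) t by (simp add: c_def)
  then have 2: "gp z (c (real n)) (c t) = t" using t c[of "real n"] c[of t] by (simp add: gp_def)
  have C0: "C \<ge> 0" using gp_nonneg[OF p o X(1)] n(2) by (rule order_trans)
  have 3: "t - C - 3 \<le> gp z p (c (real n))"
    using gp_hyperbolic[OF o p X(1)[of n] c(1)[of "real n"]] 1 n(1) C0 by (auto simp: min_def split: if_splits)
  have "t - C - 6 \<le> gp z p (c t)"
    using gp_hyperbolic[OF o p c(1)[of "real n"] c(1)[OF t]] 2 3 C0 by (auto simp: min_def split: if_splits)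
  then have "hdist p (c t) \<le> 2 * C + 12" using c(2)[OF t] by (simp add: gp_def t_def field_simps)
  then show ?thesis by (simp add: c_def t_def)
qed

text \<open>The law of cosines gives at most \<open>1 + 1/8\<close> for \<open>cosh\<close> of the
  distance. The purpose is the contrapositive: rays that have separated by time \<open>T\<close>
  make an angle larger than \<open>exp (- T)\<close>.\<close>

lemma rays_close_of_visual_dist:
  assumes "x \<in> hyp" "\<xi> \<in> hyp_boundary" "\<eta> \<in> hyp_boundary" "T \<ge> 0" "visual_dist x \<xi> \<eta> \<le> exp (- T)"
  shows "hdist (ray_pt x \<xi> T) (ray_pt x \<eta> T) \<le> 2"
proof -
  define th where "th = visual_dist x \<xi> \<eta>"
  have th: "0 \<le> th" "cos th = 1 - vis_gap x \<xi> \<eta>" "th \<le> exp (- T)"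
    using cos_visual_dist[OF assms(1-3)] assms(5) by (auto simp: th_def)
  have "(sin (th / 2))\<^sup>2 \<le> (th / 2)\<^sup>2"
    using abs_sin_x_le_abs_x[of "th/2"] by (simp only: abs_le_square_iff)
  moreover have "cos th = 1 - 2 * (sin (th/2))\<^sup>2" using cos_double_sin[of "th/2"] by simp
  ultimately have g: "vis_gap x \<xi> \<eta> \<le> th\<^sup>2 / 2" using th(2) by (simp add: power_divide)
  have "0 \<le> sinh T" using assms by simp
  moreover have "sinh T \<le> exp T / 2" by (simp add: sinh_def)
  ultimately have s: "(sinh T)\<^sup>2 \<le> (exp T / 2)\<^sup>2" by (intro power_mono)
  have "vis_gap x \<xi> \<eta> * (sinh T)\<^sup>2 \<le> (exp (-T))\<^sup>2 / 2 * (exp T / 2)\<^sup>2"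
    using order_trans[OF g divide_right_mono[OF power_mono[OF th(3,1), of 2], of 2]] s by (intro mult_mono) auto
  also have "\<dots> = 1 / 8" by (simp add: exp_minus power2_eq_square field_simps)
  finally have "cosh (hdist (ray_pt x \<xi> T) (ray_pt x \<eta> T)) \<le> 1 + 1/8"
    using cosh_hdist_rays[OF assms(1-4) assms(4)] by (simp add: power2_eq_square mult.assoc)
  also have "\<dots> \<le> cosh 2"
    using exp_ge_add_one_self[of "2::real"] exp_le_two_cosh[of 2] by linarith
  finally show ?thesis
    using cosh_le_imp[of "hdist (ray_pt x \<xi> T) (ray_pt x \<eta> T)" 2]
      hdist_nonneg[OF ray_pt_hyp(1)[OF assms(1,2,4)] ray_pt_hyp(1)[OF assms(1,3,4)]] by simp
qed

text \<open>A quarter of the angle stays below \<open>pi / 4\<close>, where the cosine is at least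
  \<open>sqrt 2 / 2\<close> and \<open>z * cos z \<le> sin z\<close>; doubling twice expresses
  \<open>1 - cos t\<close> by \<open>sin z * cos z\<close>.\<close>

lemma square_le_one_minus_cos:
  assumes "0 \<le> t" "t \<le> pi" shows "t\<^sup>2 \<le> 8 * (1 - cos t)"
proof -
  define z where "z = t / 4"
  have z: "0 \<le> z" "z \<le> pi / 4" using assms by (auto simp: z_def)
  have "sqrt 2 / 2 \<le> cos z"
    using cos_monotone_0_pi_le[of z "pi/4"] z by (simp add: cos_45)
  then have "(sqrt 2 / 2)\<^sup>2 \<le> (cos z)\<^sup>2" by (intro power_mono) auto
  then have c: "1 / 2 \<le> (cos z)\<^sup>2" by (simp add: power_divide)
  have s: "z * cos z \<le> sin z"
  proof (cases "z = 0")
    case False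
    then have "0 < z" using z by simp
    from MVT2[OF this, of sin cos] obtain u where u: "0 < u" "u < z" "sin z - sin 0 = (z - 0) * cos u"
      by (auto intro: DERIV_sin)
    have "cos z \<le> cos u" using u z by (intro cos_monotone_0_pi_le) auto
    then show ?thesis using u z by (simp add: mult_left_mono)
  qed simp
  have "0 \<le> cos z" using z by (intro cos_ge_zero) auto
  with s z have "(z * cos z)\<^sup>2 \<le> (sin z)\<^sup>2" by (intro power_mono) auto
  then have "z\<^sup>2 * (cos z)\<^sup>2 * (cos z)\<^sup>2 \<le> (sin z)\<^sup>2 * (cos z)\<^sup>2"
    by (intro mult_right_mono) (auto simp: power_mult_distrib)
  moreover have "z\<^sup>2 * (1/2) * (1/2) \<le> z\<^sup>2 * (cos z)\<^sup>2 * (cos z)\<^sup>2"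
    using c by (intro mult_mono) auto
  moreover have "1 - cos t = 8 * ((sin z)\<^sup>2 * (cos z)\<^sup>2)"
    using cos_double_sin[of "2 * z"] sin_double[of z] by (simp add: z_def power_mult_distrib)
  ultimately have "8 * (z\<^sup>2 / 4) \<le> 1 - cos t" by argo
  then show ?thesis by (simp add: z_def power_divide)
qed

text \<open>This will bound the diameter of shadows. Different times are allowed, because the law of
  cosines bounds \<open>vis_gap\<close> by \<open>cosh\<close> of the distance for any two points of
  the rays.\<close>

lemma visual_dist_le_of_rays_close:
  assumes "x \<in> hyp" "\<xi> \<in> hyp_boundary" "\<eta> \<in> hyp_boundary" "s \<ge> L" "t \<ge> L" "L \<ge> 1"
    "hdist (ray_pt x \<xi> s) (ray_pt x \<eta> t) \<le> K"
  shows "visual_dist x \<xi> \<eta> \<le> 16 * cosh K * exp (- L)"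
proof -
  define th where "th = visual_dist x \<xi> \<eta>"
  have th: "0 \<le> th" "th \<le> pi" "cos th = 1 - vis_gap x \<xi> \<eta>"
    using cos_visual_dist[OF assms(1-3)] by (auto simp: th_def)
  have sq: "th\<^sup>2 \<le> 8 * vis_gap x \<xi> \<eta>" using square_le_one_minus_cos[OF th(1,2)] th(3) by simp
  have g: "vis_gap x \<xi> \<eta> \<ge> 0" using th(3) cos_le_one[of th] by linarith
  have lo: "exp L / 4 \<le> sinh u" if "u \<ge> L" for u
  proof -
    have "exp (- u) \<le> exp u * exp (-1)" unfolding exp_add[symmetric] using that assms by simp
    also have "\<dots> \<le> exp u * (1/2)"
      using exp_ge_add_one_self[of 1] by (intro mult_left_mono) (auto simp: exp_minus field_simps)
    finally have "exp u / 4 \<le> sinh u" by (simp add: sinh_def)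
    moreover have "exp L \<le> exp u" using that by simp
    ultimately show ?thesis by linarith
  qed
  have nn: "0 \<le> hdist (ray_pt x \<xi> s) (ray_pt x \<eta> t)"
    using ray_pt_hyp(1)[OF assms(1,2), of s] ray_pt_hyp(1)[OF assms(1,3), of t] assms(4-6) by simp
  have "vis_gap x \<xi> \<eta> * (exp L / 4 * (exp L / 4)) \<le> vis_gap x \<xi> \<eta> * (sinh s * sinh t)"
    using lo assms g by (intro mult_left_mono mult_mono) auto
  also have "\<dots> \<le> cosh (hdist (ray_pt x \<xi> s) (ray_pt x \<eta> t))"
    using cosh_hdist_rays[OF assms(1-3), of s t] assms cosh_real_pos[of "s - t"] by (simp add: mult.assoc)
  also have "\<dots> \<le> cosh K" using assms(7) nn by (metis cosh_real_nonneg_le_iff order_trans)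
  finally have "vis_gap x \<xi> \<eta> \<le> 16 * cosh K * (exp (- L))\<^sup>2"
    by (simp add: exp_minus field_simps power2_eq_square)
  with sq have "th\<^sup>2 \<le> 128 * cosh K * (exp (- L))\<^sup>2" by simp
  also have "\<dots> \<le> 256 * (cosh K)\<^sup>2 * (exp (-L))\<^sup>2"
    using cosh_real_ge_1[of K] by (intro mult_right_mono) (auto simp: power2_eq_square intro: order_trans[OF _ mult_left_mono[of 1]])
  also have "\<dots> = (16 * cosh K * exp (- L))\<^sup>2" by (simp add: power_mult_distrib)
  finally show ?thesis unfolding th_def by (rule power2_le_imp_le) simp
qed

text \<open>The hyperbolic analogue of spherical interpolation. The right side has Lorentz square 1,
  hence is a lift, and its form with the lift of \<open>\<gamma> (s + r)\<close> is 1, so both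
  points are at distance 0.\<close>

lemma segment_point:
  assumes \<gamma>: "geodesic_on {s..s'} \<gamma>" and r: "0 \<le> r" "r \<le> s' - s" "s < s'"
  shows "hlift (\<gamma> (s + r)) = (sinh (s' - s - r) / sinh (s' - s)) *\<^sub>R hlift (\<gamma> s) + (sinh r / sinh (s' - s)) *\<^sub>R hlift (\<gamma> s')"
    (is "_ = ?W")
proof -
  define D where "D = s' - s"
  define u where "u = D - r"
  have D: "sinh D > 0" "D = u + r" and u: "u \<ge> 0" using r by (auto simp: D_def u_def)
  have h: "\<gamma> s \<in> hyp" "\<gamma> s' \<in> hyp" "\<gamma> (s + r) \<in> hyp" "hdist (\<gamma> s) (\<gamma> s') = D"
      "hdist (\<gamma> (s + r)) (\<gamma> s) = r" "hdist (\<gamma> (s + r)) (\<gamma> s') = u"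
    using \<gamma> r by (auto simp: geodesic_on_def D_def u_def)
  have W: "?W = (1 / sinh D) *\<^sub>R (sinh u *\<^sub>R hlift (\<gamma> s) + sinh r *\<^sub>R hlift (\<gamma> s'))"
    by (simp add: D_def[symmetric] u_def[symmetric] scaleR_add_right)
  have c2: "cosh t * cosh t = 1 + sinh t * sinh t" for t :: real
    using cosh_square_eq[of t] by (simp add: power2_eq_square)
  have "lor ?W ?W = (1 / sinh D)\<^sup>2 * (sinh u * sinh u + sinh r * sinh r + 2 * (sinh u * sinh r * cosh D))"
    unfolding W using h lor_commute[of "hlift (\<gamma> s')" "hlift (\<gamma> s)"]
    by (simp add: lor_hlift power2_eq_square algebra_simps)
  also have "sinh u * sinh u + sinh r * sinh r + 2 * (sinh u * sinh r * cosh D)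
     = (sinh u * sinh u) * (cosh r * cosh r) + (cosh u * cosh u) * (sinh r * sinh r) + 2 * (sinh u * cosh r) * (cosh u * sinh r)"
    unfolding D(2) cosh_add c2 by (simp add: algebra_simps)
  also have "\<dots> = (sinh D)\<^sup>2" unfolding D(2) sinh_add by (simp add: power2_eq_square algebra_simps)
  finally have WW: "lor ?W ?W = 1" using D(1) by (simp add: power_divide)
  have Wpos: "fst ?W > 0"
  proof (cases "u = 0")
    case True then show ?thesis using D fst_hlift_pos h unfolding W by simp
  next
    case False
    then have "0 < sinh u * fst (hlift (\<gamma> s))" using u fst_hlift_pos[OF h(1)] by simp
    moreover have "0 \<le> sinh r * fst (hlift (\<gamma> s'))" using r fst_hlift_pos[OF h(2)] by simp
    ultimately show ?thesis using D unfolding W by simp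
  qed
  have "lor ?W (hlift (\<gamma> (s + r))) = (1 / sinh D) * (sinh u * cosh r + sinh r * cosh u)"
    unfolding W using h by (simp add: lor_commute[of _ "hlift (\<gamma> (s + r))"] lor_hlift)
  also have "sinh u * cosh r + sinh r * cosh u = sinh D" unfolding D(2) sinh_add by simp
  finally have "lor ?W (hlift (\<gamma> (s + r))) = 1" using D by simp
  then have "cosh (hdist (hproj ?W) (\<gamma> (s + r))) = 1"
    using hproj_works[OF WW Wpos] h(3) by (simp flip: lor_hlift)
  then have "hdist (hproj ?W) (\<gamma> (s + r)) = 0"
    using cosh_eq_imp[of "hdist (hproj ?W) (\<gamma> (s + r))" 0] hproj_works[OF WW Wpos] h(3) by simp
  then have "hproj ?W = \<gamma> (s + r)" by (rule hdist_eq_0[OF hproj_works(1)[OF WW Wpos] h(3)])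
  then show ?thesis using hproj_works(2)[OF WW Wpos] by metis
qed

section \<open>Convergence of geodesics and chains\<close>

lemma sinh_le_exp_half: "sinh u \<le> exp u / 2" for u :: real
  by (simp add: sinh_def)

text \<open>
  The error \<open>e\<close> is uniform on the compact piece \<open>{s..s'}\<close> of the ray, because the lifted ray is
  a combination of two fixed vectors.
\<close>

lemma cosh_hdist_along_geodesic:
  fixes X :: "nat \<Rightarrow> 'a::euclidean_space"
  assumes c: "geodesic_on {s..} c" "(c \<longlongrightarrow> b) at_top" and "s \<le> s'"
    and X: "\<And>n. X n \<in> hyp" "X \<longlonglongrightarrow> \<zeta>" and \<zeta>: "\<zeta> \<in> hyp_boundary"
  shows "\<exists>e. e \<longlonglongrightarrow> 0 \<and> (\<forall>n. \<forall>t\<in>{s..s'}.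
     cosh (hdist (c t) (X n)) \<le> fst (hlift (X n)) * (busemann \<zeta> (c t) + e n))"
proof -
  have b: "b \<in> hyp_boundary" by (rule geodesic_ray_boundary) fact+
  have cs: "c s \<in> hyp" using c by (auto simp: geodesic_on_def)
  define \<beta> where "\<beta> = busemann b (c s)"
  have \<beta>: "\<beta> > 0" unfolding \<beta>_def by (rule busemann_pos) fact+
  define Y where "Y n = (1 / fst (hlift (X n))) *\<^sub>R hlift (X n)" for n
  have Y: "Y \<longlonglongrightarrow> nul \<zeta>" unfolding Y_def by (rule hlift_at_boundary(2)) fact+
  define e1 where "e1 n = \<bar>lor (hlift (c s)) (Y n) - lor (hlift (c s)) (nul \<zeta>)\<bar>" for n
  define e2 where "e2 n = \<bar>lor (nul b) (Y n) - lor (nul b) (nul \<zeta>)\<bar>" for n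
  define e where "e n = e1 n + sinh (s' - s) / \<beta> * e2 n" for n
  have "e1 \<longlonglongrightarrow> \<bar>lor (hlift (c s)) (nul \<zeta>) - lor (hlift (c s)) (nul \<zeta>)\<bar>"
    unfolding e1_def by (intro tendsto_intros tendsto_lor Y)
  moreover have "e2 \<longlonglongrightarrow> \<bar>lor (nul b) (nul \<zeta>) - lor (nul b) (nul \<zeta>)\<bar>"
    unfolding e2_def by (intro tendsto_intros tendsto_lor Y)
  ultimately have "e \<longlonglongrightarrow> 0 + sinh (s' - s) / \<beta> * 0"
    unfolding e_def by (intro tendsto_intros) auto
  moreover have "cosh (hdist (c t) (X n)) \<le> fst (hlift (X n)) * (busemann \<zeta> (c t) + e n)"
    if t: "t \<in> {s..s'}" for n t
  proof -
    have ct: "c t \<in> hyp" using c t by (auto simp: geodesic_on_def)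
    have "c t = ray_pt (c s) b (t - s)" by (rule geodesic_eq_ray_pt[OF c]) (use t in simp)
    then have "hlift (c t) = rvec (c s) b (t - s)" using ray_pt_hyp(2)[OF cs b] t by simp
    then have L: "lor (hlift (c t)) N = exp (- (t - s)) * lor (hlift (c s)) N + sinh (t - s) / \<beta> * lor (nul b) N" for N
      by (simp add: rvec_def \<beta>_def)
    have "cosh (hdist (c t) (X n)) = fst (hlift (X n)) * lor (hlift (c t)) (Y n)"
      unfolding Y_def lor_linear lor_hlift[OF ct X(1)] using fst_hlift_pos[OF X(1)[of n]] by simp
    moreover have "lor (hlift (c t)) (Y n) \<le> busemann \<zeta> (c t) + e n"
    proof -
      have "lor (hlift (c t)) (Y n) - busemann \<zeta> (c t)
        = exp (- (t - s)) * (lor (hlift (c s)) (Y n) - lor (hlift (c s)) (nul \<zeta>))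
          + sinh (t - s) / \<beta> * (lor (nul b) (Y n) - lor (nul b) (nul \<zeta>))"
        unfolding busemann_def L by (simp add: algebra_simps)
      also have "\<dots> \<le> 1 * e1 n + sinh (s' - s) / \<beta> * e2 n"
      proof (rule add_mono)
        have "exp (- (t - s)) * (lor (hlift (c s)) (Y n) - lor (hlift (c s)) (nul \<zeta>)) \<le> exp (- (t - s)) * e1 n"
          by (intro mult_left_mono) (auto simp: e1_def)
        also have "\<dots> \<le> 1 * e1 n" using t by (intro mult_right_mono) (auto simp: e1_def)
        finally show "exp (- (t - s)) * (lor (hlift (c s)) (Y n) - lor (hlift (c s)) (nul \<zeta>)) \<le> 1 * e1 n" .
        have "sinh (t - s) / \<beta> * (lor (nul b) (Y n) - lor (nul b) (nul \<zeta>)) \<le> sinh (t - s) / \<beta> * e2 n"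
          using t \<beta> by (intro mult_left_mono) (auto simp: e2_def)
        also have "\<dots> \<le> sinh (s' - s) / \<beta> * e2 n"
          using t \<beta> by (intro mult_right_mono divide_right_mono) (auto simp: e2_def)
        finally show "sinh (t - s) / \<beta> * (lor (nul b) (Y n) - lor (nul b) (nul \<zeta>)) \<le> sinh (s' - s) / \<beta> * e2 n" .
      qed
      finally show ?thesis by (simp add: e_def)
    qed
    ultimately show ?thesis using fst_hlift_pos[OF X(1)[of n]] by simp
  qed
  ultimately show ?thesis by (intro exI[of _ e]) auto
qed

text \<open>Divided by the two heights, \<open>cosh\<close> of the distance tends to the form of the
  two null vectors, which is positive because they are distinct; the heights tend to
  infinity.\<close>

lemma hdist_at_distinct_boundary:
  fixes X Y :: "'b \<Rightarrow> 'a::euclidean_space"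
  assumes X: "\<And>n. X n \<in> hyp" "(X \<longlongrightarrow> a) F" "a \<in> hyp_boundary"
    and Y: "\<And>n. Y n \<in> hyp" "(Y \<longlongrightarrow> b) F" "b \<in> hyp_boundary" and ab: "a \<noteq> b"
  shows "filterlim (\<lambda>n. hdist (X n) (Y n)) at_top F"
proof -
  define p q where "p n = fst (hlift (X n))" and "q n = fst (hlift (Y n))" for n
  define D where "D n = hdist (X n) (Y n)" for n
  have pq: "p n > 0" "q n > 0" for n
    using fst_hlift_pos[OF X(1)] fst_hlift_pos[OF Y(1)] by (simp_all add: p_def q_def)
  have pl: "filterlim p at_top F" and ql: "filterlim q at_top F"
    unfolding p_def q_def by (intro hlift_at_boundary(1)[OF X] hlift_at_boundary(1)[OF Y])+
  define \<beta> where "\<beta> = lor (nul a) (nul b)"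
  have "norm (a - b) > 0" using ab by simp
  then have \<beta>: "\<beta> > 0" unfolding \<beta>_def lor_nul_norm[OF X(3) Y(3)] by simp
  define B where "B n = cosh (D n) / (p n * q n)" for n
  have "((\<lambda>n. lor ((1 / p n) *\<^sub>R hlift (X n)) ((1 / q n) *\<^sub>R hlift (Y n))) \<longlongrightarrow> \<beta>) F"
    unfolding p_def q_def \<beta>_def by (intro tendsto_lor hlift_at_boundary(2) X Y)
  then have Bl: "(B \<longlongrightarrow> \<beta>) F"
    by (simp add: B_def[abs_def] D_def lor_hlift X Y mult.commute)
  have coshD: "cosh (D n) = B n * (p n * q n)" for n using pq[of n] by (simp add: B_def)
  have "filterlim (\<lambda>n. p n * q n) at_top F" by (intro filterlim_at_top_mult_at_top pl ql)
  then have C: "filterlim (\<lambda>n. cosh (D n)) at_top F"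
    unfolding coshD by (rule filterlim_tendsto_pos_mult_at_top[OF Bl \<beta>])
  have "filterlim D at_top F" unfolding filterlim_at_top
  proof
    fix Z
    have "eventually (\<lambda>n. cosh Z \<le> cosh (D n)) F" using C by (simp add: filterlim_at_top)
    then show "eventually (\<lambda>n. Z \<le> D n) F"
    proof eventually_elim
      case (elim n)
      have "0 \<le> D n" using X Y by (simp add: D_def)
      show ?case
      proof (rule ccontr)
        assume "\<not> Z \<le> D n"
        then have "cosh (D n) < cosh Z" using \<open>0 \<le> D n\<close> by (intro cosh_real_strict_mono) auto
        with elim show False by simp
      qed
    qed
  qed
  then show ?thesis by (simp add: D_def[abs_def])
qed

text \<open>
  The shift \<open>r\<close> below balances the two terms of the combination in \<open>segment_point\<close>.
\<close>

lemma geodesics_converge_to_line: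
  fixes \<gamma> :: "nat \<Rightarrow> real \<Rightarrow> 'a::euclidean_space"
  assumes c: "geodesic_line c a b" and ab: "a \<noteq> b"
    and \<gamma>: "\<And>n. geodesic_on {s n..s' n} (\<gamma> n)" "\<And>n. s n < s' n"
    and lim: "(\<lambda>n. \<gamma> n (s n)) \<longlonglongrightarrow> a" "(\<lambda>n. \<gamma> n (s' n)) \<longlonglongrightarrow> b"
    and \<epsilon>: "\<epsilon> > 0"
  shows "eventually (\<lambda>n. \<exists>T. s n + R \<le> T \<and> T + R \<le> s' n \<and> (\<forall>t\<in>{-R..R}. hdist (\<gamma> n (T + t)) (c t) < \<epsilon>)) sequentially"
proof (cases "R \<ge> 0")
  case False
  \<comment> \<open>For negative \<open>R\<close> the interval \<open>{-R..R}\<close> is empty, so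
    only the two inequalities on \<open>T\<close> remain.\<close>
  then have "s n + R \<le> s n \<and> s n + R \<le> s' n" for n using \<gamma>(2)[of n] by simp
  then show ?thesis using False by (intro always_eventually allI) (auto intro!: exI[of _ "s _"])
next
  case R: True
  define c' where "c' t = c (- t)" for t
  have geo: "geodesic_on {u..} c" "geodesic_on {u..} c'" for u
    using c by (auto simp: geodesic_line_def geodesic_on_def c'_def)
  have cl: "(c \<longlongrightarrow> b) at_top" "(c' \<longlongrightarrow> a) at_top"
    using c unfolding geodesic_line_def c'_def by (auto simp: filterlim_at_bot_mirror)
  have bd: "a \<in> hyp_boundary" "b \<in> hyp_boundary"
    using geodesic_ray_boundary geo cl by blast+
  have ch: "c t \<in> hyp" for t using geo(1)[of t] by (auto simp: geodesic_on_def)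
  define P Q where "P n = \<gamma> n (s n)" and "Q n = \<gamma> n (s' n)" for n
  define p q where "p n = fst (hlift (P n))" and "q n = fst (hlift (Q n))" for n
  define D where "D n = s' n - s n" for n
  have PQ: "P n \<in> hyp" "Q n \<in> hyp" "hdist (P n) (Q n) = D n" "D n > 0" for n
    using \<gamma>(1)[of n] \<gamma>(2)[of n] by (auto simp: geodesic_on_def P_def Q_def D_def)
  have Pl: "P \<longlonglongrightarrow> a" and Ql: "Q \<longlonglongrightarrow> b" using lim by (simp_all add: P_def[abs_def] Q_def[abs_def])
  have pq: "p n > 0" "q n > 0" for n using fst_hlift_pos[OF PQ(1)] fst_hlift_pos[OF PQ(2)] by (simp_all add: p_def q_def)
  have pl: "filterlim p at_top sequentially" and ql: "filterlim q at_top sequentially"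
    unfolding p_def q_def by (intro hlift_at_boundary(1)[OF _ Pl] hlift_at_boundary(1)[OF _ Ql] PQ bd)+
  define \<beta> where "\<beta> = lor (nul a) (nul b)"
  have "norm (a - b) > 0" using ab by simp
  then have \<beta>: "\<beta> > 0" unfolding \<beta>_def lor_nul_norm[OF bd] by simp
  define B where "B n = cosh (D n) / (p n * q n)" for n
  have "(\<lambda>n. lor ((1 / p n) *\<^sub>R hlift (P n)) ((1 / q n) *\<^sub>R hlift (Q n))) \<longlonglongrightarrow> \<beta>"
    unfolding p_def q_def \<beta>_def by (intro tendsto_lor hlift_at_boundary(2) PQ Pl Ql bd)
  then have Bl: "B \<longlonglongrightarrow> \<beta>"
    by (simp add: B_def[abs_def] lor_hlift PQ mult.commute)
  have Bpos: "B n > 0" for n using pq by (simp add: B_def)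
  have coshD: "cosh (D n) = p n * q n * B n" for n using pq[of n] by (simp add: B_def)
  define a0 b0 where "a0 = busemann a (c 0)" and "b0 = busemann b (c 0)"
  have ab0: "a0 > 0" "b0 > 0" unfolding a0_def b0_def by (intro busemann_pos ch bd)+
  have bus_b: "busemann b (c t) = exp (- t) * b0" for t
  proof (cases "t \<ge> 0")
    case True then show ?thesis using busemann_along_geodesic[OF geo(1)[of 0] cl(1), of t] by (simp add: b0_def)
  next
    case False then show ?thesis using busemann_along_geodesic[OF geo(1)[of t] cl(1), of 0]
      by (simp add: b0_def exp_minus)
  qed
  have bus_a: "busemann a (c t) = exp t * a0" for t
  proof (cases "t \<le> 0")
    case True then show ?thesis using busemann_along_geodesic[OF geo(2)[of 0] cl(2), of "-t"] by (simp add: a0_def c'_def)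
  next
    case False then show ?thesis using busemann_along_geodesic[OF geo(2)[of "-t"] cl(2), of 0]
      by (simp add: a0_def c'_def exp_minus)
  qed
  \<comment> \<open>The same relation holds at every point of the line. It results from computing
    \<open>busemann a (c 1)\<close> along the line and from the lift of the ray towards
    \<open>b\<close>.\<close>
  have a0b0: "a0 * b0 = \<beta> / 2"
  proof -
    have "c 1 = ray_pt (c 0) b 1" using geodesic_eq_ray_pt[OF geo(1)[of 0] cl(1), of 1] by simp
    then have "hlift (c 1) = rvec (c 0) b 1" using ray_pt_hyp(2)[OF ch bd(2)] by simp
    then have "busemann a (c 1) = exp (-1) * a0 + sinh 1 / b0 * \<beta>"
      by (simp add: busemann_def rvec_def a0_def b0_def \<beta>_def lor_commute[of "nul b" "nul a"])
    then have "(exp 1 - exp (-1)) * a0 = sinh 1 / b0 * \<beta>" using bus_a[of 1] by (simp add: algebra_simps)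
    then have "2 * sinh 1 * a0 * b0 = sinh 1 * \<beta>" using ab0 by (simp add: sinh_field_def field_simps)
    then have "sinh (1::real) * (2 * (a0 * b0)) = sinh 1 * \<beta>" by (simp add: algebra_simps)
    then show ?thesis by simp
  qed
  obtain e1 where e1: "e1 \<longlonglongrightarrow> 0" "\<And>n t. t \<in> {-R..R} \<Longrightarrow> cosh (hdist (c t) (P n)) \<le> p n * (busemann a (c t) + e1 n)"
    using cosh_hdist_along_geodesic[OF geo(1)[of "-R"] cl(1) _ PQ(1) Pl bd(1), of R] R unfolding p_def by auto
  obtain e2 where e2: "e2 \<longlonglongrightarrow> 0" "\<And>n t. t \<in> {-R..R} \<Longrightarrow> cosh (hdist (c t) (Q n)) \<le> q n * (busemann b (c t) + e2 n)"
    using cosh_hdist_along_geodesic[OF geo(1)[of "-R"] cl(1) _ PQ(2) Ql bd(2), of R] R unfolding q_def by auto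
  \<comment> \<open>The factor \<open>exp R\<close> lets the errors be absorbed beside
    \<open>exp t\<close> and \<open>exp (- t)\<close>, so that one bound serves all \<open>t\<close>
    in \<open>{-R..R}\<close>.\<close>
  define A1 A2 where "A1 n = a0 + exp R * \<bar>e1 n\<bar>" and "A2 n = b0 + exp R * \<bar>e2 n\<bar>" for n
  have A1: "cosh (hdist (c t) (P n)) \<le> p n * (exp t * A1 n)" if t: "t \<in> {-R..R}" for t n
  proof -
    have "1 \<le> exp t * exp R" using t by (simp flip: exp_add)
    then have "1 * \<bar>e1 n\<bar> \<le> exp t * exp R * \<bar>e1 n\<bar>" by (intro mult_right_mono) auto
    then have "busemann a (c t) + e1 n \<le> exp t * A1 n"
      by (simp add: bus_a A1_def algebra_simps)
    then have "p n * (busemann a (c t) + e1 n) \<le> p n * (exp t * A1 n)" using pq[of n] by simp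
    with e1(2)[OF t, of n] show ?thesis by linarith
  qed
  have A2: "cosh (hdist (c t) (Q n)) \<le> q n * (exp (-t) * A2 n)" if t: "t \<in> {-R..R}" for t n
  proof -
    have "1 \<le> exp (-t) * exp R" using t by (simp flip: exp_add)
    then have "1 * \<bar>e2 n\<bar> \<le> exp (-t) * exp R * \<bar>e2 n\<bar>" by (intro mult_right_mono) auto
    then have "busemann b (c t) + e2 n \<le> exp (-t) * A2 n"
      by (simp add: bus_b A2_def algebra_simps)
    then have "q n * (busemann b (c t) + e2 n) \<le> q n * (exp (-t) * A2 n)" using pq[of n] by simp
    with e2(2)[OF t, of n] show ?thesis by linarith
  qed
  define r where "r n = (D n + ln (p n * a0 / (q n * b0))) / 2" for n
  define Y where "Y n = exp (r n) * (q n * b0)" for n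
  have e2r: "exp (2 * r n) = exp (D n) * (p n * a0 / (q n * b0))" for n
  proof -
    have "2 * r n = D n + ln (p n * a0 / (q n * b0))" by (simp add: r_def)
    then show ?thesis using pq[of n] ab0 by (simp add: exp_add)
  qed
  have Y': "Y n = exp (D n - r n) * (p n * a0)" for n
  proof -
    have "exp (r n) * exp (r n) = exp (D n) * (p n * a0 / (q n * b0))" using e2r[of n] by (simp flip: exp_add)
    then show ?thesis using pq[of n] ab0 unfolding Y_def by (simp add: exp_diff field_simps)
  qed
  \<comment> \<open>\<open>Y n\<close> is the common value of the two balanced weights. Its square
    is free of the shift \<open>r n\<close>, so its growth against \<open>sinh (D n)\<close> can be
    read off.\<close>
  have YY: "(Y n)\<^sup>2 = exp (D n) * cosh (D n) * (a0 * b0 / B n)" for n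
  proof -
    have "(Y n)\<^sup>2 = (exp (r n) * (q n * b0)) * (exp (D n - r n) * (p n * a0))"
      unfolding power2_eq_square using Y'[of n] by (simp add: Y_def)
    also have "\<dots> = (exp (r n) * exp (D n - r n)) * (p n * q n * (a0 * b0))" by (simp add: algebra_simps)
    also have "exp (r n) * exp (D n - r n) = exp (D n)" by (simp flip: exp_add)
    finally show ?thesis using Bpos[of n] by (simp add: coshD)
  qed
  have Dl: "filterlim D at_top sequentially"
    using hdist_at_distinct_boundary[OF PQ(1) Pl bd(1) PQ(2) Ql bd(2) ab] by (simp add: PQ(3))
  have ev1: "eventually (\<lambda>n. R \<le> r n) sequentially"
  proof -
    have "filterlim (\<lambda>n. (B n * (a0 / b0)) * (p n * p n)) at_top sequentially"
      by (rule filterlim_tendsto_pos_mult_at_top[OF tendsto_mult[OF Bl tendsto_const]])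
         (use \<beta> ab0 in \<open>auto intro: filterlim_at_top_mult_at_top pl\<close>)
    then have "eventually (\<lambda>n. exp (2 * R) \<le> (B n * (a0 / b0)) * (p n * p n)) sequentially"
      by (simp add: filterlim_at_top)
    then show ?thesis
    proof eventually_elim
      case (elim n)
      have "(B n * (a0 / b0)) * (p n * p n) = cosh (D n) * (p n * a0 / (q n * b0))"
        using pq[of n] by (simp add: coshD)
      also have "\<dots> \<le> exp (2 * r n)" unfolding e2r
        using pq[of n] ab0 PQ(4)[of n] by (intro mult_right_mono) (auto simp: cosh_def)
      finally have "exp (2 * R) \<le> exp (2 * r n)" using elim by linarith
      then show ?case by simp
    qed
  qed
  have ev2: "eventually (\<lambda>n. R \<le> D n - r n) sequentially"
  proof -
    have "filterlim (\<lambda>n. (B n * (b0 / a0)) * (q n * q n)) at_top sequentially"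
      by (rule filterlim_tendsto_pos_mult_at_top[OF tendsto_mult[OF Bl tendsto_const]])
         (use \<beta> ab0 in \<open>auto intro: filterlim_at_top_mult_at_top ql\<close>)
    then have "eventually (\<lambda>n. exp (2 * R) \<le> (B n * (b0 / a0)) * (q n * q n)) sequentially"
      by (simp add: filterlim_at_top)
    then show ?thesis
    proof eventually_elim
      case (elim n)
      have "(B n * (b0 / a0)) * (q n * q n) = cosh (D n) * (q n * b0 / (p n * a0))"
        using pq[of n] by (simp add: coshD)
      also have "\<dots> \<le> exp (D n) * (q n * b0 / (p n * a0))"
        using pq[of n] ab0 PQ(4)[of n] by (intro mult_right_mono) (auto simp: cosh_def)
      also have "\<dots> = exp (2 * (D n - r n))"
      proof -
        have "exp (2 * (D n - r n)) = exp (D n) * exp (D n) / exp (2 * r n)" by (simp flip: exp_add exp_diff)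
        then show ?thesis unfolding e2r using pq[of n] ab0 by simp
      qed
      finally have "exp (2 * R) \<le> exp (2 * (D n - r n))" using elim by linarith
      then show ?case by simp
    qed
  qed
  \<comment> \<open>A bound for \<open>cosh\<close> of the distance that is uniform in
    \<open>t\<close>; as it tends to 1, the distance falls below \<open>\<epsilon>\<close>.\<close>
  define U where "U n = Y n / sinh (D n) * (A1 n / a0 + A2 n / b0) / 2" for n
  have "U \<longlonglongrightarrow> 1 * ((a0 + exp R * \<bar>0\<bar>) / a0 + (b0 + exp R * \<bar>0\<bar>) / b0) / 2"
  proof -
    have h: "((\<lambda>x::real. exp x * cosh x / (sinh x)\<^sup>2) \<longlongrightarrow> 2) at_top"
    proof -
      have eq: "eventually (\<lambda>x::real. exp x * cosh x / (sinh x)\<^sup>2 = 2 * (1 + exp (-2 * x)) / (1 - exp (-2*x))\<^sup>2) at_top"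
        using eventually_gt_at_top[of 0]
      proof eventually_elim
        case (elim x)
        have 1: "cosh x = exp x * (1 + exp (-2 * x)) / 2" "sinh x = exp x * (1 - exp (-2 * x)) / 2"
          by (auto simp: cosh_field_def sinh_field_def algebra_simps simp flip: exp_add)
        show ?case unfolding 1 by (simp add: power2_eq_square divide_simps)
      qed
      have z: "((\<lambda>x::real. exp (-2 * x)) \<longlongrightarrow> 0) at_top" by real_asymp
      have "((\<lambda>x::real. 2 * (1 + exp (-2 * x)) / (1 - exp (-2*x))\<^sup>2) \<longlongrightarrow> 2 * (1 + 0) / (1 - 0)\<^sup>2) at_top"
        by (intro tendsto_intros z) auto
      then show ?thesis using tendsto_cong[OF eq] by simp
    qed
    have "(\<lambda>n. exp (D n) * cosh (D n) / (sinh (D n))\<^sup>2 * (a0 * b0 / B n)) \<longlonglongrightarrow> 2 * (a0 * b0 / \<beta>)"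
      by (intro tendsto_intros filterlim_compose[OF h Dl] Bl) (use \<beta> in auto)
    then have "(\<lambda>n. sqrt ((Y n / sinh (D n))\<^sup>2)) \<longlonglongrightarrow> sqrt (2 * (a0 * b0 / \<beta>))"
      by (intro tendsto_real_sqrt) (simp add: power_divide YY mult.commute)
    moreover have "sqrt ((Y n / sinh (D n))\<^sup>2) = Y n / sinh (D n)" for n
      using pq[of n] ab0 PQ(4)[of n] by (simp add: Y_def)
    ultimately have "(\<lambda>n. Y n / sinh (D n)) \<longlonglongrightarrow> 1" using \<beta> by (simp add: a0b0)
    then show ?thesis unfolding U_def A1_def A2_def
      by (intro tendsto_intros e1(1) e2(1)) (use ab0 in auto)
  qed
  then have "U \<longlonglongrightarrow> 1" using ab0 by simp
  moreover have "1 < cosh \<epsilon>" using \<epsilon> cosh_real_strict_mono[of 0 \<epsilon>] by simp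
  ultimately have "eventually (\<lambda>n. U n < cosh \<epsilon>) sequentially" by (rule order_tendstoD(2))
  with ev1 ev2 show ?thesis
  proof eventually_elim
    case (elim n)
    have "hdist (\<gamma> n (s n + r n + t)) (c t) < \<epsilon>" if t: "t \<in> {-R..R}" for t
    proof -
      define g where "g = \<gamma> n (s n + (r n + t))"
      have rt: "0 \<le> r n + t" "r n + t \<le> s' n - s n" using elim t by (auto simp: D_def)
      have g: "g \<in> hyp" using \<gamma>(1)[of n] rt by (auto simp: geodesic_on_def g_def)
      have sD: "sinh (D n) > 0" using PQ(4) by simp
      have "cosh (hdist (c t) g) = lor (hlift (c t)) (hlift g)" using ch g by (simp add: lor_hlift)
      also have "\<dots> = sinh (D n - (r n + t)) / sinh (D n) * cosh (hdist (c t) (P n))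
          + sinh (r n + t) / sinh (D n) * cosh (hdist (c t) (Q n))"
        unfolding g_def segment_point[OF \<gamma>(1) rt \<gamma>(2)]
        by (simp add: lor_hlift ch PQ flip: D_def P_def Q_def)
      also have "\<dots> \<le> (exp (D n - (r n + t)) / 2) / sinh (D n) * (p n * (exp t * A1 n))
          + (exp (r n + t) / 2) / sinh (D n) * (q n * (exp (-t) * A2 n))"
        using rt sD A1[OF t, of n] A2[OF t, of n]
        by (intro add_mono mult_mono divide_right_mono sinh_le_exp_half) (auto simp: D_def)
      also have "\<dots> = (exp (D n - r n) * p n * A1 n + exp (r n) * q n * A2 n) / sinh (D n) / 2"
      proof -
        have "exp (D n - (r n + t)) * exp t = exp (D n - r n)" "exp (r n + t) * exp (-t) = exp (r n)"
          by (simp_all flip: exp_add)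
        then show ?thesis using sD by (simp add: field_simps)
      qed
      also have "\<dots> = U n"
      proof -
        have e: "exp (D n - r n) * p n = Y n / a0" "exp (r n) * q n = Y n / b0"
          using Y'[of n] Y_def[of n] ab0 by (auto simp: field_simps)
        show ?thesis unfolding e U_def using sD ab0 by (simp add: field_simps)
      qed
      also have "\<dots> < cosh \<epsilon>" by (fact elim)
      finally have lt: "cosh (hdist (c t) g) < cosh \<epsilon>" .
      have "hdist (c t) g < \<epsilon>"
      proof (rule ccontr)
        assume "\<not> ?thesis"
        then have "cosh \<epsilon> \<le> cosh (hdist (c t) g)" using \<epsilon> by (subst cosh_real_nonneg_le_iff) auto
        with lt show False by simp
      qed
      then show ?thesis by (simp add: g_def hdist_commute add.assoc)
    qed
    then show ?case using elim by (intro exI[of _ "s n + r n"]) (auto simp: D_def)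
  qed
qed

text \<open>A local-to-global principle for quasi-geodesics. In \<open>turn\<close> the next point
  is compared with the base point \<open>z\<close> and not with the preceding point, because this is
  the form in which connecting elements provide the bound. The step length leaves room for the
  applications of hyperbolicity in \<open>gp_chain\<close>.\<close>

locale hyperbolic_chain =
  fixes p :: "nat \<Rightarrow> 'a::euclidean_space" and z :: 'a and C :: real
  assumes hyp: "\<And>n. p n \<in> hyp" "z \<in> hyp"
    and turn: "\<And>n. gp (p n) z (p (Suc n)) \<le> C"
    and step: "\<And>n. 2 * C + 10 \<le> hdist (p n) (p (Suc n))"
begin

lemma C_nonneg: "C \<ge> 0"
  using gp_nonneg[OF hyp(1) hyp(2) hyp(1)] turn order_trans by blast

text \<open>Seen from \<open>p (Suc j)\<close>, the long step and the bound there put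
  \<open>p j\<close> and \<open>p k\<close> in different directions. Hence from \<open>p j\<close>
  the points \<open>p k\<close> and \<open>p (Suc j)\<close> lie in the same direction, and the
  bound is inherited from \<open>turn\<close> with a loss of 3. The loss does not accumulate, since
  each stage starts again from \<open>turn\<close>.\<close>

lemma gp_chain:
  assumes "j < k" shows "gp (p j) z (p k) \<le> C + 3"
  using assms
proof (induction "k - j" arbitrary: j rule: less_induct)
  case less
  show ?case
  proof (cases "k = Suc j")
    case True then show ?thesis using turn[of j] by simp
  next
    case False
    then have "Suc j < k" "k - Suc j < k - j" using less.prems by auto
    then have 1: "gp (p (Suc j)) z (p k) \<le> C + 3" using less.hyps by blast
    have 2: "gp (p (Suc j)) z (p j) = hdist (p j) (p (Suc j)) - gp (p j) z (p (Suc j))"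
      by (simp add: gp_def hdist_commute field_simps)
    have 3: "gp (p (Suc j)) (p j) (p k) \<le> C + 6"
      using gp_hyperbolic[OF hyp(1) hyp(2) hyp(1) hyp(1), of "Suc j" j k] 1 2 turn[of j] step[of j] C_nonneg
      by (auto simp: min_def split: if_splits)
    have 4: "gp (p j) (p k) (p (Suc j)) = hdist (p j) (p (Suc j)) - gp (p (Suc j)) (p j) (p k)"
      by (simp add: gp_def hdist_commute field_simps)
    show ?thesis
      using gp_hyperbolic[OF hyp(1) hyp(2) hyp(1) hyp(1), of j k "Suc j"] 3 4 turn[of j] step[of j] C_nonneg
      by (auto simp: min_def split: if_splits)
  qed
qed

lemma hdist_step: "hdist z (p n) + hdist (p n) (p (Suc n)) - 2 * C \<le> hdist z (p (Suc n))"
  using turn[of n] unfolding gp_def hdist_commute[of "p n" z] by (simp add: field_simps)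

text \<open>A step of length at least \<open>2 * C + 10\<close> loses at most \<open>2 * C\<close>
  by turning.\<close>

lemma hdist_grow: "j \<le> k \<Longrightarrow> hdist z (p j) + 10 * real (k - j) \<le> hdist z (p k)"
proof (induction k)
  case (Suc k)
  show ?case
  proof (cases "j = Suc k")
    case False
    then have "j \<le> k" using Suc by simp
    then show ?thesis using Suc.IH hdist_step[of k] step[of k] by (simp add: Suc_diff_le)
  qed simp
qed simp

lemma converges: "\<exists>\<xi>\<in>hyp_boundary. p \<longlonglongrightarrow> \<xi>"
proof (rule gp_convergent[OF hyp(1) hyp(2)])
  show "filterlim (\<lambda>n. 10 * real n - C - 3) at_top sequentially" by real_asymp
  fix m k :: nat assume mk: "m \<le> k"
  have m: "10 * real m \<le> hdist z (p m)" using hdist_grow[of 0 m] hdist_nonneg[OF hyp(2) hyp(1), of 0] by (auto intro: order_trans[rotated])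
  show "10 * real m - C - 3 \<le> gp z (p m) (p k)"
  proof (cases "m = k")
    case True then show ?thesis using m C_nonneg by (simp add: gp_def)
  next
    case False
    then have "gp (p m) z (p k) \<le> C + 3" using gp_chain mk by simp
    moreover have "gp z (p m) (p k) = hdist z (p m) - gp (p m) z (p k)" by (simp add: gp_def hdist_commute field_simps)
    ultimately show ?thesis using m by simp
  qed
qed

lemma ray_near_chain:
  assumes "\<xi> \<in> hyp_boundary" "p \<longlonglongrightarrow> \<xi>"
  shows "hdist (p m) (ray_pt z \<xi> (hdist z (p m))) \<le> 2 * C + 18"
proof -
  have "eventually (\<lambda>n. gp (p m) z (p n) \<le> C + 3) sequentially"
    using eventually_gt_at_top[of m] by eventually_elim (rule gp_chain)
  from ray_near_point[OF hyp(2) assms(1) hyp(1) assms(2) hyp(1) this] show ?thesis by simp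
qed

end

section \<open>Kleinian groups and the upper bound\<close>

locale kleinian =
  fixes G :: "('g, 'r) monoid_scheme" (structure)
    and \<phi> :: "'g \<Rightarrow> 'a::euclidean_space \<Rightarrow> 'a"
    and x\<^sub>0 :: 'a
  assumes x0: "x\<^sub>0 \<in> hyp" and kleinian: "kleinian_group G \<phi>"
begin

sublocale group_action G hyp \<phi>
  using kleinian by (simp add: kleinian_group_def)

sublocale group G
  using group_hom by (simp add: group_hom_def)

abbreviation P :: "'g \<Rightarrow> 'a" where "P g \<equiv> \<phi> g x\<^sub>0"

definition len :: "'g \<Rightarrow> real" where "len g = hdist x\<^sub>0 (P g)"

lemma act_hyp [simp]: "g \<in> carrier G \<Longrightarrow> x \<in> hyp \<Longrightarrow> \<phi> g x \<in> hyp"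
  using element_image by blast

lemma P_hyp [simp]: "g \<in> carrier G \<Longrightarrow> P g \<in> hyp"
  by (simp add: x0)

lemma act_mult: "g \<in> carrier G \<Longrightarrow> h \<in> carrier G \<Longrightarrow> x \<in> hyp \<Longrightarrow> \<phi> (g \<otimes> h) x = \<phi> g (\<phi> h x)"
  by (rule composition_rule)

lemma act_one [simp]: "x \<in> hyp \<Longrightarrow> \<phi> \<one> x = x"
  using id_eq_one by (metis restrict_apply)

lemma hdist_act [simp]: "g \<in> carrier G \<Longrightarrow> x \<in> hyp \<Longrightarrow> y \<in> hyp \<Longrightarrow> hdist (\<phi> g x) (\<phi> g y) = hdist x y"
  using kleinian by (simp add: kleinian_group_def)

lemma gp_iso: "g \<in> carrier G \<Longrightarrow> p \<in> hyp \<Longrightarrow> x \<in> hyp \<Longrightarrow> y \<in> hyp \<Longrightarrow> gp (\<phi> g p) (\<phi> g x) (\<phi> g y) = gp p x y"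
  by (simp add: gp_def)

lemma act_inv_act [simp]: "g \<in> carrier G \<Longrightarrow> x \<in> hyp \<Longrightarrow> \<phi> (inv g) (\<phi> g x) = x"
  by (simp flip: act_mult)

lemma act_act_inv [simp]: "g \<in> carrier G \<Longrightarrow> x \<in> hyp \<Longrightarrow> \<phi> g (\<phi> (inv g) x) = x"
  by (simp flip: act_mult)

lemma hdist_act_left: "g \<in> carrier G \<Longrightarrow> x \<in> hyp \<Longrightarrow> y \<in> hyp \<Longrightarrow> hdist (\<phi> g x) y = hdist x (\<phi> (inv g) y)"
  using hdist_act[of "inv g" "\<phi> g x" y] by simp

lemma hdist_P: "g \<in> carrier G \<Longrightarrow> h \<in> carrier G \<Longrightarrow> hdist (P g) (P h) = len (inv g \<otimes> h)"
  by (simp add: len_def hdist_act_left x0 act_mult)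

lemma len_nonneg [simp]: "g \<in> carrier G \<Longrightarrow> 0 \<le> len g"
  by (simp add: len_def x0)

lemma len_inv [simp]: "g \<in> carrier G \<Longrightarrow> len (inv g) = len g"
  using hdist_act_left[of g x\<^sub>0 x\<^sub>0] by (simp add: len_def x0 hdist_commute)

lemma len_mult: "g \<in> carrier G \<Longrightarrow> h \<in> carrier G \<Longrightarrow> len (g \<otimes> h) \<le> len g + len h"
  using hdist_triangle[of x\<^sub>0 "P g" "P (g \<otimes> h)"] by (simp add: len_def x0 act_mult)

lemma finite_return:
  assumes "compact K" "K \<subseteq> hyp" shows "finite {g \<in> carrier G. \<phi> g ` K \<inter> K \<noteq> {}}"
  using kleinian assms by (simp add: kleinian_group_def)

text \<open>Properness in the form used for counting: a hyperbolic ball lies in a Euclidean ball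
  about 0 of radius less than 1, which is a compact part of \<open>hyp\<close>.\<close>

lemma finite_ball: "finite {g \<in> carrier G. len g \<le> R}"
proof -
  \<comment> \<open>\<open>max R 0\<close> keeps \<open>x\<^sub>0\<close> itself in the ball when
    \<open>R\<close> is negative.\<close>
  obtain r where r: "r < 1" "\<And>x::'a. x \<in> hyp \<Longrightarrow> hdist 0 x \<le> hdist 0 x\<^sub>0 + max R 0 \<Longrightarrow> norm x \<le> r"
    using norm_less_of_hdist_le by blast
  have "finite {g \<in> carrier G. \<phi> g ` cball 0 r \<inter> cball 0 r \<noteq> {}}"
    using r(1) by (intro finite_return) (auto simp: hyp_def)
  moreover have "{g \<in> carrier G. len g \<le> R} \<subseteq> {g \<in> carrier G. \<phi> g ` cball 0 r \<inter> cball 0 r \<noteq> {}}"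
  proof safe
    fix g assume g: "g \<in> carrier G" "len g \<le> R" and e: "\<phi> g ` cball 0 r \<inter> cball 0 r = {}"
    have "hdist 0 (P g) \<le> hdist 0 x\<^sub>0 + max R 0"
      using hdist_triangle[OF zero_hyp x0 P_hyp[OF g(1)]] g(2) by (simp add: len_def)
    then have "P g \<in> cball 0 r" using r(2) g(1) by simp
    moreover have "x\<^sub>0 \<in> cball 0 r" using r(2)[OF x0] by simp
    ultimately show False using e by blast
  qed
  ultimately show ?thesis by (rule finite_subset[rotated])
qed

lemma countable_carrier: "countable (carrier G)"
proof -
  have "carrier G = (\<Union>n::nat. {g \<in> carrier G. len g \<le> real n})"
  proof (intro equalityI subsetI)
    fix g assume g: "g \<in> carrier G"
    obtain n :: nat where "len g \<le> real n" using real_arch_simple by blast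
    with g show "g \<in> (\<Union>n::nat. {g \<in> carrier G. len g \<le> real n})" by auto
  qed auto
  moreover have "countable (\<Union>n::nat. {g \<in> carrier G. len g \<le> real n})"
    by (rule countable_UN[OF countableI_type]) (rule countable_finite[OF finite_ball])
  ultimately show ?thesis by metis
qed

lemma orbit_eq: "orbit G \<phi> x\<^sub>0 = P ` carrier G"
  by (auto simp: orbit_def)

lemma limit_set_sequence:
  assumes "z \<in> limit_set G \<phi> x\<^sub>0"
  obtains g where "\<And>n. g n \<in> carrier G" "(\<lambda>n. P (g n)) \<longlonglongrightarrow> z"
proof -
  have "z islimpt P ` carrier G" using assms by (simp add: limit_set_def orbit_eq)
  then obtain f where f: "\<And>n. f n \<in> P ` carrier G" "f \<longlonglongrightarrow> z"
    unfolding islimpt_sequential by blast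
  define g where "g n = inv_into (carrier G) P (f n)" for n
  have "P (g n) = f n" "g n \<in> carrier G" for n
    unfolding g_def by (intro f_inv_into_f inv_into_into f(1))+
  with f(2) that[of g] show ?thesis by simp
qed

text \<open>An interior limit point has a compact neighbourhood containing infinitely many orbit
  points. Adding \<open>x\<^sub>0\<close> to it gives a compact set that meets infinitely many of
  its translates, against properness.\<close>

lemma limit_set_boundary:
  assumes "z \<in> limit_set G \<phi> x\<^sub>0" shows "z \<in> hyp_boundary"
proof (rule ccontr)
  assume "z \<notin> hyp_boundary"
  then have z: "z \<in> hyp" using assms by (simp add: limit_set_def)
  have lim: "z islimpt P ` carrier G" using assms by (simp add: limit_set_def orbit_eq)
  obtain e where e: "e > 0" "cball z e \<subseteq> hyp"
    using z unfolding hyp_def by (metis open_contains_cball open_ball)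
  define K where "K = insert x\<^sub>0 (cball z e)"
  have fin: "finite {g \<in> carrier G. \<phi> g ` K \<inter> K \<noteq> {}}"
    using e x0 by (intro finite_return) (auto simp: K_def)
  have "P ` carrier G \<inter> ball z e \<subseteq> P ` {g \<in> carrier G. \<phi> g ` K \<inter> K \<noteq> {}}"
    by (auto simp: K_def)
  then have "finite (P ` carrier G \<inter> ball z e)" using fin finite_subset by blast
  then show False using lim e(1) by (simp add: islimpt_eq_infinite_ball)
qed

lemma infinite_carrier:
  assumes "non_elementary G \<phi> x\<^sub>0" shows "infinite (carrier G)"
proof
  assume "finite (carrier G)"
  then have "finite (P ` carrier G)" by simp
  then have "limit_set G \<phi> x\<^sub>0 = {}" by (auto simp: limit_set_def orbit_eq islimpt_finite)
  then show False using assms by (simp add: non_elementary_def)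
qed

end

section \<open>Null sets of Hausdorff measure\<close>

lemma hausdorff_premeasure_zero_iff:
  "hausdorff_premeasure X d s \<delta> A = 0 \<longleftrightarrow>
    (\<forall>\<epsilon>>0. \<exists>U. A \<subseteq> (\<Union>i. U i) \<and> (\<forall>i. U i \<subseteq> X \<and> (\<forall>x\<in>U i. \<forall>y\<in>U i. d x y \<le> \<delta>)) \<and>
       (\<Sum>i. ennreal (metric_diam d (U i) powr s)) < ennreal \<epsilon>)" (is "_ \<longleftrightarrow> ?R")
proof -
  define \<U> where "\<U> = {U :: nat \<Rightarrow> 'a set. A \<subseteq> (\<Union>i. U i) \<and> (\<forall>i. U i \<subseteq> X \<and> (\<forall>x\<in>U i. \<forall>y\<in>U i. d x y \<le> \<delta>))}"
  define S where "S U = (\<Sum>i. ennreal (metric_diam d (U i) powr s))" for U :: "nat \<Rightarrow> 'a set"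
  have "hausdorff_premeasure X d s \<delta> A = 0 \<longleftrightarrow> (INF U\<in>\<U>. S U) \<le> 0"
    by (simp add: hausdorff_premeasure_def \<U>_def S_def)
  also have "\<dots> \<longleftrightarrow> (\<forall>y>0. \<exists>U\<in>\<U>. S U < y)" by (rule INF_le_iff)
  also have "\<dots> \<longleftrightarrow> (\<forall>\<epsilon>>0. \<exists>U\<in>\<U>. S U < ennreal \<epsilon>)"
  proof safe
    fix y :: ennreal assume "0 < y" and *: "\<forall>\<epsilon>>0. \<exists>U\<in>\<U>. S U < ennreal \<epsilon>"
    then obtain \<epsilon> where "0 < \<epsilon>" "ennreal \<epsilon> \<le> y"
    proof (cases y)
      case (real r)
      then show ?thesis using \<open>0 < y\<close> that[of r] by (auto simp: ennreal_less_iff)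
    next
      case top
      then show ?thesis using that[of 1] by simp
    qed
    with * show "\<exists>U\<in>\<U>. S U < y" using order_less_le_trans by blast
  qed (auto simp: ennreal_less_iff)
  also have "\<dots> \<longleftrightarrow> ?R" by (auto simp: \<U>_def S_def)
  finally show ?thesis .
qed

lemma hausdorff_measure_zero_iff:
  "hausdorff_measure X d s A = 0 \<longleftrightarrow> (\<forall>\<delta>>0. hausdorff_premeasure X d s \<delta> A = 0)"
  unfolding hausdorff_measure_def by (auto simp: SUP_eq_iff bot_ennreal[symmetric])

lemma hausdorff_measure_zero_mono:
  assumes "hausdorff_measure X d s B = 0" "A \<subseteq> B" shows "hausdorff_measure X d s A = 0"
  using assms unfolding hausdorff_measure_zero_iff hausdorff_premeasure_zero_iff
  by (meson subset_trans)

lemma hausdorff_measure_zero_UN: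
  fixes A :: "nat \<Rightarrow> 'a set"
  assumes "\<And>n. hausdorff_measure X d s (A n) = 0"
  shows "hausdorff_measure X d s (\<Union>n. A n) = 0"
  unfolding hausdorff_measure_zero_iff hausdorff_premeasure_zero_iff
proof (intro allI impI)
  fix \<delta> \<epsilon> :: real assume "\<delta> > 0" "\<epsilon> > 0"
  \<comment> \<open>These tolerances add up to \<open>\<epsilon> / 2\<close>, which keeps the final
    inequality strict.\<close>
  have "\<exists>U. A n \<subseteq> (\<Union>i. U i) \<and> (\<forall>i. U i \<subseteq> X \<and> (\<forall>x\<in>U i. \<forall>y\<in>U i. d x y \<le> \<delta>)) \<and>
       (\<Sum>i. ennreal (metric_diam d (U i) powr s)) < ennreal (\<epsilon> / 2 * (1/2) ^ Suc n)" for n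
    using assms[of n] \<open>\<delta> > 0\<close> \<open>\<epsilon> > 0\<close> unfolding hausdorff_measure_zero_iff hausdorff_premeasure_zero_iff by simp
  then obtain U where U: "\<And>n. A n \<subseteq> (\<Union>i. U n i)" "\<And>n i. U n i \<subseteq> X"
     "\<And>n i x y. x \<in> U n i \<Longrightarrow> y \<in> U n i \<Longrightarrow> d x y \<le> \<delta>"
     "\<And>n. (\<Sum>i. ennreal (metric_diam d (U n i) powr s)) < ennreal (\<epsilon> / 2 * (1/2) ^ Suc n)"
    by metis
  define V where "V i = (case prod_decode i of (n, j) \<Rightarrow> U n j)" for i
  have "(\<Sum>i. (\<lambda>(n,j). ennreal (metric_diam d (U n j) powr s)) (prod_decode i))
     = (\<Sum>n. \<Sum>j. ennreal (metric_diam d (U n j) powr s))"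
    by (intro suminf_ennreal_2dimen) simp
  also have "\<dots> \<le> (\<Sum>n. ennreal (\<epsilon> / 2 * (1/2) ^ Suc n))"
    using U(4) by (intro suminf_le) (auto simp: less_imp_le)
  also have "\<dots> = ennreal (\<epsilon> / 2)"
    using \<open>\<epsilon> > 0\<close> sums_mult[OF power_half_series, of "\<epsilon> / 2"]
    by (intro suminf_ennreal_eq) auto
  also have "\<dots> < ennreal \<epsilon>" using \<open>\<epsilon> > 0\<close> by (simp add: ennreal_less_iff)
  finally have "(\<Sum>i. ennreal (metric_diam d (V i) powr s)) < ennreal \<epsilon>"
    by (simp add: V_def split_def)
  moreover have "(\<Union>n. A n) \<subseteq> (\<Union>i. V i)"
  proof
    fix x assume "x \<in> (\<Union>n. A n)"
    then obtain n j where "x \<in> U n j" using U(1) by blast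
    then have "x \<in> V (prod_encode (n, j))" by (simp add: V_def)
    then show "x \<in> (\<Union>i. V i)" by blast
  qed
  moreover have "\<forall>i. V i \<subseteq> X \<and> (\<forall>x\<in>V i. \<forall>y\<in>V i. d x y \<le> \<delta>)"
    using U(2,3) by (auto simp: V_def split: prod.splits)
  ultimately show "\<exists>U. (\<Union>n. A n) \<subseteq> (\<Union>i. U i) \<and> (\<forall>i. U i \<subseteq> X \<and> (\<forall>x\<in>U i. \<forall>y\<in>U i. d x y \<le> \<delta>)) \<and>
       (\<Sum>i. ennreal (metric_diam d (U i) powr s)) < ennreal \<epsilon>" by blast
qed

lemma metric_diam_le:
  assumes "\<And>x y. x \<in> U \<Longrightarrow> y \<in> U \<Longrightarrow> d x y \<le> B" "0 \<le> B"
  shows "metric_diam d U \<le> B"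
  unfolding metric_diam_def using assms by (auto intro!: cSUP_least)

text \<open>The bound \<open>B\<close> ensures that the real-valued supremum in
  \<open>metric_diam\<close> is an upper bound.\<close>

lemma le_metric_diam:
  assumes "\<And>x y. x \<in> U \<Longrightarrow> y \<in> U \<Longrightarrow> d x y \<le> B" "x \<in> U" "y \<in> U"
  shows "d x y \<le> metric_diam d U"
proof -
  have "(case (x, y) of (x, y) \<Rightarrow> d x y) \<le> (SUP (x, y)\<in>U \<times> U. d x y)"
    using assms by (intro cSUP_upper bdd_aboveI[of _ B]) auto
  then show ?thesis using assms by (auto simp: metric_diam_def)
qed

section \<open>Shadows of orbit points and the upper bound for the dimension\<close>

context kleinian
begin

definition shadow :: "real \<Rightarrow> 'g \<Rightarrow> 'a set" where
  "shadow K g = {\<xi> \<in> hyp_boundary. \<exists>t\<ge>0. hdist (ray_pt x\<^sub>0 \<xi> t) (P g) < K}"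

text \<open>Two rays in the shadow pass within \<open>2 * K\<close> of each other near
  \<open>P g\<close>, at times not before \<open>len g - K\<close>.\<close>

lemma visual_dist_shadow:
  assumes g: "g \<in> carrier G" "len g \<ge> K + 1" and \<xi>: "\<xi> \<in> shadow K g" and \<eta>: "\<eta> \<in> shadow K g"
  shows "visual_dist x\<^sub>0 \<xi> \<eta> \<le> 16 * cosh (2 * K) * exp K * exp (- len g)"
proof -
  obtain s t where st: "s \<ge> 0" "hdist (ray_pt x\<^sub>0 \<xi> s) (P g) < K" "t \<ge> 0" "hdist (ray_pt x\<^sub>0 \<eta> t) (P g) < K"
    and b: "\<xi> \<in> hyp_boundary" "\<eta> \<in> hyp_boundary"
    using \<xi> \<eta> by (auto simp: shadow_def)
  note h = ray_pt_hyp(1)[OF x0 b(1) st(1)] ray_pt_hyp(1)[OF x0 b(2) st(3)] P_hyp[OF g(1)]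
  have d: "hdist x\<^sub>0 (ray_pt x\<^sub>0 \<xi> s) = s" "hdist x\<^sub>0 (ray_pt x\<^sub>0 \<eta> t) = t"
    using hdist_ray_pt[OF x0 b(1), of 0 s] hdist_ray_pt[OF x0 b(2), of 0 t] st x0 by auto
  have "s \<ge> len g - K" "t \<ge> len g - K"
    using hdist_triangle[OF x0 h(1) h(3)] hdist_triangle[OF x0 h(2) h(3)] st d by (auto simp: len_def)
  moreover have "hdist (ray_pt x\<^sub>0 \<xi> s) (ray_pt x\<^sub>0 \<eta> t) \<le> 2 * K"
    using hdist_triangle[OF h(1) h(3) h(2)] st by (simp add: hdist_commute[of "P g"])
  ultimately have "visual_dist x\<^sub>0 \<xi> \<eta> \<le> 16 * cosh (2 * K) * exp (- (len g - K))"
    using g by (intro visual_dist_le_of_rays_close[OF x0 b]) auto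
  also have "exp (- (len g - K)) = exp K * exp (- len g)" by (simp flip: exp_add)
  finally show ?thesis by (simp add: mult.assoc)
qed

text \<open>One natural number \<open>K\<close> serves all \<open>R\<close>. The conical limit set
  is thus covered by countably many limsup sets of shadows, each with a fixed \<open>K\<close>, to
  which a covering argument applies.\<close>

lemma conical_in_shadows:
  assumes "\<xi> \<in> conical_limit_set G \<phi> x\<^sub>0"
  shows "\<exists>K::nat. \<forall>R. \<exists>g\<in>carrier G. len g > R \<and> \<xi> \<in> shadow (real K) g"
proof -
  define f where "f t = ray_orbit_dist G \<phi> x\<^sub>0 \<xi> t" for t
  have \<xi>: "\<xi> \<in> hyp_boundary" and L: "Liminf at_top (\<lambda>t. ereal (f t)) < \<infinity>"
    using assms by (auto simp: conical_limit_set_def f_def)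
  have "\<exists>K::nat. \<not> eventually (\<lambda>t. ereal (real K) \<le> ereal (f t)) at_top"
  proof (rule ccontr)
    assume "\<not> ?thesis"
    then have "ereal (real K) \<le> Liminf at_top (\<lambda>t. ereal (f t))" for K :: nat
      by (intro Liminf_bounded) auto
    then have "Liminf at_top (\<lambda>t. ereal (f t)) = \<infinity>"
      by (metis ereal_top linorder_le_cases real_arch_simple ereal_less_eq(3) order_trans)
    with L show False by simp
  qed
  then obtain K :: nat where K: "\<not> eventually (\<lambda>t. real K \<le> f t) at_top" by auto
  show ?thesis
  proof (intro exI[of _ K] allI)
    fix R
    obtain t where t: "t \<ge> max 0 (R + real K)" "f t < real K"
      using K unfolding eventually_at_top_linorder by (meson linorder_not_le)
    have "(INF a\<in>P ` carrier G. hdist (ray_pt x\<^sub>0 \<xi> t) a) < real K"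
      using t by (simp add: f_def ray_orbit_dist_def hsetdist_def orbit_eq hray_eq x0 \<xi>)
    then have "\<exists>d\<in>(\<lambda>a. hdist (ray_pt x\<^sub>0 \<xi> t) a) ` P ` carrier G. d < real K"
      by (intro cInf_lessD) auto
    then obtain g where g: "g \<in> carrier G" "hdist (ray_pt x\<^sub>0 \<xi> t) (P g) < real K" by auto
    have h: "ray_pt x\<^sub>0 \<xi> t \<in> hyp" using ray_pt_hyp(1)[OF x0 \<xi>] t by simp
    have "hdist x\<^sub>0 (ray_pt x\<^sub>0 \<xi> t) = t" using hdist_ray_pt[OF x0 \<xi>, of 0 t] t x0 by simp
    then have "t \<le> len g + hdist (ray_pt x\<^sub>0 \<xi> t) (P g)"
      using hdist_triangle[OF x0 P_hyp[OF g(1)] h] by (simp add: len_def hdist_commute[of "P g"])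
    then have "len g > R" using g(2) t(1) by simp
    moreover have "\<xi> \<in> shadow (real K) g" using g t \<xi> by (auto simp: shadow_def)
    ultimately show "\<exists>g\<in>carrier G. len g > R \<and> \<xi> \<in> shadow (real K) g" using g(1) by blast
  qed
qed

lemma conical_measure_zero:
  assumes inf: "infinite (carrier G)" and s: "s > 0" "(\<lambda>g. exp (- s * len g)) summable_on carrier G"
  shows "hausdorff_measure hyp_boundary (visual_dist x\<^sub>0) s (conical_limit_set G \<phi> x\<^sub>0) = 0"
proof -
  define E where "E K = {\<xi>. \<forall>R. \<exists>g\<in>carrier G. len g > R \<and> \<xi> \<in> shadow (real K) g}" for K :: nat
  define e where "e = from_nat_into (carrier G)"
  have e: "bij_betw e UNIV (carrier G)"
    unfolding e_def by (rule bij_betw_from_nat_into[OF countable_carrier inf])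
  then have ec: "e i \<in> carrier G" and einj: "inj e" and esurj: "g \<in> carrier G \<Longrightarrow> \<exists>i. g = e i" for i g
    by (auto simp: bij_betw_def)
  have "(\<lambda>i. exp (- s * len (e i))) summable_on UNIV"
    using s(2) summable_on_reindex_bij_betw[OF e, of "\<lambda>g. exp (- s * len g)"] by simp
  then have sm: "summable (\<lambda>i. exp (- s * len (e i)))" by (rule summable_on_imp_summable)
  have "hausdorff_measure hyp_boundary (visual_dist x\<^sub>0) s (E K) = 0" for K
    unfolding hausdorff_measure_zero_iff hausdorff_premeasure_zero_iff
  proof (intro allI impI)
    fix \<delta> \<epsilon> :: real assume \<delta>: "\<delta> > 0" and \<epsilon>: "\<epsilon> > 0"
    define C where "C = 16 * cosh (2 * real K) * exp (real K)"
    have C: "C > 0" by (simp add: C_def)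
    define a where "a i = C powr s * exp (- s * len (e i))" for i
    have a: "summable a" "\<And>i. a i \<ge> 0" unfolding a_def by (intro summable_mult sm) simp
    obtain N1 where N1: "\<And>n. n \<ge> N1 \<Longrightarrow> norm (\<Sum>i. a (i + n)) < \<epsilon>"
      using suminf_exist_split[OF \<epsilon> a(1)] by blast
    define R where "R = max (real K + 1) (ln (C / \<delta>))"
    have "finite (e -` {g \<in> carrier G. len g \<le> R})" by (intro finite_vimageI finite_ball einj)
    then obtain N2 where N2: "\<And>i. i \<in> e -` {g \<in> carrier G. len g \<le> R} \<Longrightarrow> i < N2"
      unfolding finite_nat_set_iff_bounded by auto
    \<comment> \<open>\<open>N1\<close> makes the tail of the series small, \<open>N2\<close> makes
      the remaining shadows so small that they are admissible for \<open>\<delta>\<close>.\<close>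
    define N where "N = max N1 N2"
    define U where "U i = shadow (real K) (e (i + N))" for i
    have lenR: "len (e (i + N)) > R" for i using N2[of "i + N"] ec by (fastforce simp: N_def)
    have vd: "visual_dist x\<^sub>0 x y \<le> C * exp (- len (e (i + N)))" if "x \<in> U i" "y \<in> U i" for i x y
      using visual_dist_shadow[of "e (i + N)" "real K" x y] that lenR[of i] ec by (simp add: U_def C_def R_def)
    have Cd: "C * exp (- len (e (i + N))) \<le> \<delta>" for i
    proof -
      have "exp (- len (e (i + N))) \<le> exp (- ln (C / \<delta>))" using lenR[of i] by (simp add: R_def)
      also have "\<dots> = \<delta> / C" using C \<delta> by (simp add: exp_minus)
      finally show ?thesis using C by (simp add: field_simps)
    qed
    have "E K \<subseteq> (\<Union>i. U i)"
    proof
      fix \<xi> assume \<xi>: "\<xi> \<in> E K"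
      define R' where "R' = Max (insert 0 ((len \<circ> e) ` {..<N}))"
      obtain g where g: "g \<in> carrier G" "len g > R'" "\<xi> \<in> shadow (real K) g" using \<xi> unfolding E_def by blast
      obtain i where i: "g = e i" using esurj g by blast
      have "i \<ge> N"
      proof (rule ccontr)
        assume "\<not> N \<le> i"
        then have "len (e i) \<le> R'" unfolding R'_def by (intro Max_ge) auto
        then show False using g i by simp
      qed
      then show "\<xi> \<in> (\<Union>i. U i)" using g i by (auto simp: U_def intro!: exI[of _ "i - N"])
    qed
    moreover have "\<forall>i. U i \<subseteq> hyp_boundary \<and> (\<forall>x\<in>U i. \<forall>y\<in>U i. visual_dist x\<^sub>0 x y \<le> \<delta>)"
    proof (intro allI conjI ballI)
      show "U i \<subseteq> hyp_boundary" for i by (auto simp: U_def shadow_def)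
      show "visual_dist x\<^sub>0 x y \<le> \<delta>" if "x \<in> U i" "y \<in> U i" for i x y
        using vd[OF that] Cd[of i] by linarith
    qed
    moreover have "(\<Sum>i. ennreal (metric_diam (visual_dist x\<^sub>0) (U i) powr s)) < ennreal \<epsilon>"
    proof -
      have le: "metric_diam (visual_dist x\<^sub>0) (U i) powr s \<le> a (i + N)" for i
      proof -
        have nn: "0 \<le> metric_diam (visual_dist x\<^sub>0) (U i)"
        proof (cases "U i = {}")
          case False
          then obtain x where x: "x \<in> U i" by blast
          then have "x \<in> hyp_boundary" by (auto simp: U_def shadow_def)
          then have "0 \<le> visual_dist x\<^sub>0 x x" using cos_visual_dist(1)[OF x0] by blast
          also have "\<dots> \<le> metric_diam (visual_dist x\<^sub>0) (U i)" by (rule le_metric_diam[OF vd x x])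
          finally show ?thesis .
        qed (simp add: metric_diam_def)
        have "metric_diam (visual_dist x\<^sub>0) (U i) \<le> C * exp (- len (e (i + N)))"
          using C by (intro metric_diam_le vd) auto
        then have "metric_diam (visual_dist x\<^sub>0) (U i) powr s \<le> (C * exp (- len (e (i + N)))) powr s"
          using nn s by (intro powr_mono2) auto
        also have "\<dots> = a (i + N)" using C by (simp add: a_def powr_def ln_mult algebra_simps flip: exp_add)
        finally show ?thesis .
      qed
      have "(\<Sum>i. ennreal (metric_diam (visual_dist x\<^sub>0) (U i) powr s)) \<le> (\<Sum>i. ennreal (a (i + N)))"
        using le by (intro suminf_le) (auto intro: ennreal_leI)
      also have "\<dots> = ennreal (\<Sum>i. a (i + N))"
        using a by (intro suminf_ennreal2) (auto simp: summable_iff_shift)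
      also have "\<dots> < ennreal \<epsilon>" using N1[of N] \<epsilon> by (intro ennreal_lessI) (auto simp: N_def abs_less_iff)
      finally show ?thesis .
    qed
    ultimately show "\<exists>U. E K \<subseteq> (\<Union>i. U i) \<and>
      (\<forall>i. U i \<subseteq> hyp_boundary \<and> (\<forall>x\<in>U i. \<forall>y\<in>U i. visual_dist x\<^sub>0 x y \<le> \<delta>)) \<and>
      (\<Sum>i. ennreal (metric_diam (visual_dist x\<^sub>0) (U i) powr s)) < ennreal \<epsilon>" by blast
  qed
  then have "hausdorff_measure hyp_boundary (visual_dist x\<^sub>0) s (\<Union>K. E K) = 0"
    by (rule hausdorff_measure_zero_UN)
  then show ?thesis
    by (rule hausdorff_measure_zero_mono) (use conical_in_shadows in \<open>auto simp: E_def\<close>)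
qed

lemma hausdorff_dim_upper:
  assumes inf: "infinite (carrier G)" and A: "A \<subseteq> conical_limit_set G \<phi> x\<^sub>0"
  shows "hausdorff_dim hyp_boundary (visual_dist x\<^sub>0) A \<le> critical_exponent G \<phi> x\<^sub>0"
  unfolding critical_exponent_def
proof (rule Inf_greatest)
  fix x assume "x \<in> {ereal s |s. (\<lambda>g. exp (- s * hdist x\<^sub>0 (P g))) summable_on carrier G}"
  then obtain s where s: "x = ereal s" "(\<lambda>g. exp (- s * len g)) summable_on carrier G" by (auto simp: len_def)
  \<comment> \<open>For \<open>s \<le> 0\<close> every term is at least 1 while the group is
    infinite. Positivity matters because \<open>hausdorff_dim\<close> ranges over positive
    exponents.\<close>
  have "s > 0"
  proof (rule ccontr)
    assume "\<not> s > 0"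
    then have le: "1 \<le> exp (- s * len g)" if "g \<in> carrier G" for g
      using that by (simp add: mult_nonpos_nonneg)
    have "(\<lambda>g. 1::real) summable_on carrier G"
      by (rule summable_on_comparison_test[OF s(2)]) (use le in auto)
    then have "(\<lambda>i::nat. 1::real) summable_on UNIV"
      using summable_on_reindex_bij_betw[OF bij_betw_from_nat_into[OF countable_carrier inf], of "\<lambda>g. 1::real"] by simp
    then have "summable (\<lambda>i::nat. 1::real)" by (rule summable_on_imp_summable)
    then show False by (simp add: summable_const_iff)
  qed
  then have "hausdorff_measure hyp_boundary (visual_dist x\<^sub>0) s A = 0"
    using hausdorff_measure_zero_mono[OF conical_measure_zero[OF inf _ s(2)] A] by simp
  then show "hausdorff_dim hyp_boundary (visual_dist x\<^sub>0) A \<le> x"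
    unfolding hausdorff_dim_def using s(1) \<open>s > 0\<close> by (intro Inf_lower) auto
qed

end

section \<open>Myrberg points\<close>

context kleinian
begin

text \<open>For orbit sequences \<open>P (u n)\<close> and \<open>P (v n)\<close> tending to
  \<open>a\<close> and \<open>b\<close>, the hypothesis is applied to
  \<open>inv (u n) \<otimes> v n\<close>. A translate of the ray then passes near both orbit points,
  and its piece between them converges to the line. It is enough to treat long \<open>h\<close>,
  since the two orbit points move apart.\<close>

lemma myrbergI:
  assumes \<xi>: "\<xi> \<in> limit_set G \<phi> x\<^sub>0"
    and K: "\<And>h. h \<in> carrier G \<Longrightarrow> len h \<ge> c \<Longrightarrow> \<exists>g\<in>carrier G. \<exists>t u. 0 \<le> t \<and> t < u \<and>
      hdist x\<^sub>0 (\<phi> g (ray_pt x\<^sub>0 \<xi> t)) \<le> K \<and> hdist (P h) (\<phi> g (ray_pt x\<^sub>0 \<xi> u)) \<le> K"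
  shows "\<xi> \<in> myrberg_limit_set G \<phi> x\<^sub>0"
  unfolding myrberg_limit_set_def
proof (intro CollectI conjI ballI impI allI \<xi>)
  fix a b l
  assume a: "a \<in> limit_set G \<phi> x\<^sub>0" and b: "b \<in> limit_set G \<phi> x\<^sub>0" and ab: "a \<noteq> b" and gl: "geodesic_line l a b"
  have bd: "\<xi> \<in> hyp_boundary" "a \<in> hyp_boundary" "b \<in> hyp_boundary" using limit_set_boundary \<xi> a b by auto
  obtain u where u: "\<And>n. u n \<in> carrier G" "(\<lambda>n. P (u n)) \<longlonglongrightarrow> a" using limit_set_sequence[OF a] by blast
  obtain v where v: "\<And>n. v n \<in> carrier G" "(\<lambda>n. P (v n)) \<longlonglongrightarrow> b" using limit_set_sequence[OF b] by blast
  have "filterlim (\<lambda>n. hdist (P (u n)) (P (v n))) at_top sequentially"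
    by (rule hdist_at_distinct_boundary[OF _ u(2) bd(2) _ v(2) bd(3) ab]) (use u v in auto)
  then obtain N where N: "\<And>n. n \<ge> N \<Longrightarrow> c \<le> hdist (P (u n)) (P (v n))"
    by (auto simp: filterlim_at_top eventually_sequentially)
  define h where "h n = inv (u (n + N)) \<otimes> v (n + N)" for n
  have h: "h n \<in> carrier G" "len (h n) \<ge> c" for n
    using u v N[of "n + N"] by (auto simp: h_def hdist_P)
  have "\<exists>g t t'. g \<in> carrier G \<and> 0 \<le> t \<and> t < t' \<and>
      hdist x\<^sub>0 (\<phi> g (ray_pt x\<^sub>0 \<xi> t)) \<le> K \<and> hdist (P (h n)) (\<phi> g (ray_pt x\<^sub>0 \<xi> t')) \<le> K" for n
    using K[OF h[of n]] by blast
  then obtain g t t' where g: "\<And>n. g n \<in> carrier G" "\<And>n. 0 \<le> t n" "\<And>n. t n < t' n"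
      "\<And>n. hdist x\<^sub>0 (\<phi> (g n) (ray_pt x\<^sub>0 \<xi> (t n))) \<le> K"
      "\<And>n. hdist (P (h n)) (\<phi> (g n) (ray_pt x\<^sub>0 \<xi> (t' n))) \<le> K"
    by metis
  define k where "k n = u (n + N) \<otimes> g n" for n
  have k: "k n \<in> carrier G" for n using u g by (simp add: k_def)
  define \<gamma> where "\<gamma> n r = \<phi> (k n) (ray_pt x\<^sub>0 \<xi> r)" for n r
  have rh: "ray_pt x\<^sub>0 \<xi> r \<in> hyp" if "r \<ge> 0" for r using ray_pt_hyp(1)[OF x0 bd(1) that] .
  have geo: "geodesic_on {t n..t' n} (\<gamma> n)" for n
    unfolding geodesic_on_def \<gamma>_def
  proof (intro conjI ballI)
    fix r assume r: "r \<in> {t n..t' n}"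
    then have r0: "r \<ge> 0" using g(2)[of n] by simp
    then show "\<phi> (k n) (ray_pt x\<^sub>0 \<xi> r) \<in> hyp" by (simp add: k rh)
    fix s assume "s \<in> {t n..t' n}"
    then have s0: "s \<ge> 0" using g(2)[of n] by simp
    show "hdist (\<phi> (k n) (ray_pt x\<^sub>0 \<xi> r)) (\<phi> (k n) (ray_pt x\<^sub>0 \<xi> s)) = \<bar>r - s\<bar>"
      using r0 s0 by (simp add: k rh hdist_ray_pt[OF x0 bd(1)])
  qed
  have hyps: "\<gamma> n (t n) \<in> hyp" "\<gamma> n (t' n) \<in> hyp" for n
    using geo[of n] g(3)[of n] by (auto simp: geodesic_on_def)
  have act: "\<gamma> n r = \<phi> (u (n + N)) (\<phi> (g n) (ray_pt x\<^sub>0 \<xi> r))" if "r \<ge> 0" for n r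
    using that u g by (simp add: \<gamma>_def k_def act_mult rh)
  have "(\<lambda>n. \<gamma> n (t n)) \<longlonglongrightarrow> a"
  proof (rule tendsto_boundary_bounded[OF _ _ bd(2)])
    show "(\<lambda>n. P (u (n + N))) \<longlonglongrightarrow> a" using u(2) by (rule LIMSEQ_ignore_initial_segment)
    show "hdist (P (u (n + N))) (\<gamma> n (t n)) \<le> K" for n
      using g(4)[of n] g(2)[of n] u g by (simp add: act rh x0)
  qed (use u hyps in auto)
  moreover have "(\<lambda>n. \<gamma> n (t' n)) \<longlonglongrightarrow> b"
  proof (rule tendsto_boundary_bounded[OF _ _ bd(3)])
    show "(\<lambda>n. P (v (n + N))) \<longlonglongrightarrow> b" using v(2) by (rule LIMSEQ_ignore_initial_segment)
    have t'0: "t' n \<ge> 0" for n using g(2)[of n] g(3)[of n] by simp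
    have "P (v (n + N)) = \<phi> (u (n + N)) (P (h n))" for n
      using u v by (simp add: h_def act_mult x0)
    then show "hdist (P (v (n + N))) (\<gamma> n (t' n)) \<le> K" for n
      using g(5)[of n] t'0[of n] u g h by (simp add: act rh x0)
  qed (use v hyps in auto)
  ultimately have conv: "eventually (\<lambda>n. \<exists>T. t n + R \<le> T \<and> T + R \<le> t' n \<and>
      (\<forall>r\<in>{-R..R}. hdist (\<gamma> n (T + r)) (l r) < \<epsilon>)) sequentially" if "\<epsilon> > 0" for R \<epsilon>
    using that by (intro geodesics_converge_to_line[OF gl ab geo g(3)])
  show "in_ray_orbit_closure G \<phi> x\<^sub>0 \<xi> l"
    unfolding in_ray_orbit_closure_def
  proof (intro allI impI)
    fix R \<epsilon> :: real assume "0 < R" "0 < \<epsilon>"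
    from eventually_happens'[OF sequentially_bot conv[OF this(2)]]
    obtain n T where T: "t n + R \<le> T" "\<forall>r\<in>{-R..R}. hdist (\<gamma> n (T + r)) (l r) < \<epsilon>"
      by blast
    have "T \<ge> R" using T g(2)[of n] by simp
    moreover have "\<phi> (k n) (hray x\<^sub>0 \<xi> (T + r)) = \<gamma> n (T + r)" if "r \<in> {-R..R}" for r
      using that \<open>T \<ge> R\<close> by (simp add: \<gamma>_def hray_eq[OF x0 bd(1)])
    ultimately show "\<exists>g\<in>carrier G. \<exists>T\<ge>R. \<forall>t\<in>{- R..R}. hdist (\<phi> g (hray x\<^sub>0 \<xi> (T + t))) (l t) < \<epsilon>"
      using T(2) k[of n] by (intro bexI[of _ "k n"] exI[of _ T]) auto
  qed
qed

end

text \<open>A converse to \<open>gp_at_boundary\<close>: a large Gromov product makes the points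
  close in norm and forces both to be far from the base point, so the common limit lies at
  infinity.\<close>

lemma gp_tendsto_boundary:
  fixes X Y :: "nat \<Rightarrow> 'a::euclidean_space"
  assumes X: "\<And>n. X n \<in> hyp" "X \<longlonglongrightarrow> \<zeta>" and Y: "\<And>n. Y n \<in> hyp" and z: "z \<in> hyp"
    and g: "filterlim (\<lambda>n. gp z (X n) (Y n)) at_top sequentially"
  shows "\<zeta> \<in> hyp_boundary" "Y \<longlonglongrightarrow> \<zeta>"
proof -
  define f where "f n = gp z (X n) (Y n) - hdist z 0" for n
  have f: "f n \<le> gp 0 (X n) (Y n)" for n
    using gp_basepoint[of 0 z "X n" "Y n"] X Y z by (simp add: f_def)
  have fl: "filterlim (\<lambda>n. - f n) at_bot sequentially"
    unfolding filterlim_at_bot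
  proof
    fix Z
    have "eventually (\<lambda>n. hdist z 0 - Z \<le> gp z (X n) (Y n)) sequentially" using g by (simp add: filterlim_at_top)
    then show "eventually (\<lambda>n. - f n \<le> Z) sequentially" by eventually_elim (simp add: f_def)
  qed
  then have e: "(\<lambda>n. 2 * exp (- f n)) \<longlonglongrightarrow> 0"
    using tendsto_mult[OF tendsto_const[of 2] filterlim_compose[OF exp_at_bot fl]] by simp
  have "norm (Y n - X n) \<le> 2 * exp (- f n)" for n
    using order_trans[OF norm_diff_le_gp[OF X(1)[of n] Y[of n]]] f[of n] by (simp add: norm_minus_commute)
  then have "(\<lambda>n. Y n - X n) \<longlonglongrightarrow> 0" by (intro Lim_null_comparison[OF _ e]) simp
  from tendsto_add[OF X(2) this] show "Y \<longlonglongrightarrow> \<zeta>" by simp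
  have "(\<lambda>n. 1 - (norm (X n))\<^sup>2) \<longlonglongrightarrow> 1 - (norm \<zeta>)\<^sup>2" by (intro tendsto_intros X)
  moreover have "(\<lambda>n. 1 - (norm (X n))\<^sup>2) \<longlonglongrightarrow> 0"
  proof (rule tendsto_sandwich[OF _ _ tendsto_const])
    show "\<forall>\<^sub>F n in sequentially. 0 \<le> 1 - (norm (X n))\<^sup>2" using hyp_pos[OF X(1)] by (simp add: less_imp_le)
    show "\<forall>\<^sub>F n in sequentially. 1 - (norm (X n))\<^sup>2 \<le> 2 * (2 * exp (- f n))"
    proof (intro always_eventually allI)
      fix n
      define w where "w = 1 - (norm (X n))\<^sup>2"
      have w: "w > 0" using hyp_pos[OF X(1)] by (simp add: w_def)
      have "w = (sqrt w)\<^sup>2" using w by simp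
      also have "\<dots> \<le> (2 * exp (- (hdist 0 (X n) / 2)))\<^sup>2"
        using sqrt_hyp_le[OF X(1)[of n]] w by (intro power_mono) (auto simp: w_def)
      also have "\<dots> = 4 * exp (- hdist 0 (X n))" by (simp add: power_mult_distrib power2_eq_square flip: exp_add)
      also have "\<dots> \<le> 4 * exp (- f n)" using f[of n] gp_le[OF zero_hyp X(1)[of n] Y[of n]] by simp
      finally show "1 - (norm (X n))\<^sup>2 \<le> 2 * (2 * exp (- f n))" by (simp add: w_def)
    qed
    show "(\<lambda>n. 2 * (2 * exp (- f n))) \<longlonglongrightarrow> 0" using tendsto_mult[OF tendsto_const[of 2] e] by simp
  qed
  ultimately have "(norm \<zeta>)\<^sup>2 = 1" using LIMSEQ_unique by fastforce
  then show "\<zeta> \<in> hyp_boundary" by (simp add: boundary_iff power2_eq_1_iff) (smt (verit) norm_ge_zero)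
qed

lemma cosh_ge_square: "1 + x\<^sup>2 / 2 \<le> cosh x" for x :: real
proof -
  have "\<bar>y\<bar> \<le> \<bar>sinh y\<bar>" for y :: real
  proof -
    have "y \<le> sinh y" if "y \<ge> 0" for y :: real
    proof -
      have "sinh 0 - 0 \<le> sinh y - y"
      proof (rule DERIV_nonneg_imp_nondecreasing[OF that])
        fix t :: real
        have "((\<lambda>y. sinh y - y) has_real_derivative cosh t - 1) (at t)" by (auto intro!: derivative_eq_intros)
        then show "\<exists>d. ((\<lambda>y. sinh y - y) has_real_derivative d) (at t) \<and> 0 \<le> d"
          using cosh_real_ge_1[of t] by (intro exI[of _ "cosh t - 1"]) auto
      qed
      then show ?thesis by simp
    qed
    from this[of "\<bar>y\<bar>"] show ?thesis by (auto simp: abs_if split: if_splits)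
  qed
  from this[of "x / 2"] have "(x / 2)\<^sup>2 \<le> (sinh (x / 2))\<^sup>2" by (simp only: abs_le_square_iff)
  then show ?thesis by (simp add: sinh_half_square power_divide)
qed

text \<open>Both lifts involve the same null vector, whose form with itself vanishes, so only mixed
  terms remain. For equal times on rays starting on one horosphere the result tends to 1
  exponentially.\<close>

lemma cosh_hdist_asymptotic_rays:
  assumes "y \<in> hyp" "z \<in> hyp" "\<zeta> \<in> hyp_boundary" "s \<ge> 0" "t \<ge> 0"
  shows "cosh (hdist (ray_pt y \<zeta> s) (ray_pt z \<zeta> t)) = exp (- (s + t)) * cosh (hdist y z)
     + exp (- s) * sinh t * (busemann \<zeta> y / busemann \<zeta> z) + exp (- t) * sinh s * (busemann \<zeta> z / busemann \<zeta> y)"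
proof -
  have "cosh (hdist (ray_pt y \<zeta> s) (ray_pt z \<zeta> t)) = lor (rvec y \<zeta> s) (rvec z \<zeta> t)"
    using assms by (simp add: ray_pt_hyp flip: lor_hlift)
  also have "\<dots> = exp (- s) * exp (- t) * cosh (hdist y z)
     + exp (- s) * sinh t * (busemann \<zeta> y / busemann \<zeta> z) + exp (- t) * sinh s * (busemann \<zeta> z / busemann \<zeta> y)"
    using assms by (simp add: rvec_def lor_hlift lor_nul_self busemann_def lor_commute[of "nul \<zeta>" "hlift z"] algebra_simps)
  finally show ?thesis by (simp flip: exp_add)
qed

section \<open>Connecting elements\<close>

text \<open>
  The assumption on \<open>X\<close> says that \<open>\<zeta>\<close> is a global fixed point of the group, expressed without
  extending the action to the boundary.
\<close>

locale kleinian_fixed_point = kleinian G \<phi> x\<^sub>0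
  for G :: "('g, 'r) monoid_scheme" (structure) and \<phi> :: "'g \<Rightarrow> 'a::euclidean_space \<Rightarrow> 'a" and x\<^sub>0 +
  fixes X :: "nat \<Rightarrow> 'a" and \<zeta> :: 'a
  assumes X: "\<And>n. X n \<in> hyp" and fixed: "\<And>f. f \<in> carrier G \<Longrightarrow> (\<lambda>n. \<phi> f (X n)) \<longlonglongrightarrow> \<zeta>"
    and \<zeta>: "\<zeta> \<in> hyp_boundary"
begin

text \<open>The exponential of the shift along the rays towards \<open>\<zeta>\<close>; a value
  below 1 means a shift towards \<open>\<zeta>\<close>. As \<open>\<zeta>\<close> is fixed by the
  group, it is a homomorphism into the positive reals.\<close>

definition stretch :: "'g \<Rightarrow> real" where
  "stretch f = busemann \<zeta> (P f) / busemann \<zeta> x\<^sub>0"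

lemma b_pos: "y \<in> hyp \<Longrightarrow> busemann \<zeta> y > 0"
  using busemann_pos \<zeta> by blast

lemma stretch_pos: "f \<in> carrier G \<Longrightarrow> stretch f > 0"
  using b_pos x0 by (simp add: stretch_def)

text \<open>Ratios of Busemann values are limits of ratios of \<open>cosh\<close> of distances to
  points approaching \<open>\<zeta>\<close>. Along \<open>\<phi> f (X n)\<close> the ratio is the
  same as along \<open>X n\<close>, by isometry, so the limit does not depend on
  \<open>f\<close>.\<close>

lemma busemann_act:
  assumes f: "f \<in> carrier G" and y: "y \<in> hyp"
  shows "busemann \<zeta> (\<phi> f y) = stretch f * busemann \<zeta> y"
proof -
  have ratio: "(\<lambda>n. cosh (hdist y (X n)) / cosh (hdist x\<^sub>0 (X n))) \<longlonglongrightarrow> busemann \<zeta> (\<phi> f y) / busemann \<zeta> (P f)"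
    if f: "f \<in> carrier G" for f
  proof -
    have h: "\<phi> f (X n) \<in> hyp" for n using f X by simp
    have 1: "(\<lambda>n. cosh (hdist (\<phi> f y) (\<phi> f (X n))) / fst (hlift (\<phi> f (X n)))) \<longlonglongrightarrow> busemann \<zeta> (\<phi> f y)"
      by (rule cosh_hdist_at_boundary[OF h fixed[OF f] \<zeta>]) (use f y in simp)
    have 2: "(\<lambda>n. cosh (hdist (P f) (\<phi> f (X n))) / fst (hlift (\<phi> f (X n)))) \<longlonglongrightarrow> busemann \<zeta> (P f)"
      by (rule cosh_hdist_at_boundary[OF h fixed[OF f] \<zeta>]) (use f in simp)
    have nz: "busemann \<zeta> (P f) \<noteq> 0" using b_pos[OF P_hyp[OF f]] by simp
    have "cosh (hdist (\<phi> f y) (\<phi> f (X n))) / fst (hlift (\<phi> f (X n))) / (cosh (hdist (P f) (\<phi> f (X n))) / fst (hlift (\<phi> f (X n))))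
        = cosh (hdist y (X n)) / cosh (hdist x\<^sub>0 (X n))" for n
      using fst_hlift_pos[OF h[of n]] f y X x0 by simp
    with tendsto_divide[OF 1 2 nz] show ?thesis by simp
  qed
  have "busemann \<zeta> (\<phi> f y) / busemann \<zeta> (P f) = busemann \<zeta> (\<phi> \<one> y) / busemann \<zeta> (P \<one>)"
    using LIMSEQ_unique[OF ratio[OF f] ratio[OF one_closed]] .
  then show ?thesis using b_pos[OF P_hyp[OF f]] b_pos[OF x0] y x0 by (simp add: stretch_def field_simps)
qed

lemma stretch_mult: "f \<in> carrier G \<Longrightarrow> g \<in> carrier G \<Longrightarrow> stretch (f \<otimes> g) = stretch f * stretch g"
  using b_pos[OF x0] by (simp add: stretch_def[of "f \<otimes> g"] act_mult x0 busemann_act)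

lemma stretch_one: "stretch \<one> = 1"
  using b_pos[OF x0] by (simp add: stretch_def x0)

lemma stretch_inv: "f \<in> carrier G \<Longrightarrow> stretch (inv f) = 1 / stretch f"
  using stretch_mult[of f "inv f"] stretch_one stretch_pos[of f] by (simp add: field_simps)

lemma stretch_pow: "f \<in> carrier G \<Longrightarrow> stretch (f [^] (n::nat)) = stretch f ^ n"
  by (induction n) (simp_all add: stretch_one stretch_mult)

lemma busemann_ray: "y \<in> hyp \<Longrightarrow> t \<ge> 0 \<Longrightarrow> busemann \<zeta> (ray_pt y \<zeta> t) = exp (- t) * busemann \<zeta> y"
  using busemann_along_geodesic[of 0 "ray_pt y \<zeta>" \<zeta> t] geodesic_ray_ray_pt[of y \<zeta>] \<zeta>
  by (simp add: geodesic_ray_def)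

lemma act_ray:
  assumes "g \<in> carrier G" "y \<in> hyp" "t \<ge> 0"
  shows "\<phi> g (ray_pt y \<zeta> t) = ray_pt (\<phi> g y) \<zeta> t"
proof -
  have h: "ray_pt y \<zeta> t \<in> hyp" using ray_pt_hyp(1)[OF assms(2) \<zeta> assms(3)] .
  show ?thesis
  proof (rule ray_pt_unique[OF _ _ \<zeta> assms(3)])
    show "hdist (\<phi> g y) (\<phi> g (ray_pt y \<zeta> t)) = t"
      using hdist_ray_pt[OF assms(2) \<zeta>, of 0 t] assms h by simp
  qed (use assms h in \<open>simp_all add: busemann_act busemann_ray\<close>)
qed

text \<open>Without any shift the orbit stays on one horosphere, and its closure meets the sphere
  only in \<open>\<zeta>\<close>.\<close>

lemma limit_set_horosphere:
  assumes "\<And>f. f \<in> carrier G \<Longrightarrow> stretch f = 1"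
  shows "limit_set G \<phi> x\<^sub>0 \<subseteq> {\<zeta>}"
proof
  fix z assume z: "z \<in> limit_set G \<phi> x\<^sub>0"
  obtain g where g: "\<And>n. g n \<in> carrier G" "(\<lambda>n. P (g n)) \<longlonglongrightarrow> z" using limit_set_sequence[OF z] by blast
  have n: "norm z = 1" using limit_set_boundary[OF z] by (simp add: boundary_iff)
  have e: "(norm (P (g n) - \<zeta>))\<^sup>2 = busemann \<zeta> x\<^sub>0 * (1 - (norm (P (g n)))\<^sup>2)" for n
  proof -
    have "busemann \<zeta> (P (g n)) = busemann \<zeta> x\<^sub>0" using busemann_act[OF g(1) x0] assms[OF g(1)] by simp
    then show ?thesis
      using busemann_formula[OF P_hyp[OF g(1)] \<zeta>, of n] hyp_pos[OF P_hyp[OF g(1)], of n] by (simp add: field_simps)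
  qed
  have "(\<lambda>n. (norm (P (g n) - \<zeta>))\<^sup>2) \<longlonglongrightarrow> (norm (z - \<zeta>))\<^sup>2" by (intro tendsto_intros g)
  moreover have "(\<lambda>n. busemann \<zeta> x\<^sub>0 * (1 - (norm (P (g n)))\<^sup>2)) \<longlonglongrightarrow> busemann \<zeta> x\<^sub>0 * (1 - (norm z)\<^sup>2)"
    by (intro tendsto_intros g)
  ultimately have "(norm (z - \<zeta>))\<^sup>2 = busemann \<zeta> x\<^sub>0 * (1 - (norm z)\<^sup>2)"
    unfolding e using LIMSEQ_unique by blast
  then show "z \<in> {\<zeta>}" using n by simp
qed

text \<open>
  A loxodromic element \<open>h\<close> fixing \<open>\<zeta>\<close>. Conjugation by high powers of \<open>h\<close> moves any finite set of
  elements with small translation along \<open>h\<close> into one fixed ball, so by discreteness there are only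
  finitely many of them and the group is virtually generated by \<open>h\<close>.
\<close>

lemma pow_near_ray:
  assumes h: "h \<in> carrier G" and \<beta>: "stretch h = exp (- \<beta>)" "\<beta> > 0"
  shows "\<exists>M. \<forall>n. hdist (P (h [^] (n::nat))) (ray_pt x\<^sub>0 \<zeta> (real n * \<beta>)) \<le> M"
proof -
  define c where "c t = ray_pt x\<^sub>0 \<zeta> t" for t
  have c: "c t \<in> hyp" if "t \<ge> 0" for t using ray_pt_hyp(1)[OF x0 \<zeta> that] by (simp add: c_def)
  have nb: "real n * \<beta> \<ge> 0" "real n * \<beta> + \<beta> \<ge> 0" for n using \<beta> by auto
  define K where "K = sqrt (2 * cosh (len h))"
  \<comment> \<open>\<open>h\<close> maps the ray to another ray towards \<open>\<zeta>\<close>, and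
    after the shift by \<open>\<beta>\<close> the two points lie on one horosphere. Their distance
    decays geometrically, so the errors of successive powers have a bounded sum.\<close>
  have step: "hdist (\<phi> h (c (real n * \<beta>))) (c (real n * \<beta> + \<beta>)) \<le> K * exp (- \<beta>) ^ n" for n
  proof -
    define t where "t = real n * \<beta>"
    have t: "t \<ge> 0" "t + \<beta> \<ge> 0" using nb[of n] by (auto simp: t_def)
    define d where "d = hdist (\<phi> h (c t)) (c (t + \<beta>))"
    have bb: "busemann \<zeta> (P h) / busemann \<zeta> x\<^sub>0 = exp (- \<beta>)" "busemann \<zeta> x\<^sub>0 / busemann \<zeta> (P h) = exp \<beta>"
      using \<beta>(1) b_pos[OF x0] b_pos[OF P_hyp[OF h]] by (auto simp: stretch_def exp_minus field_simps)
    have "cosh d = exp (- (t + (t + \<beta>))) * cosh (hdist (P h) x\<^sub>0)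
        + (exp (- t) * sinh (t + \<beta>) * exp (- \<beta>) + exp (- (t + \<beta>)) * sinh t * exp \<beta>)"
      unfolding d_def c_def using t h
      by (simp add: act_ray[OF h x0] cosh_hdist_asymptotic_rays[OF P_hyp[OF h] x0 \<zeta>] bb)
    also have "exp (- t) * sinh (t + \<beta>) * exp (- \<beta>) + exp (- (t + \<beta>)) * sinh t * exp \<beta>
       = 1 - (exp (-2*t) + exp (-2*t - 2 * \<beta>)) / 2"
    proof -
      have "exp (- t) * sinh (t + \<beta>) * exp (- \<beta>)
          = (exp (- t) * exp (t + \<beta>) * exp (- \<beta>) - exp (- t) * exp (- (t + \<beta>)) * exp (- \<beta>)) / 2"
        by (simp add: sinh_field_def algebra_simps)
      also have "exp (- t) * exp (t + \<beta>) * exp (- \<beta>) = 1" by (simp flip: exp_add)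
      also have "exp (- t) * exp (- (t + \<beta>)) * exp (- \<beta>) = exp (-2*t - 2 * \<beta>)" by (simp flip: exp_add)
      finally have 1: "exp (- t) * sinh (t + \<beta>) * exp (- \<beta>) = (1 - exp (-2*t - 2 * \<beta>)) / 2" .
      have "exp (- (t + \<beta>)) * sinh t * exp \<beta>
          = (exp (- (t + \<beta>)) * exp t * exp \<beta> - exp (- (t + \<beta>)) * exp (- t) * exp \<beta>) / 2"
        by (simp add: sinh_field_def algebra_simps)
      also have "exp (- (t + \<beta>)) * exp t * exp \<beta> = 1" by (simp flip: exp_add)
      also have "exp (- (t + \<beta>)) * exp (- t) * exp \<beta> = exp (-2*t)" by (simp flip: exp_add)
      finally show ?thesis using 1 by argo
    qed
    also have "exp (- (t + (t + \<beta>))) * cosh (hdist (P h) x\<^sub>0) + (1 - (exp (-2*t) + exp (-2*t - 2 * \<beta>)) / 2)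
        \<le> exp (-2*t) * cosh (hdist (P h) x\<^sub>0) + 1"
    proof -
      have "exp (- (t + (t + \<beta>))) * cosh (hdist (P h) x\<^sub>0) \<le> exp (-2*t) * cosh (hdist (P h) x\<^sub>0)"
        using \<beta> by (intro mult_right_mono) auto
      moreover have "0 \<le> (exp (-2*t) + exp (-2*t - 2 * \<beta>)) / 2" by (simp add: add_nonneg_nonneg)
      ultimately show ?thesis by linarith
    qed
    finally have "cosh d \<le> exp (-2*t) * cosh (len h) + 1" by (simp add: len_def hdist_commute add.assoc)
    with cosh_ge_square[of d] have "d\<^sup>2 \<le> 2 * (exp (-2*t) * cosh (len h))" by simp
    also have "\<dots> = (K * exp (-t))\<^sup>2"
      by (simp add: K_def power_mult_distrib power2_eq_square[of "exp (-t)"] flip: exp_add)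
    finally have "d \<le> K * exp (-t)" by (rule power2_le_imp_le) (simp add: K_def)
    also have "exp (-t) = exp (- \<beta>) ^ n" by (simp add: t_def flip: exp_of_nat_mult)
    finally show ?thesis by (simp add: d_def t_def)
  qed
  define q where "q = exp (- \<beta>)"
  have q: "0 < q" "q < 1" using \<beta> by (auto simp: q_def)
  have "hdist (P (h [^] n)) (c (real n * \<beta>)) \<le> K * (\<Sum>i<n. q ^ i)" for n :: nat
  proof (induction n)
    case 0
    then show ?case by (simp add: c_def x0)
  next
    case (Suc n)
    have hn: "h [^] n \<in> carrier G" using h by simp
    have P: "P (h [^] Suc n) = \<phi> h (P (h [^] n))"
      using h x0 nat_pow_comm[of h n 1] by (simp add: act_mult[symmetric])
    have cn: "c (real n * \<beta>) \<in> hyp" "c (real n * \<beta> + \<beta>) \<in> hyp" using c nb by auto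
    have "hdist (P (h [^] Suc n)) (c (real (Suc n) * \<beta>)) = hdist (\<phi> h (P (h [^] n))) (c (real n * \<beta> + \<beta>))"
      unfolding P by (simp add: distrib_right add.commute)
    also have "\<dots> \<le> hdist (\<phi> h (P (h [^] n))) (\<phi> h (c (real n * \<beta>))) + hdist (\<phi> h (c (real n * \<beta>))) (c (real n * \<beta> + \<beta>))"
      using h hn cn by (intro hdist_triangle) simp_all
    also have "\<dots> \<le> K * (\<Sum>i<n. q ^ i) + K * q ^ n"
      using Suc.IH step[of n] h hn cn by (simp add: q_def)
    finally show ?case by (simp add: algebra_simps)
  qed
  moreover have "K * (\<Sum>i<n. q ^ i) \<le> K * (1 / (1 - q))" for n
  proof (rule mult_left_mono)
    have "(\<Sum>i<n. q ^ i) = (1 - q ^ n) / (1 - q)" using q by (simp add: sum_gp_strict)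
    also have "\<dots> \<le> 1 / (1 - q)" using q by (intro divide_right_mono) auto
    finally show "(\<Sum>i<n. q ^ i) \<le> 1 / (1 - q)" .
  qed (simp add: K_def)
  ultimately show ?thesis unfolding c_def by (meson order_trans)
qed

lemma finite_small_stretch:
  assumes h: "h \<in> carrier G" and \<beta>: "stretch h = exp (- \<beta>)" "\<beta> > 0"
  shows "finite {g \<in> carrier G. \<bar>ln (stretch g)\<bar> \<le> \<beta>}" (is "finite ?T")
proof -
  obtain M where M: "\<And>n::nat. hdist (P (h [^] n)) (ray_pt x\<^sub>0 \<zeta> (real n * \<beta>)) \<le> M"
    using pow_near_ray[OF assms] by blast
  define M' where "M' = ln (2 * (1 + cosh \<beta>))"
  have hn [simp]: "h [^] n \<in> carrier G" for n :: nat using h by simp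
  \<comment> \<open>A point of the ray at time at least \<open>len g / 2\<close> is moved by
    \<open>g\<close> by at most \<open>M'\<close>, and \<open>h [^] n\<close> carries the base point
    to within \<open>M\<close> of such a point.\<close>
  have conj: "len (inv (h [^] n) \<otimes> g \<otimes> h [^] n) \<le> 2 * M + M'"
    if g: "g \<in> ?T" and n: "len g \<le> 2 * (real n * \<beta>)" for g and n :: nat
  proof -
    define t where "t = real n * \<beta>"
    have t: "t \<ge> 0" using \<beta> by (simp add: t_def)
    define c where "c = ray_pt x\<^sub>0 \<zeta> t"
    have c: "c \<in> hyp" using ray_pt_hyp(1)[OF x0 \<zeta> t] by (simp add: c_def)
    have gc: "g \<in> carrier G" using g by simp
    define l where "l = ln (stretch g)"
    have l: "stretch g = exp l" "\<bar>l\<bar> \<le> \<beta>" using g stretch_pos[OF gc] by (auto simp: l_def)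
    have bb: "busemann \<zeta> (P g) / busemann \<zeta> x\<^sub>0 = exp l" "busemann \<zeta> x\<^sub>0 / busemann \<zeta> (P g) = exp (- l)"
      using l(1) b_pos[OF x0] b_pos[OF P_hyp[OF gc]] by (auto simp: stretch_def exp_minus field_simps)
    have "cosh (hdist c (\<phi> g c)) = exp (- (t + t)) * cosh (len g)
        + exp (- t) * sinh t * exp (- l) + exp (- t) * sinh t * exp l"
      unfolding c_def using t gc
      by (simp add: act_ray[OF gc x0] cosh_hdist_asymptotic_rays[OF x0 P_hyp[OF gc] \<zeta>] bb len_def)
    also have "\<dots> \<le> 1 + cosh \<beta>"
    proof -
      have "cosh (len g) \<le> exp (len g)" using gc by (simp add: cosh_def)
      also have "\<dots> \<le> exp (t + t)" using n by (simp add: t_def mult.commute)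
      finally have "exp (- (t + t)) * cosh (len g) \<le> exp (- (t + t)) * exp (t + t)" by (intro mult_left_mono) auto
      then have 1: "exp (- (t + t)) * cosh (len g) \<le> 1" by (simp flip: exp_add)
      have "exp (- t) * sinh t \<le> exp (- t) * (exp t / 2)" by (intro mult_left_mono sinh_le_exp_half) auto
      then have "exp (- t) * sinh t \<le> 1 / 2" by (simp flip: exp_add)
      then have "exp (- t) * sinh t * (exp (- l) + exp l) \<le> 1 / 2 * (exp (- l) + exp l)"
        by (intro mult_right_mono) (auto intro: add_nonneg_nonneg)
      also have "\<dots> = cosh l" by (simp add: cosh_field_def)
      also have "\<dots> \<le> cosh \<beta>" using l(2) \<beta>(2) by (metis abs_ge_zero cosh_real_abs cosh_real_nonneg_le_iff order_less_imp_le)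
      finally show ?thesis using 1 by (simp add: algebra_simps)
    qed
    finally have "2 * cosh (hdist c (\<phi> g c)) \<le> 2 * (1 + cosh \<beta>)" by simp
    then have "exp (hdist c (\<phi> g c)) \<le> 2 * (1 + cosh \<beta>)" by (rule order_trans[OF exp_le_two_cosh])
    then have d1: "hdist c (\<phi> g c) \<le> M'"
      unfolding M'_def by (subst ln_ge_iff) (simp_all add: add_pos_pos)
    have d2: "hdist (P (h [^] n)) c \<le> M" using M[of n] by (simp add: c_def t_def)
    have "inv (h [^] n) \<otimes> g \<otimes> h [^] n = inv (h [^] n) \<otimes> (g \<otimes> h [^] n)" using gc by (simp add: m_assoc)
    then have "len (inv (h [^] n) \<otimes> g \<otimes> h [^] n) = hdist (P (h [^] n)) (\<phi> g (P (h [^] n)))"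
      using gc by (simp add: x0 act_mult flip: hdist_P)
    also have "\<dots> \<le> hdist (P (h [^] n)) c + (hdist c (\<phi> g c) + hdist (\<phi> g c) (\<phi> g (P (h [^] n))))"
      using hdist_triangle[of "P (h [^] n)" c "\<phi> g (P (h [^] n))"] hdist_triangle[of c "\<phi> g c" "\<phi> g (P (h [^] n))"] gc c
      by simp
    also have "\<dots> \<le> M + (M' + M)" using d1 d2 gc c by (simp add: hdist_commute[of c])
    finally show ?thesis by simp
  qed
  define B where "B = {g \<in> carrier G. len g \<le> 2 * M + M'}"
  have B: "finite B" unfolding B_def by (rule finite_ball)
  \<comment> \<open>The exponent \<open>n\<close> depends on \<open>S\<close> but the ball
    \<open>B\<close> does not, so all finite subsets have the same cardinality bound.\<close>
  have "card S \<le> card B" if S: "S \<subseteq> ?T" "finite S" for S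
  proof -
    define L where "L = Max (insert 0 (len ` S))"
    have L: "len g \<le> L" if "g \<in> S" for g unfolding L_def using S that by (intro Max_ge) auto
    obtain n :: nat where n: "L / (2 * \<beta>) \<le> real n" using real_arch_simple by blast
    have n': "len g \<le> 2 * (real n * \<beta>)" if "g \<in> S" for g
      using n L[OF that] \<beta>(2) by (simp add: field_simps)
    define k where "k g = inv (h [^] n) \<otimes> g \<otimes> h [^] n" for g
    have "inj_on k S"
    proof (rule inj_onI)
      fix x y assume xy: "x \<in> S" "y \<in> S" "k x = k y"
      then have "x \<in> carrier G" "y \<in> carrier G" using S by auto
      then show "x = y" using xy(3) by (simp add: k_def)
    qed
    moreover have "k ` S \<subseteq> B"
      using S conj n' by (auto simp: k_def B_def)
    ultimately show ?thesis using B card_inj_on_le by blast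
  qed
  then show ?thesis using finite_if_finite_subsets_card_bdd[of ?T "card B"] by blast
qed

text \<open>Dividing \<open>ln (stretch g)\<close> by \<open>\<beta>\<close> with remainder writes
  \<open>g\<close> as a power of \<open>h\<close> or of its inverse times an element of the finite
  set \<open>T\<close>. The orbit therefore stays within bounded distance of the orbit of these
  powers, which accumulates only at the two ends of the axis.\<close>

lemma limit_set_loxodromic:
  assumes h: "h \<in> carrier G" and \<beta>: "stretch h = exp (- \<beta>)" "\<beta> > 0"
  shows "\<exists>\<eta>. limit_set G \<phi> x\<^sub>0 \<subseteq> {\<zeta>, \<eta>}"
proof -
  obtain M where M: "\<And>n::nat. hdist (P (h [^] n)) (ray_pt x\<^sub>0 \<zeta> (real n * \<beta>)) \<le> M"
    using pow_near_ray[OF assms] by blast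
  define T where "T = {g \<in> carrier G. \<bar>ln (stretch g)\<bar> \<le> \<beta>}"
  have T: "finite T" unfolding T_def by (rule finite_small_stretch[OF assms])
  have hn [simp]: "h [^] n \<in> carrier G" for n :: nat using h by simp
  have ch: "ray_pt x\<^sub>0 \<zeta> (real n * \<beta>) \<in> hyp" for n :: nat
    using ray_pt_hyp(1)[OF x0 \<zeta>, of "real n * \<beta>"] \<beta>(2) by simp
  have lenc: "hdist x\<^sub>0 (ray_pt x\<^sub>0 \<zeta> (real n * \<beta>)) = real n * \<beta>" for n :: nat
    using hdist_ray_pt[OF x0 \<zeta>, of 0 "real n * \<beta>"] \<beta>(2) x0 by simp
  have lenpow: "\<bar>len (h [^] n) - real n * \<beta>\<bar> \<le> M" for n :: nat
    using hdist_triangle[OF x0 P_hyp[OF hn] ch, of n n] hdist_triangle[OF x0 ch P_hyp[OF hn], of n n] M[of n] lenc[of n]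
    by (simp add: len_def hdist_commute[of "ray_pt x\<^sub>0 \<zeta> (real n * \<beta>)"])
  have to_\<zeta>: "(\<lambda>n. P (h [^] (n::nat))) \<longlonglongrightarrow> \<zeta>"
  proof (rule tendsto_boundary_bounded[OF ch _ \<zeta>])
    have "filterlim (\<lambda>n. real n * \<beta>) at_top sequentially"
      by (intro filterlim_at_top_mult_tendsto_pos[OF tendsto_const \<beta>(2)] filterlim_real_sequentially)
    then show "(\<lambda>n. ray_pt x\<^sub>0 \<zeta> (real n * \<beta>)) \<longlonglongrightarrow> \<zeta>"
      using filterlim_compose[OF ray_pt_tendsto[OF x0 \<zeta>]] by blast
    show "hdist (ray_pt x\<^sub>0 \<zeta> (real n * \<beta>)) (P (h [^] n)) \<le> M" for n
      using M[of n] by (simp add: hdist_commute)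
  qed simp
  have "\<exists>\<eta>\<in>hyp_boundary. (\<lambda>n. P (inv (h [^] (n::nat)))) \<longlonglongrightarrow> \<eta>"
  proof (rule gp_convergent[OF _ x0])
    show "filterlim (\<lambda>n. real n * \<beta> - 2 * M) at_top sequentially"
      using \<beta>(2) by real_asymp
    fix m k :: nat assume mk: "m \<le> k"
    have "h [^] k = h [^] (k - m) \<otimes> h [^] m" using h mk by (simp add: nat_pow_mult)
    then have "h [^] k \<otimes> inv (h [^] m) = h [^] (k - m)" by (simp add: m_assoc)
    then have e: "inv (inv (h [^] k)) \<otimes> inv (h [^] m) = h [^] (k - m)" by simp
    have "hdist (P (inv (h [^] k))) (P (inv (h [^] m))) = len (h [^] (k - m))"
      using e by (simp add: hdist_P)
    then show "real m * \<beta> - 2 * M \<le> gp x\<^sub>0 (P (inv (h [^] m))) (P (inv (h [^] k)))"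
      using lenpow[of m] lenpow[of k] lenpow[of "k - m"] mk
      by (simp add: gp_def hdist_commute of_nat_diff algebra_simps flip: len_def)
  qed simp
  then obtain \<eta> where to_\<eta>: "(\<lambda>n. P (inv (h [^] (n::nat)))) \<longlonglongrightarrow> \<eta>" by blast
  have decomp: "\<exists>(n::nat) \<tau>. \<tau> \<in> T \<and> (g = h [^] n \<otimes> \<tau> \<or> g = inv (h [^] n) \<otimes> \<tau>)" if g: "g \<in> carrier G" for g
  proof -
    define l where "l = ln (stretch g)"
    define k where "k = \<lfloor>l / \<beta>\<rfloor>"
    have k: "of_int k * \<beta> \<le> l" "l \<le> of_int k * \<beta> + \<beta>"
    proof -
      have "of_int k \<le> l / \<beta>" "l / \<beta> \<le> of_int k + 1"
        unfolding k_def by linarith+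
      then show "of_int k * \<beta> \<le> l" "l \<le> of_int k * \<beta> + \<beta>"
        using \<beta>(2) by (simp_all add: pos_le_divide_eq pos_divide_le_eq distrib_right)
    qed
    show ?thesis
    proof (cases "k \<ge> 0")
      case True
      define n where "n = nat k"
      have n: "real n = of_int k" using True by (simp add: n_def)
      have "ln (stretch (h [^] n \<otimes> g)) = l - real n * \<beta>"
        using g h stretch_pos[OF g] by (simp add: stretch_mult stretch_pow \<beta>(1) l_def ln_mult ln_realpow)
      then have "h [^] n \<otimes> g \<in> T" using k g by (simp add: T_def n)
      moreover have "g = inv (h [^] n) \<otimes> (h [^] n \<otimes> g)" using g by (simp add: m_assoc[symmetric])
      ultimately show ?thesis by blast
    next
      case False
      define n where "n = nat (- k)"
      have n: "real n = - of_int k" using False by (simp add: n_def)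
      have "ln (stretch (inv (h [^] n) \<otimes> g)) = l + real n * \<beta>"
        using g h stretch_pos[OF g] by (simp add: stretch_mult stretch_pow stretch_inv \<beta>(1) l_def ln_mult ln_div ln_realpow)
      then have "inv (h [^] n) \<otimes> g \<in> T" using k g by (simp add: T_def n)
      moreover have "g = h [^] n \<otimes> (inv (h [^] n) \<otimes> g)" using g by (simp add: m_assoc[symmetric])
      ultimately show ?thesis by blast
    qed
  qed
  have "limit_set G \<phi> x\<^sub>0 \<subseteq> {\<zeta>, \<eta>}"
  proof
    fix z assume z: "z \<in> limit_set G \<phi> x\<^sub>0"
    have zb: "z \<in> hyp_boundary" by (rule limit_set_boundary[OF z])
    obtain g where g: "\<And>i. g i \<in> carrier G" "(\<lambda>i. P (g i)) \<longlonglongrightarrow> z" using limit_set_sequence[OF z] by blast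
    have "\<forall>i. \<exists>n \<tau>. \<tau> \<in> T \<and> (g i = h [^] (n::nat) \<otimes> \<tau> \<or> g i = inv (h [^] n) \<otimes> \<tau>)" using decomp g by blast
    then obtain n \<tau> where n: "\<And>i. \<tau> i \<in> T" "\<And>i. g i = h [^] (n i) \<otimes> \<tau> i \<or> g i = inv (h [^] (n i :: nat)) \<otimes> \<tau> i"
      by metis
    define L where "L = Max (insert 0 (len ` T))"
    have L: "len (\<tau> i) \<le> L" for i unfolding L_def using T n(1) by (intro Max_ge) auto
    have tc: "\<tau> i \<in> carrier G" for i using n(1)[of i] by (simp add: T_def)
    define y where "y i = (if g i = h [^] (n i) \<otimes> \<tau> i then h [^] (n i) else inv (h [^] (n i)))" for i
    have y: "y i \<in> carrier G" "g i = y i \<otimes> \<tau> i" for i using n(2)[of i] by (auto simp: y_def)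
    have dy: "hdist (P (g i)) (P (y i)) \<le> L" for i
    proof -
      have "hdist (P (g i)) (P (y i)) = len (\<tau> i)"
        using y tc by (simp add: act_mult x0 len_def hdist_commute)
      then show ?thesis using L by simp
    qed
    have yl: "(\<lambda>i. P (y i)) \<longlonglongrightarrow> z"
      by (rule tendsto_boundary_bounded[OF _ _ zb g(2) dy]) (use g y in auto)
    have "filterlim (\<lambda>i. gp x\<^sub>0 (P (y i)) (P (y i))) at_top sequentially"
      by (rule gp_at_boundary[OF _ yl _ yl zb x0]) (use y in auto)
    then have leny: "filterlim (\<lambda>i. len (y i)) at_top sequentially" by (simp add: gp_def len_def)
    have nl: "filterlim n at_top sequentially"
      unfolding filterlim_at_top
    proof
      fix Z :: nat
      have "eventually (\<lambda>i. real Z * \<beta> + M + 1 \<le> len (y i)) sequentially" using leny by (simp add: filterlim_at_top)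
      then show "eventually (\<lambda>i. Z \<le> n i) sequentially"
      proof eventually_elim
        case (elim i)
        have "len (y i) = len (h [^] (n i))" by (simp add: y_def)
        then have "real Z * \<beta> \<le> real (n i) * \<beta>" using elim lenpow[of "n i"] by linarith
        then show ?case using \<beta>(2) by simp
      qed
    qed
    \<comment> \<open>The product vanishes for every \<open>i\<close>, as \<open>y i\<close> is one
      of the two powers; this avoids choosing a subsequence on which the sign is constant.\<close>
    have "(\<lambda>i. norm (P (y i) - P (h [^] (n i))) * norm (P (y i) - P (inv (h [^] (n i))))) \<longlonglongrightarrow> norm (z - \<zeta>) * norm (z - \<eta>)"
      by (intro tendsto_intros yl filterlim_compose[OF to_\<zeta> nl] filterlim_compose[OF to_\<eta> nl])
    moreover have "norm (P (y i) - P (h [^] (n i))) * norm (P (y i) - P (inv (h [^] (n i)))) = 0" for i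
      by (simp add: y_def)
    ultimately have "norm (z - \<zeta>) * norm (z - \<eta>) = 0" by (simp add: LIMSEQ_const_iff)
    then show "z \<in> {\<zeta>, \<eta>}" by simp
  qed
  then show ?thesis by blast
qed

lemma elementary: "\<not> non_elementary G \<phi> x\<^sub>0"
proof -
  have "\<exists>\<eta>. limit_set G \<phi> x\<^sub>0 \<subseteq> {\<zeta>, \<eta>}"
  proof (cases "\<forall>f\<in>carrier G. stretch f = 1")
    case True
    then show ?thesis using limit_set_horosphere by blast
  next
    case False
    then obtain f where f: "f \<in> carrier G" "stretch f \<noteq> 1" by blast
    \<comment> \<open>An element shifting away from \<open>\<zeta>\<close> is replaced by its
      inverse.\<close>
    obtain h where h: "h \<in> carrier G" "stretch h < 1"
    proof (cases "stretch f < 1")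
      case True then show ?thesis using that f by blast
    next
      case False then show ?thesis using that[of "inv f"] f stretch_inv[of f] by simp
    qed
    define \<beta> where "\<beta> = - ln (stretch h)"
    have "stretch h = exp (- \<beta>)" "\<beta> > 0" using stretch_pos[OF h(1)] h(2) by (auto simp: \<beta>_def)
    then show ?thesis using limit_set_loxodromic[OF h(1)] by blast
  qed
  then obtain \<eta> where sub: "limit_set G \<phi> x\<^sub>0 \<subseteq> {\<zeta>, \<eta>}" by blast
  have "card (limit_set G \<phi> x\<^sub>0) \<le> card {\<zeta>, \<eta>}" using sub by (intro card_mono) auto
  also have "\<dots> \<le> 2" by (simp add: card_insert_if)
  finally show ?thesis using sub finite_subset by (auto simp: non_elementary_def)
qed

end


context kleinian
begin

text \<open>
  If no finite set of connecting elements worked, a limit of the \<open>h\<close> violating the bound for larger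
  and larger sets would be a global fixed point.
\<close>

lemma extension_lemma:
  assumes ne: "non_elementary G \<phi> x\<^sub>0"
  obtains F C where "finite F" "F \<subseteq> carrier G" "F \<noteq> {}"
    "\<And>g h. g \<in> carrier G \<Longrightarrow> h \<in> carrier G \<Longrightarrow> \<exists>f\<in>F. gp x\<^sub>0 (P (inv g)) (P (f \<otimes> h)) \<le> C"
proof (rule ccontr)
  assume "\<not> thesis"
  with that have neg: "\<exists>g\<in>carrier G. \<exists>h\<in>carrier G. \<forall>f\<in>F. gp x\<^sub>0 (P (inv g)) (P (f \<otimes> h)) > C"
    if "finite F" "F \<subseteq> carrier G" "F \<noteq> {}" for F C
    using that by (meson linorder_not_le)
  have inf: "infinite (carrier G)" by (rule infinite_carrier[OF ne])
  define e where "e = from_nat_into (carrier G)"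
  have e: "bij_betw e UNIV (carrier G)"
    unfolding e_def by (rule bij_betw_from_nat_into[OF countable_carrier inf])
  then have ec: "e i \<in> carrier G" for i by (auto simp: bij_betw_def)
  \<comment> \<open>The pair of index \<open>n\<close> fails for the elements \<open>e 0\<close> to
    \<open>e n\<close>, so every fixed element is eventually among those tested.\<close>
  have "\<exists>g h. g \<in> carrier G \<and> h \<in> carrier G \<and> (\<forall>i\<le>n. gp x\<^sub>0 (P (inv g)) (P (e i \<otimes> h)) > real n)" for n :: nat
  proof -
    have "\<exists>g\<in>carrier G. \<exists>h\<in>carrier G. \<forall>f\<in>e ` {..n}. gp x\<^sub>0 (P (inv g)) (P (f \<otimes> h)) > real n"
      using ec by (intro neg) auto
    then show ?thesis by fastforce
  qed
  then obtain g h where gh: "\<And>n. g n \<in> carrier G" "\<And>n. h n \<in> carrier G"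
      "\<And>n i. i \<le> n \<Longrightarrow> gp x\<^sub>0 (P (inv (g n))) (P (e i \<otimes> h n)) > real n"
    by metis
  define Y where "Y n = P (inv (g n))" for n
  have Y: "Y n \<in> hyp" for n using gh by (simp add: Y_def)
  have "compact (cball (0::'a) 1)" by simp
  moreover have "\<forall>n. Y n \<in> cball 0 1" using Y by (simp add: hyp_iff less_imp_le)
  ultimately obtain \<zeta> r where r: "strict_mono (r :: nat \<Rightarrow> nat)" "(Y \<circ> r) \<longlonglongrightarrow> \<zeta>"
    unfolding compact_def by blast
  have big: "filterlim (\<lambda>n. gp x\<^sub>0 (Y (r n)) (P (f \<otimes> h (r n)))) at_top sequentially" if f: "f \<in> carrier G" for f
  proof -
    obtain i where i: "f = e i" using e f by (auto simp: bij_betw_def)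
    have "eventually (\<lambda>n. real n \<le> gp x\<^sub>0 (Y (r n)) (P (f \<otimes> h (r n)))) sequentially"
      using eventually_ge_at_top[of i]
    proof eventually_elim
      case (elim n)
      have rn: "n \<le> r n" using r(1) by (rule seq_suble)
      then have "real (r n) < gp x\<^sub>0 (Y (r n)) (P (f \<otimes> h (r n)))"
        using gh(3)[of i "r n"] elim by (simp add: Y_def i)
      then show ?case using rn by linarith
    qed
    then show ?thesis by (rule filterlim_at_top_mono[OF filterlim_real_sequentially])
  qed
  have lim: "(\<lambda>n. Y (r n)) \<longlonglongrightarrow> \<zeta>" using r(2) by (simp add: o_def)
  have fh: "P (f \<otimes> h (r n)) \<in> hyp" if "f \<in> carrier G" for f n using that gh by simp
  note conv = gp_tendsto_boundary[OF Y lim fh x0 big]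
  \<comment> \<open>Every translate of the sequence \<open>P (h (r n))\<close> has large Gromov
    product with the one sequence \<open>Y (r n)\<close>, so all translates share its limit.\<close>
  interpret kleinian_fixed_point G \<phi> x\<^sub>0 "\<lambda>n. P (h (r n))" \<zeta>
  proof
    show "(\<lambda>n. \<phi> f (P (h (r n)))) \<longlonglongrightarrow> \<zeta>" if "f \<in> carrier G" for f
      using conv(2)[OF that that] that gh by (simp add: act_mult x0)
    show "\<zeta> \<in> hyp_boundary" using conv(1)[of \<one>] by simp
  qed (use gh in simp)
  show False using elementary ne by simp
qed

end

section \<open>Mass distribution and growth\<close>

text \<open>
  Mass distribution for a set coded by sequences: \<open>exp (- S (Suc m))\<close> is the scale at which codes
  first differing at \<open>m\<close> separate. A set of diameter \<open>r\<close> thus only meets one cylinder, whose mass is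
  at most \<open>r powr s / c\<close>.
\<close>

lemma hausdorff_measure_coded_nonzero:
  fixes N :: "nat \<Rightarrow> nat" and S :: "nat \<Rightarrow> real" and code :: "(nat \<Rightarrow> nat) \<Rightarrow> 'x"
  assumes N: "\<And>j. N j \<ge> 1" and s: "s > 0" and c: "c > 0"
    and S: "filterlim S at_top sequentially"
    and sep: "\<And>w w' m. (\<And>j. w j < N j) \<Longrightarrow> (\<And>j. w' j < N j) \<Longrightarrow> (\<And>j. j < m \<Longrightarrow> w j = w' j) \<Longrightarrow> w m \<noteq> w' m \<Longrightarrow>
        exp (- S (Suc m)) \<le> d (code w) (code w')"
    and mass: "\<And>M. c * exp (s * S (Suc M)) \<le> (\<Prod>j<M. real (N j))"
    and A: "\<And>w. (\<And>j. w j < N j) \<Longrightarrow> code w \<in> A"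
    and d: "\<And>x y. x \<in> X \<Longrightarrow> y \<in> X \<Longrightarrow> 0 \<le> d x y \<and> d x y \<le> B"
  shows "hausdorff_measure X d s A \<noteq> 0"
proof
  assume "hausdorff_measure X d s A = 0"
  then have "hausdorff_premeasure X d s 1 A = 0" by (simp add: hausdorff_measure_zero_iff)
  then obtain U where U: "A \<subseteq> (\<Union>i. U i)" "\<And>i. U i \<subseteq> X"
      "(\<Sum>i. ennreal (metric_diam d (U i) powr s)) < ennreal (c / 4)"
    unfolding hausdorff_premeasure_zero_iff using c by (metis divide_pos_pos zero_less_numeral)
  define D where "D i = metric_diam d (U i)" for i
  have D: "0 \<le> D i" for i
  proof (cases "U i = {}")
    case False
    then obtain x where x: "x \<in> U i" by blast
    then have "0 \<le> d x x" using d U(2) by blast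
    also have "\<dots> \<le> D i" unfolding D_def by (rule le_metric_diam[OF _ x x]) (use d U(2) in blast)
    finally show ?thesis .
  qed (simp add: D_def metric_diam_def)
  \<comment> \<open>A set of diameter 0 has no scale. Adding \<open>\<kappa> i\<close> to the power
    of the diameter yields a radius strictly larger than the diameter, at total cost
    \<open>c / 4\<close>. Together with the \<open>c / 4\<close> of the cover this leaves total mass
    at most 1/2.\<close>
  define \<kappa> where "\<kappa> i = c / 4 * (1/2) ^ Suc i" for i :: nat
  have \<kappa>: "\<kappa> i > 0" for i using c by (simp add: \<kappa>_def)
  define r where "r i = (D i powr s + \<kappa> i) powr (1 / s)" for i
  have rs: "r i powr s = D i powr s + \<kappa> i" for i
  proof -
    have "D i powr s + \<kappa> i > 0" using \<kappa>[of i] powr_ge_zero[of "D i" s] by linarith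
    then show ?thesis using s by (simp add: r_def powr_powr)
  qed
  have rpos: "r i > 0" for i
  proof -
    have "D i powr s + \<kappa> i > 0" using \<kappa>[of i] powr_ge_zero[of "D i" s] by linarith
    then show ?thesis by (simp add: r_def)
  qed
  have rD: "D i < r i" for i
  proof (rule ccontr)
    assume "\<not> D i < r i"
    then have "r i powr s \<le> D i powr s" using rpos[of i] s by (intro powr_mono2) auto
    then show False using rs[of i] \<kappa>[of i] by simp
  qed
  define \<mu> where "\<mu> j = uniform_count_measure {..<N j}" for j
  have ne: "{..<N j} \<noteq> {}" for j using N[of j] by (auto simp: lessThan_empty_iff)
  interpret product_prob_space \<mu> UNIV
    by (rule product_prob_spaceI) (auto simp: \<mu>_def intro!: prob_space_uniform_count_measure ne)
  define \<Omega> where "\<Omega> = space (Pi\<^sub>M UNIV \<mu>)"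
  have \<Omega>: "w \<in> \<Omega> \<longleftrightarrow> (\<forall>j. w j < N j)" for w
    by (simp add: \<Omega>_def \<mu>_def space_PiM space_uniform_count_measure PiE_UNIV_domain Pi_iff)
  have "\<exists>C. C \<in> sets (Pi\<^sub>M UNIV \<mu>) \<and> {w \<in> \<Omega>. code w \<in> U i} \<subseteq> C \<and> emeasure (Pi\<^sub>M UNIV \<mu>) C \<le> ennreal (r i powr s / c)" for i
  proof (cases "\<exists>v. v \<in> \<Omega> \<and> code v \<in> U i")
    case False
    then show ?thesis by (intro exI[of _ "{}"]) auto
  next
    case True
    then obtain v where v: "v \<in> \<Omega>" "code v \<in> U i" by blast
    have "eventually (\<lambda>n. - ln (r i) \<le> S n) sequentially" using S by (simp add: filterlim_at_top)
    then obtain n where "\<And>m. m \<ge> n \<Longrightarrow> - ln (r i) \<le> S m" by (auto simp: eventually_sequentially)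
    then have "- ln (r i) \<le> S (Suc n)" by simp
    then have "exp (- S (Suc n)) \<le> exp (ln (r i))" by (subst exp_le_cancel_iff) linarith
    then have ex: "\<exists>n. exp (- S (Suc n)) \<le> r i" using rpos[of i] by auto
    \<comment> \<open>The number of coordinates determined by \<open>U i\<close>: codes that first
      differ before \<open>M\<close> are separated by more than \<open>r i\<close>, while at
      \<open>M\<close> the scale is at most \<open>r i\<close>, where the hypothesis
      \<open>mass\<close> applies.\<close>
    define M where "M = (LEAST n. exp (- S (Suc n)) \<le> r i)"
    have M: "exp (- S (Suc M)) \<le> r i" unfolding M_def using ex by (rule LeastI_ex)
    have M': "r i < exp (- S (Suc m))" if "m < M" for m
      using not_less_Least[OF that[unfolded M_def]] by simp
    define C where "C = {w \<in> space (Pi\<^sub>M UNIV \<mu>). \<forall>j\<in>{..<M}. w j \<in> {v j}}"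
    have sv: "{v j} \<in> sets (\<mu> j)" for j using v(1) by (simp add: \<mu>_def \<Omega> sets_uniform_count_measure)
    have "C = prod_emb UNIV \<mu> {..<M} (Pi\<^sub>E {..<M} (\<lambda>j. {v j}))"
      unfolding C_def prod_emb_def by (auto simp: space_PiM PiE_iff)
    then have "C \<in> sets (Pi\<^sub>M UNIV \<mu>)" using sv by (simp add: sets_PiM_I)
    moreover have "{w \<in> \<Omega>. code w \<in> U i} \<subseteq> C"
    proof
      fix w assume w: "w \<in> {w \<in> \<Omega>. code w \<in> U i}"
      have "w j = v j" if "j < M" for j
      proof (rule ccontr)
        assume neq: "w j \<noteq> v j"
        define m where "m = (LEAST j. w j \<noteq> v j)"
        have m: "w m \<noteq> v m" unfolding m_def using neq by (rule LeastI)
        have m': "w j = v j" if "j < m" for j using not_less_Least[OF that[unfolded m_def]] by simp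
        have "m \<le> j" unfolding m_def by (rule Least_le) (rule neq)
        then have "m < M" using that by simp
        have "exp (- S (Suc m)) \<le> d (code w) (code v)"
          by (rule sep) (use w v m m' \<Omega> in auto)
        also have "\<dots> \<le> D i" unfolding D_def
          by (rule le_metric_diam[where B = B]) (use w v d U(2) in blast)+
        also have "\<dots> < r i" by (rule rD)
        finally show False using M'[OF \<open>m < M\<close>] by simp
      qed
      then show "w \<in> C" using w by (simp add: C_def \<Omega>_def)
    qed
    moreover have "emeasure (Pi\<^sub>M UNIV \<mu>) C \<le> ennreal (r i powr s / c)"
    proof -
      have "emeasure (Pi\<^sub>M UNIV \<mu>) C = (\<Prod>j<M. emeasure (\<mu> j) {v j})"
        unfolding C_def by (rule emeasure_PiM_Collect) (use sv in auto)
      also have "\<dots> = (\<Prod>j<M. ennreal (1 / real (N j)))"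
        using v(1) \<Omega> by (intro prod.cong refl) (auto simp: \<mu>_def emeasure_uniform_count_measure)
      also have "\<dots> = ennreal (\<Prod>j<M. 1 / real (N j))" by (intro prod_ennreal) auto
      also have "(\<Prod>j<M. 1 / real (N j)) = 1 / (\<Prod>j<M. real (N j))" by (simp add: prod_dividef)
      also have "1 / (\<Prod>j<M. real (N j)) \<le> 1 / (c * exp (s * S (Suc M)))"
        using c mass[of M] by (intro divide_left_mono mult_pos_pos) (auto intro: less_le_trans[of 0 "c * exp (s * S (Suc M))"])
      also have "\<dots> = exp (- S (Suc M)) powr s / c" by (simp add: powr_def) (simp add: exp_minus field_simps)
      also have "\<dots> \<le> r i powr s / c" using M s c by (intro divide_right_mono powr_mono2) auto
      finally show ?thesis using ennreal_leI by blast
    qed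
    ultimately show ?thesis by blast
  qed
  then have "\<forall>i. \<exists>C. C \<in> sets (Pi\<^sub>M UNIV \<mu>) \<and> {w \<in> \<Omega>. code w \<in> U i} \<subseteq> C \<and> emeasure (Pi\<^sub>M UNIV \<mu>) C \<le> ennreal (r i powr s / c)"
    by blast
  from choice[OF this] obtain C where C: "\<And>i. C i \<in> sets (Pi\<^sub>M UNIV \<mu>)" "\<And>i. {w \<in> \<Omega>. code w \<in> U i} \<subseteq> C i"
     "\<And>i. emeasure (Pi\<^sub>M UNIV \<mu>) (C i) \<le> ennreal (r i powr s / c)"
    by blast
  have "\<Omega> \<subseteq> (\<Union>i. C i)"
  proof
    fix w assume w: "w \<in> \<Omega>"
    then have "code w \<in> A" using A \<Omega> by blast
    then obtain i where "code w \<in> U i" using U(1) by blast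
    then show "w \<in> (\<Union>i. C i)" using C(2) w by blast
  qed
  then have "1 \<le> emeasure (Pi\<^sub>M UNIV \<mu>) (\<Union>i. C i)"
    using emeasure_mono[of \<Omega> "\<Union>i. C i" "Pi\<^sub>M UNIV \<mu>"] C(1) emeasure_space_1 by (simp add: \<Omega>_def)
  also have "\<dots> \<le> (\<Sum>i. emeasure (Pi\<^sub>M UNIV \<mu>) (C i))"
    using C(1) by (intro emeasure_subadditive_countably) auto
  also have "\<dots> \<le> (\<Sum>i. ennreal (1 / c) * (ennreal (D i powr s) + ennreal (\<kappa> i)))"
  proof (intro suminf_le)
    fix i
    have "ennreal (r i powr s / c) = ennreal (1 / c) * (ennreal (D i powr s) + ennreal (\<kappa> i))"
      using c \<kappa>[of i] by (simp add: rs ennreal_mult[symmetric] flip: ennreal_plus)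
    with C(3)[of i] show "emeasure (Pi\<^sub>M UNIV \<mu>) (C i) \<le> ennreal (1 / c) * (ennreal (D i powr s) + ennreal (\<kappa> i))" by simp
  qed auto
  also have "\<dots> = ennreal (1 / c) * ((\<Sum>i. ennreal (D i powr s)) + (\<Sum>i. ennreal (\<kappa> i)))"
    by (simp add: suminf_add)
  also have "(\<Sum>i. ennreal (\<kappa> i)) = ennreal (c / 4)"
    using c sums_mult[OF power_half_series, of "c / 4"] \<kappa>
    by (intro suminf_ennreal_eq) (auto simp: \<kappa>_def)
  also have "ennreal (1 / c) * ((\<Sum>i. ennreal (D i powr s)) + ennreal (c / 4))
      \<le> ennreal (1 / c) * (ennreal (c / 4) + ennreal (c / 4))"
    using U(3) by (intro mult_left_mono add_right_mono) (auto simp: D_def less_imp_le)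
  also have "\<dots> = ennreal (1 / 2)" using c by (simp add: ennreal_mult[symmetric] flip: ennreal_plus)
  finally have "(1::ennreal) \<le> ennreal (1 / 2)" .
  then have "ennreal 1 \<le> ennreal (1 / 2)" by simp
  then show False by (subst (asm) ennreal_le_iff) auto
qed

text \<open>Greedy choice: keep a point, discard the at most \<open>k\<close> points near it, and
  continue with the rest.\<close>

lemma separated_subset:
  fixes near :: "'b \<Rightarrow> 'b \<Rightarrow> bool"
  assumes "finite X" and "\<And>x y. near x y \<Longrightarrow> near y x" and "\<And>x. x \<in> X \<Longrightarrow> near x x"
    and "\<And>x. x \<in> X \<Longrightarrow> card {y \<in> X. near x y} \<le> k"
  shows "\<exists>Y\<subseteq>X. (\<forall>x\<in>Y. \<forall>y\<in>Y. x \<noteq> y \<longrightarrow> \<not> near x y) \<and> card X \<le> k * card Y"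
  using assms(1,3,4)
proof (induction X rule: finite_psubset_induct)
  case (psubset X)
  show ?case
  proof (cases "X = {}")
    case False
    then obtain x where x: "x \<in> X" by blast
    define X' where "X' = {y \<in> X. \<not> near x y}"
    have X': "X' \<subset> X" using x psubset.prems(1)[OF x] by (auto simp: X'_def)
    have cd: "card {y \<in> X'. near z y} \<le> k" if "z \<in> X'" for z
    proof -
      have "card {y \<in> X'. near z y} \<le> card {y \<in> X. near z y}"
        using psubset.hyps X' by (intro card_mono) auto
      then show ?thesis using psubset.prems(2)[of z] that X' by auto
    qed
    have "\<exists>Y\<subseteq>X'. (\<forall>x\<in>Y. \<forall>y\<in>Y. x \<noteq> y \<longrightarrow> \<not> near x y) \<and> card X' \<le> k * card Y"
      by (rule psubset.IH[OF X' psubset.prems(1) cd]) (use X' in auto)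
    then obtain Y where Y: "Y \<subseteq> X'" "\<forall>x\<in>Y. \<forall>y\<in>Y. x \<noteq> y \<longrightarrow> \<not> near x y" "card X' \<le> k * card Y"
      by blast
    have fin: "finite Y" "x \<notin> Y"
      using Y(1) X' psubset.hyps psubset.prems(1)[OF x] by (auto simp: X'_def intro: finite_subset)
    have "X = {y \<in> X. near x y} \<union> X'" by (auto simp: X'_def)
    then have "card X \<le> card {y \<in> X. near x y} + card X'" by (metis card_Un_le)
    also have "\<dots> \<le> k * card (insert x Y)" using psubset.prems(2)[OF x] Y(3) fin by simp
    finally have "card X \<le> k * card (insert x Y)" .
    moreover have "\<forall>u\<in>insert x Y. \<forall>v\<in>insert x Y. u \<noteq> v \<longrightarrow> \<not> near u v"
      using Y(1,2) assms(2) by (auto simp: X'_def)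
    moreover have "insert x Y \<subseteq> X" using x Y X' by auto
    ultimately show ?thesis by blast
  qed auto
qed

section \<open>Orbit growth and separated sets of children\<close>

context kleinian
begin

text \<open>Otherwise the annuli from \<open>n0\<close> on would be too small, and the orbital
  series would converge at an exponent \<open>t\<close> between \<open>s\<close> and the critical
  exponent.\<close>

lemma annulus_growth:
  assumes s: "s > 0" "ereal s < critical_exponent G \<phi> x\<^sub>0"
  shows "\<exists>n\<ge>n0. exp (s * real n) \<le> card {g \<in> carrier G. real n \<le> len g \<and> len g < real n + 1}"
proof (rule ccontr)
  define A where "A n = {g \<in> carrier G. real n \<le> len g \<and> len g < real n + 1}" for n :: nat
  have finA: "finite (A n)" for n
    by (rule finite_subset[OF _ finite_ball[of "real n + 1"]]) (auto simp: A_def)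
  assume "\<not> ?thesis"
  then have small: "card (A n) < exp (s * real n)" if "n \<ge> n0" for n
    using that by (force simp: A_def)
  obtain t where t: "ereal s < ereal t" "ereal t < critical_exponent G \<phi> x\<^sub>0"
    using ereal_dense2[OF s(2)] by blast
  then have st: "s < t" by simp
  have nn: "t > 0" using st s by simp
  define f where "f n = (if n < n0 then real (card (A n)) else exp ((s - t) * real n))" for n :: nat
  have f0: "f n \<ge> 0" for n by (simp add: f_def)
  have "summable (\<lambda>n. exp (s - t) ^ n)" using st by (intro summable_geometric) simp
  then have "summable (\<lambda>n. exp ((s - t) * real n))" by (simp add: exp_of_nat2_mult)
  then have sf: "summable f"
    by (rule summable_cong[THEN iffD1, rotated]) (auto simp: f_def eventually_sequentially intro!: exI[of _ n0])
  have le: "real (card (A n)) * exp (- t * real n) \<le> f n" for n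
  proof (cases "n < n0")
    case True
    have "real (card (A n)) * exp (- t * real n) \<le> real (card (A n)) * 1"
      using nn by (intro mult_left_mono) (auto simp: mult_nonneg_nonneg)
    then show ?thesis using True by (simp add: f_def)
  next
    case False
    then have "real (card (A n)) * exp (- t * real n) \<le> exp (s * real n) * exp (- t * real n)"
      using small[of n] by (intro mult_right_mono) auto
    also have "\<dots> = exp ((s - t) * real n)" by (simp add: algebra_simps flip: exp_add)
    finally show ?thesis using False by (simp add: f_def)
  qed
  have "(\<lambda>g. exp (- t * len g)) summable_on carrier G"
  proof (rule nonneg_bounded_partial_sums_imp_summable_on)
    show "eventually (\<lambda>X. sum (\<lambda>g. exp (- t * len g)) X \<le> suminf f) (finite_subsets_at_top (carrier G))"
    proof (rule eventually_finite_subsets_at_top_weakI)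
      fix X assume X: "finite X" "X \<subseteq> carrier G"
      define lev where "lev g = nat \<lfloor>len g\<rfloor>" for g
      have lev: "g \<in> A (lev g)" if "g \<in> X" for g
      proof -
        have "real (lev g) = of_int \<lfloor>len g\<rfloor>" using that X by (auto simp: lev_def)
        then show ?thesis using that X by (auto simp: A_def)
      qed
      have "sum (\<lambda>g. exp (- t * len g)) X = (\<Sum>n\<in>lev ` X. sum (\<lambda>g. exp (- t * len g)) {g \<in> X. lev g = n})"
        using X(1) by (intro sum.image_gen)
      also have "\<dots> \<le> (\<Sum>n\<in>lev ` X. f n)"
      proof (rule sum_mono)
        fix n
        have "sum (\<lambda>g. exp (- t * len g)) {g \<in> X. lev g = n} \<le> sum (\<lambda>g. exp (- t * real n)) {g \<in> X. lev g = n}"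
          using lev nn by (intro sum_mono) (auto simp: A_def)
        also have "\<dots> = card {g \<in> X. lev g = n} * exp (- t * real n)" by simp
        also have "\<dots> \<le> card (A n) * exp (- t * real n)"
          using lev by (intro mult_right_mono of_nat_mono card_mono finA) auto
        also have "\<dots> \<le> f n" by (rule le)
        finally show "sum (\<lambda>g. exp (- t * len g)) {g \<in> X. lev g = n} \<le> f n" .
      qed
      also have "\<dots> \<le> suminf f" using X(1) f0 by (intro sum_le_suminf sf) auto
      finally show "sum (\<lambda>g. exp (- t * len g)) X \<le> suminf f" .
    qed
  qed simp
  then have "critical_exponent G \<phi> x\<^sub>0 \<le> ereal t"
    unfolding critical_exponent_def by (intro Inf_lower) (auto simp: len_def)
  with t(2) show False by simp
qed

text \<open>The children are products \<open>f a \<otimes> a\<close> with \<open>a\<close> in one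
  annulus and \<open>f a\<close> a connecting element for \<open>g\<close>. This map is at most
  \<open>card F\<close> to one, and \<open>D\<close>-separation costs a further factor; both losses
  are independent of \<open>n\<close>, so the gap to a slightly larger exponent absorbs them. The
  growth is measured against the upper bound of the children's lengths, and \<open>N\<close> is the
  same for all \<open>g\<close>.\<close>

lemma separated_children:
  assumes s: "s > 0" "ereal s < critical_exponent G \<phi> x\<^sub>0" and D: "D > 0"
    and F: "finite F" "F \<subseteq> carrier G" "F \<noteq> {}"
      "\<And>g h. g \<in> carrier G \<Longrightarrow> h \<in> carrier G \<Longrightarrow> \<exists>f\<in>F. gp x\<^sub>0 (P (inv g)) (P (f \<otimes> h)) \<le> C"
    and cF: "\<And>f. f \<in> F \<Longrightarrow> len f \<le> cF"
  shows "\<exists>n N. R \<le> real n \<and> exp (s * (real n + 1 + cF)) \<le> real N \<and>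
    (\<forall>g\<in>carrier G. \<exists>ch::nat \<Rightarrow> 'g. \<forall>i<N. ch i \<in> carrier G \<and> gp x\<^sub>0 (P (inv g)) (P (ch i)) \<le> C \<and>
       real n - cF \<le> len (ch i) \<and> len (ch i) \<le> real n + 1 + cF \<and>
       (\<forall>j<N. i \<noteq> j \<longrightarrow> D \<le> hdist (P (ch i)) (P (ch j))))"
proof -
  obtain t where t: "ereal s < ereal t" "ereal t < critical_exponent G \<phi> x\<^sub>0"
    using ereal_dense2[OF s(2)] by blast
  then have st: "s < t" "t > 0" using s by auto
  define kD where "kD = card {g \<in> carrier G. len g \<le> D}"
  \<comment> \<open>All losses in one constant: separation, multiplicity, the additional length
    \<open>1 + cF\<close>, and a summand 1 for rounding up \<open>N\<close>.\<close>
  define K where "K = real (kD * card F) * (exp (s * (1 + cF)) + 1)"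
  have K0: "K \<ge> 0" by (simp add: K_def add_nonneg_nonneg)
  define n0 where "n0 = nat \<lceil>max R (ln (K + 1) / (t - s))\<rceil>"
  obtain n where n: "n \<ge> n0" "exp (t * real n) \<le> card {g \<in> carrier G. real n \<le> len g \<and> len g < real n + 1}"
    using annulus_growth[OF st(2) t(2)] by blast
  have nR: "R \<le> real n" and nl: "ln (K + 1) / (t - s) \<le> real n"
    using n(1) by (auto simp: n0_def nat_le_iff ceiling_le_iff)
  define A where "A = {g \<in> carrier G. real n \<le> len g \<and> len g < real n + 1}"
  have finA: "finite A"
    by (rule finite_subset[OF _ finite_ball[of "real n + 1"]]) (auto simp: A_def)
  define N where "N = nat \<lceil>exp (s * (real n + 1 + cF))\<rceil>"
  have N1: "exp (s * (real n + 1 + cF)) \<le> real N" by (simp add: N_def)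
  have N2: "real N \<le> exp (s * (real n + 1 + cF)) + 1"
  proof -
    have "0 \<le> \<lceil>exp (s * (real n + 1 + cF))\<rceil>"
      using exp_gt_zero[of "s * (real n + 1 + cF)"] unfolding zero_le_ceiling by linarith
    then have "real N = of_int \<lceil>exp (s * (real n + 1 + cF))\<rceil>" by (simp add: N_def)
    then show ?thesis using ceiling_correct[of "exp (s * (real n + 1 + cF))"] by linarith
  qed
  have big: "real (kD * card F) * real N \<le> card A"
  proof -
    have "real (kD * card F) * real N \<le> real (kD * card F) * (exp (s * (real n + 1 + cF)) + 1)"
      using N2 by (intro mult_left_mono) auto
    also have "\<dots> \<le> real (kD * card F) * ((exp (s * (1 + cF)) + 1) * exp (s * real n))"
    proof (rule mult_left_mono)
      have "exp (s * (real n + 1 + cF)) = exp (s * (1 + cF)) * exp (s * real n)"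
        by (simp add: algebra_simps flip: exp_add)
      moreover have "1 \<le> exp (s * real n)" using s by simp
      ultimately show "exp (s * (real n + 1 + cF)) + 1 \<le> (exp (s * (1 + cF)) + 1) * exp (s * real n)"
        by (simp add: distrib_right)
    qed simp
    also have "\<dots> = K * exp (s * real n)" by (simp add: K_def)
    also have "\<dots> \<le> exp ((t - s) * real n) * exp (s * real n)"
    proof (rule mult_right_mono)
      have "ln (K + 1) \<le> (t - s) * real n" using nl st by (simp add: pos_divide_le_eq mult.commute)
      then have "exp (ln (K + 1)) \<le> exp ((t - s) * real n)" by simp
      then show "K \<le> exp ((t - s) * real n)" using K0 by simp
    qed simp
    also have "\<dots> = exp (t * real n)" by (simp add: algebra_simps flip: exp_add)
    also have "\<dots> \<le> card A" using n(2) by (simp add: A_def)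
    finally show ?thesis .
  qed
  have "\<exists>ch::nat \<Rightarrow> 'g. \<forall>i<N. ch i \<in> carrier G \<and> gp x\<^sub>0 (P (inv g)) (P (ch i)) \<le> C \<and>
       real n - cF \<le> len (ch i) \<and> len (ch i) \<le> real n + 1 + cF \<and>
       (\<forall>j<N. i \<noteq> j \<longrightarrow> D \<le> hdist (P (ch i)) (P (ch j)))" if g: "g \<in> carrier G" for g
  proof -
    have "\<forall>a\<in>A. \<exists>f. f \<in> F \<and> gp x\<^sub>0 (P (inv g)) (P (f \<otimes> a)) \<le> C" using F(4)[OF g] by (auto simp: A_def)
    then obtain f where f: "\<And>a. a \<in> A \<Longrightarrow> f a \<in> F" "\<And>a. a \<in> A \<Longrightarrow> gp x\<^sub>0 (P (inv g)) (P (f a \<otimes> a)) \<le> C"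
      by metis
    have fc: "f a \<in> carrier G" "a \<in> carrier G" if "a \<in> A" for a using f(1)[OF that] F(2) that by (auto simp: A_def)
    define I where "I = (\<lambda>a. f a \<otimes> a) ` A"
    have finI: "finite I" using finA by (simp add: I_def)
    have I: "u \<in> carrier G \<and> gp x\<^sub>0 (P (inv g)) (P u) \<le> C \<and> real n - cF \<le> len u \<and> len u \<le> real n + 1 + cF"
      if "u \<in> I" for u
    proof -
      obtain a where a: "a \<in> A" "u = f a \<otimes> a" using \<open>u \<in> I\<close> unfolding I_def by blast
      have "len a \<le> len (inv (f a)) + len (f a \<otimes> a)"
        using len_mult[of "inv (f a)" "f a \<otimes> a"] fc[OF a(1)] by (simp add: m_assoc[symmetric])
      moreover have "len (f a \<otimes> a) \<le> len (f a) + len a" using len_mult fc[OF a(1)] by simp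
      moreover have "len (f a) \<le> cF" using cF f(1)[OF a(1)] by simp
      moreover have "real n \<le> len a" "len a < real n + 1" using a(1) by (auto simp: A_def)
      ultimately show ?thesis using f(2)[OF a(1)] a(2) fc[OF a(1)] by simp
    qed
    have "card A \<le> (\<Sum>u\<in>I. card {a \<in> A. f a \<otimes> a = u})"
    proof -
      have "A = (\<Union>u\<in>I. {a \<in> A. f a \<otimes> a = u})" by (auto simp: I_def)
      then have "card A = card (\<Union>u\<in>I. {a \<in> A. f a \<otimes> a = u})" by simp
      also have "\<dots> \<le> (\<Sum>u\<in>I. card {a \<in> A. f a \<otimes> a = u})" by (rule card_UN_le[OF finI])
      finally show ?thesis .
    qed
    also have "\<dots> \<le> (\<Sum>u\<in>I. card F)"
    proof (rule sum_mono)
      fix u assume u: "u \<in> I"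
      have "{a \<in> A. f a \<otimes> a = u} \<subseteq> (\<lambda>y. inv y \<otimes> u) ` F"
      proof
        fix a assume a: "a \<in> {a \<in> A. f a \<otimes> a = u}"
        then have "a = inv (f a) \<otimes> u" using fc[of a] by (auto simp: m_assoc[symmetric])
        then show "a \<in> (\<lambda>y. inv y \<otimes> u) ` F" using f(1) a by blast
      qed
      then show "card {a \<in> A. f a \<otimes> a = u} \<le> card F" using F(1) by (rule surj_card_le[rotated])
    qed
    finally have cA: "card A \<le> card I * card F" by simp
    define near where "near u v \<longleftrightarrow> hdist (P u) (P v) < D" for u v
    have "card {v \<in> I. near u v} \<le> kD" if u: "u \<in> I" for u
      unfolding kD_def
    proof (rule card_inj_on_le)
      show "inj_on (\<lambda>v. inv u \<otimes> v) {v \<in> I. near u v}" using I u by (intro inj_onI) simp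
      show "(\<lambda>v. inv u \<otimes> v) ` {v \<in> I. near u v} \<subseteq> {g \<in> carrier G. len g \<le> D}"
        using I u by (auto simp: near_def hdist_P)
    qed (rule finite_ball)
    then obtain Y where Y: "Y \<subseteq> I" "\<forall>u\<in>Y. \<forall>v\<in>Y. u \<noteq> v \<longrightarrow> \<not> near u v" "card I \<le> kD * card Y"
      using separated_subset[OF finI, of near kD] D by (auto simp: near_def hdist_commute)
    have "real (kD * card F) * real N \<le> real (kD * card F) * real (card Y)"
    proof -
      have "card A \<le> kD * card F * card Y"
      proof -
        have "card I * card F \<le> kD * card Y * card F" using Y(3) by (rule mult_le_mono1)
        with cA have "card A \<le> kD * card Y * card F" by (rule order_trans)
        then show ?thesis by (simp only: ac_simps)
      qed
      then show ?thesis using big by (smt (verit) of_nat_le_iff of_nat_mult)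
    qed
    moreover have "kD > 0"
    proof -
      have "\<one> \<in> {g \<in> carrier G. len g \<le> D}" using D by (simp add: len_def x0)
      then show ?thesis unfolding kD_def using finite_ball card_gt_0_iff by blast
    qed
    moreover have "card F > 0" using F by (simp add: card_gt_0_iff)
    ultimately have NY: "N \<le> card Y" by simp
    have finY: "finite Y" using Y(1) finI by (rule finite_subset)
    obtain ch where ch: "bij_betw ch {0..<card Y} Y" using ex_bij_betw_nat_finite[OF finY] by blast
    have chY: "ch i \<in> Y" if "i < N" for i using ch that NY by (auto simp: bij_betw_def)
    have chne: "ch i \<noteq> ch j" if "i < N" "j < N" "i \<noteq> j" for i j
      using ch that NY by (auto simp: bij_betw_def inj_on_def)
    show ?thesis
    proof (intro exI[of _ ch] allI impI conjI)
      fix i assume i: "i < N"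
      have "ch i \<in> I" using chY[OF i] Y(1) by blast
      then show "ch i \<in> carrier G" "gp x\<^sub>0 (P (inv g)) (P (ch i)) \<le> C"
          "real n - cF \<le> len (ch i)" "len (ch i) \<le> real n + 1 + cF"
        using I by blast+
      fix j assume j: "j < N" "i \<noteq> j"
      have "\<not> near (ch i) (ch j)" using Y(2) chY[OF i] chY[OF j(1)] chne[OF i j] by blast
      then show "D \<le> hdist (P (ch i)) (P (ch j))" by (simp add: near_def)
    qed
  qed
  then show ?thesis using nR N1 by blast
qed

end

section \<open>Trees of group elements\<close>

context kleinian
begin

lemma bdd_below_hdist_orbit: "x \<in> hyp \<Longrightarrow> bdd_below (hdist x ` orbit G \<phi> x\<^sub>0)"
  by (rule bdd_belowI[of _ 0]) (auto simp: orbit_eq)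

lemma ray_orbit_dist_le:
  assumes "\<xi> \<in> hyp_boundary" "t \<ge> 0" "g \<in> carrier G"
  shows "ray_orbit_dist G \<phi> x\<^sub>0 \<xi> t \<le> hdist (ray_pt x\<^sub>0 \<xi> t) (P g)"
  unfolding ray_orbit_dist_def hsetdist_def hray_eq[OF x0 assms(1,2)]
  by (intro cINF_lower bdd_below_hdist_orbit ray_pt_hyp(1)[OF x0 assms(1,2)]) (use assms in \<open>simp add: orbit_eq\<close>)

lemma ray_orbit_dist_nonneg:
  assumes "\<xi> \<in> hyp_boundary" "t \<ge> 0"
  shows "0 \<le> ray_orbit_dist G \<phi> x\<^sub>0 \<xi> t"
  unfolding ray_orbit_dist_def hsetdist_def hray_eq[OF x0 assms]
  using ray_pt_hyp(1)[OF x0 assms] by (intro cINF_greatest) (auto simp: orbit_eq)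

end

text \<open>
  A vertex \<open>g\<close> at level \<open>m\<close> has the children \<open>g \<otimes> child m g i\<close>, \<open>i < N m\<close>. The bound on Gromov products makes the orbit points along each branch a quasi-geodesic.
\<close>

locale kleinian_tree = kleinian G \<phi> x\<^sub>0
  for G :: "('g, 'r) monoid_scheme" (structure) and \<phi> :: "'g \<Rightarrow> 'a::euclidean_space \<Rightarrow> 'a" and x\<^sub>0 +
  fixes C :: real and N :: "nat \<Rightarrow> nat" and step_len :: "nat \<Rightarrow> real" and child :: "nat \<Rightarrow> 'g \<Rightarrow> nat \<Rightarrow> 'g"
  assumes N_pos: "\<And>m. N m \<ge> 1"
    and child: "\<And>m g i. g \<in> carrier G \<Longrightarrow> i < N m \<Longrightarrow> child m g i \<in> carrier G \<and>
        gp x\<^sub>0 (P (inv g)) (P (child m g i)) \<le> C \<and> 2 * C + 10 \<le> len (child m g i) \<and> len (child m g i) \<le> step_len m"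
begin

definition codes :: "(nat \<Rightarrow> nat) set" where "codes = {w. \<forall>j. w j < N j}"

fun vertex :: "(nat \<Rightarrow> nat) \<Rightarrow> nat \<Rightarrow> 'g" where
  "vertex w 0 = \<one>"
| "vertex w (Suc m) = vertex w m \<otimes> child m (vertex w m) (w m)"

lemma vertex_carrier: "w \<in> codes \<Longrightarrow> vertex w m \<in> carrier G"
  by (induction m) (auto simp: codes_def child)

lemma vertex_cong: "(\<And>j. j < m \<Longrightarrow> w j = w' j) \<Longrightarrow> vertex w m = vertex w' m"
  by (induction m) auto

lemma child_vertex:
  assumes "w \<in> codes"
  shows "child m (vertex w m) (w m) \<in> carrier G"
    "gp x\<^sub>0 (P (inv (vertex w m))) (P (child m (vertex w m) (w m))) \<le> C"
    "2 * C + 10 \<le> len (child m (vertex w m) (w m))"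
    "len (child m (vertex w m) (w m)) \<le> step_len m"
  using child[OF vertex_carrier[OF assms], of "w m" m] assms by (auto simp: codes_def)

lemma hdist_vertex_Suc:
  assumes w: "w \<in> codes"
  shows "hdist (P (vertex w m)) (P (vertex w (Suc m))) = len (child m (vertex w m) (w m))"
  using vertex_carrier[OF w] child_vertex(1)[OF w] by (simp add: act_mult x0 len_def)

lemma gp_vertex_Suc:
  assumes w: "w \<in> codes"
  shows "gp (P (vertex w m)) x\<^sub>0 (P (vertex w (Suc m))) \<le> C"
proof -
  define g u where "g = vertex w m" and "u = child m g (w m)"
  have gu: "g \<in> carrier G" "u \<in> carrier G" using vertex_carrier[OF w] child_vertex(1)[OF w] by (auto simp: g_def u_def)
  have "gp (P g) x\<^sub>0 (P (g \<otimes> u)) = gp (\<phi> g x\<^sub>0) (\<phi> g (P (inv g))) (\<phi> g (P u))"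
    using gu x0 by (simp add: act_mult)
  also have "\<dots> = gp x\<^sub>0 (P (inv g)) (P u)" using gu x0 by (intro gp_iso) auto
  finally show ?thesis using child_vertex(2)[OF w, of m] by (simp add: g_def u_def)
qed

lemma chain: "w \<in> codes \<Longrightarrow> hyperbolic_chain (\<lambda>m. P (vertex w m)) x\<^sub>0 C"
  by unfold_locales (use vertex_carrier gp_vertex_Suc hdist_vertex_Suc child_vertex(3) x0 in \<open>simp_all del: vertex.simps\<close>)

definition code_limit :: "(nat \<Rightarrow> nat) \<Rightarrow> 'a" where
  "code_limit w = (SOME \<xi>. \<xi> \<in> hyp_boundary \<and> (\<lambda>m. P (vertex w m)) \<longlonglongrightarrow> \<xi>)"

lemma code_limit:
  assumes "w \<in> codes"
  shows "code_limit w \<in> hyp_boundary" "(\<lambda>m. P (vertex w m)) \<longlonglongrightarrow> code_limit w"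
proof -
  have "\<exists>\<xi>. \<xi> \<in> hyp_boundary \<and> (\<lambda>m. P (vertex w m)) \<longlonglongrightarrow> \<xi>"
    using hyperbolic_chain.converges[OF chain[OF assms]] by blast
  from someI_ex[OF this] show "code_limit w \<in> hyp_boundary" "(\<lambda>m. P (vertex w m)) \<longlonglongrightarrow> code_limit w"
    by (auto simp: code_limit_def)
qed

lemma len_vertex_Suc:
  assumes w: "w \<in> codes"
  shows "len (vertex w m) + len (child m (vertex w m) (w m)) - 2 * C \<le> len (vertex w (Suc m))"
    and "len (vertex w (Suc m)) \<le> len (vertex w m) + len (child m (vertex w m) (w m))"
proof -
  show "len (vertex w m) + len (child m (vertex w m) (w m)) - 2 * C \<le> len (vertex w (Suc m))"
    using hyperbolic_chain.hdist_step[OF chain[OF w], of m] hdist_vertex_Suc[OF w, of m]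
    by (simp add: len_def del: vertex.simps)
  show "len (vertex w (Suc m)) \<le> len (vertex w m) + len (child m (vertex w m) (w m))"
    using len_mult[OF vertex_carrier[OF w] child_vertex(1)[OF w]] by simp
qed

lemma len_vertex_ge: "w \<in> codes \<Longrightarrow> 10 * real m \<le> len (vertex w m)"
  using hyperbolic_chain.hdist_grow[OF chain, of w 0 m] by (simp add: len_def x0)

lemma len_vertex_mono: "w \<in> codes \<Longrightarrow> len (vertex w m) \<le> len (vertex w (Suc m))"
  using hyperbolic_chain.hdist_grow[OF chain, of w m "Suc m"] by (simp add: len_def del: vertex.simps)

lemma len_vertex_le: "w \<in> codes \<Longrightarrow> len (vertex w m) \<le> (\<Sum>j<m. step_len j)"
proof (induction m)
  case (Suc m)
  then show ?case using len_vertex_Suc(2)[OF Suc.prems, of m] child_vertex(4)[OF Suc.prems, of m]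
    by (simp del: vertex.simps)
qed (simp add: len_def x0)

lemma ray_near_vertex:
  "w \<in> codes \<Longrightarrow> hdist (P (vertex w m)) (ray_pt x\<^sub>0 (code_limit w) (len (vertex w m))) \<le> 2 * C + 18"
  using hyperbolic_chain.ray_near_chain[OF chain code_limit] by (simp add: len_def)

lemma code_limit_limit_set:
  assumes w: "w \<in> codes" shows "code_limit w \<in> limit_set G \<phi> x\<^sub>0"
proof -
  have "P (vertex w m) \<noteq> code_limit w" for m
    using P_hyp[OF vertex_carrier[OF w], of m] code_limit(1)[OF w] by (auto simp: hyp_iff boundary_iff)
  then have "code_limit w islimpt P ` carrier G"
    unfolding islimpt_sequential using vertex_carrier[OF w] code_limit(2)[OF w]
    by (intro exI[of _ "\<lambda>m. P (vertex w m)"]) auto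
  then show ?thesis using code_limit(1)[OF w] by (simp add: limit_set_def orbit_eq)
qed

text \<open>At a smaller angle the two rays would be within 2 at time \<open>T\<close>. Each sibling
  is within \<open>2 * C + 18\<close> of its own ray, and the times \<open>T\<close> and
  \<open>T'\<close> differ by at most \<open>W + 2 * C\<close>, so the siblings would be at distance
  at most \<open>6 * C + 38 + W\<close>.\<close>

lemma code_limit_separated:
  assumes w: "w \<in> codes" "w' \<in> codes" and agree: "\<And>j. j < m \<Longrightarrow> w j = w' j" and neq: "w m \<noteq> w' m"
    and sib: "\<And>g i j. g \<in> carrier G \<Longrightarrow> i < N m \<Longrightarrow> j < N m \<Longrightarrow> i \<noteq> j \<Longrightarrow>
       len (child m g i) \<le> len (child m g j) + W \<and> 6 * C + 38 + W < hdist (P (child m g i)) (P (child m g j))"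
  shows "exp (- (\<Sum>j<Suc m. step_len j)) \<le> visual_dist x\<^sub>0 (code_limit w) (code_limit w')"
proof (rule ccontr)
  assume neg: "\<not> ?thesis"
  define g where "g = vertex w m"
  have g: "g \<in> carrier G" "vertex w' m = g"
    using vertex_carrier[OF w(1)] vertex_cong[of m w' w] agree by (auto simp: g_def)
  define u u' where "u = child m g (w m)" and "u' = child m g (w' m)"
  have wm: "w m < N m" "w' m < N m" using w by (auto simp: codes_def)
  have u: "u \<in> carrier G" "u' \<in> carrier G" using child[OF g(1)] wm by (auto simp: u_def u'_def)
  have v: "vertex w (Suc m) = g \<otimes> u" "vertex w' (Suc m) = g \<otimes> u'" using g by (auto simp: u_def u'_def g_def)
  define T T' where "T = len (g \<otimes> u)" and "T' = len (g \<otimes> u')"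
  have T: "len g + len u - 2 * C \<le> T" "T \<le> len g + len u" "len g + len u' - 2 * C \<le> T'" "T' \<le> len g + len u'"
    using len_vertex_Suc[OF w(1), of m] len_vertex_Suc[OF w(2), of m] g
    by (auto simp: T_def T'_def u_def u'_def g_def)
  have s1: "len u \<le> len u' + W" "6 * C + 38 + W < hdist (P u) (P u')" and s2: "len u' \<le> len u + W"
    using sib[OF g(1) wm neq] sib[OF g(1) wm(2,1)] neq by (auto simp: u_def u'_def)
  have C: "C \<ge> 0" using hyperbolic_chain.C_nonneg[OF chain[OF w(1)]] .
  have "\<bar>T - T'\<bar> \<le> W + 2 * C" using T s1(1) s2 by linarith
  moreover have T0: "T \<ge> 0" "T' \<ge> 0" using g u by (auto simp: T_def T'_def)
  define \<xi> \<xi>' where "\<xi> = code_limit w" and "\<xi>' = code_limit w'"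
  have b: "\<xi> \<in> hyp_boundary" "\<xi>' \<in> hyp_boundary" using code_limit(1) w by (auto simp: \<xi>_def \<xi>'_def)
  have "T \<le> (\<Sum>j<Suc m. step_len j)" using len_vertex_le[OF w(1), of "Suc m"] unfolding v T_def .
  then have "exp (- (\<Sum>j<Suc m. step_len j)) \<le> exp (- T)" by simp
  then have "visual_dist x\<^sub>0 \<xi> \<xi>' \<le> exp (- T)" using neg unfolding \<xi>_def \<xi>'_def by linarith
  then have c: "hdist (ray_pt x\<^sub>0 \<xi> T) (ray_pt x\<^sub>0 \<xi>' T) \<le> 2"
    by (rule rays_close_of_visual_dist[OF x0 b T0(1)])
  have c': "hdist (ray_pt x\<^sub>0 \<xi>' T) (ray_pt x\<^sub>0 \<xi>' T') = \<bar>T - T'\<bar>" by (rule hdist_ray_pt[OF x0 b(2) T0])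
  have n1: "hdist (P (g \<otimes> u)) (ray_pt x\<^sub>0 \<xi> T) \<le> 2 * C + 18"
    using ray_near_vertex[OF w(1), of "Suc m"] unfolding v T_def \<xi>_def .
  have n2: "hdist (P (g \<otimes> u')) (ray_pt x\<^sub>0 \<xi>' T') \<le> 2 * C + 18"
    using ray_near_vertex[OF w(2), of "Suc m"] unfolding v T'_def \<xi>'_def .
  have h: "P (g \<otimes> u) \<in> hyp" "P (g \<otimes> u') \<in> hyp" "ray_pt x\<^sub>0 \<xi> T \<in> hyp" "ray_pt x\<^sub>0 \<xi>' T \<in> hyp" "ray_pt x\<^sub>0 \<xi>' T' \<in> hyp"
    using g u T0 b ray_pt_hyp(1)[OF x0] by auto
  have "hdist (P u) (P u') = hdist (P (g \<otimes> u)) (P (g \<otimes> u'))" using g u by (simp add: act_mult x0)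
  also have "\<dots> \<le> hdist (P (g \<otimes> u)) (ray_pt x\<^sub>0 \<xi> T) + (hdist (ray_pt x\<^sub>0 \<xi> T) (ray_pt x\<^sub>0 \<xi>' T)
      + (hdist (ray_pt x\<^sub>0 \<xi>' T) (ray_pt x\<^sub>0 \<xi>' T') + hdist (ray_pt x\<^sub>0 \<xi>' T') (P (g \<otimes> u'))))"
    using hdist_triangle[OF h(1,3,2)] hdist_triangle[OF h(3,4,2)] hdist_triangle[OF h(4,5,2)] by linarith
  finally show False using c c' n1 n2 s1(2) \<open>\<bar>T - T'\<bar> \<le> W + 2 * C\<close> by (simp add: hdist_commute[of "ray_pt x\<^sub>0 \<xi>' T'"])
qed

text \<open>The ray is near the orbit at the times \<open>L m\<close>, and it cannot move away by
  more than \<open>step_len m\<close> before the next one. Level \<open>m\<close> is not reached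
  before time \<open>10 * m\<close>, so growth of the steps that is sublinear in \<open>m\<close> is
  sublinear in time.\<close>

lemma code_limit_sublinear:
  assumes w: "w \<in> codes" and sub: "\<And>\<epsilon>. \<epsilon> > 0 \<Longrightarrow> \<exists>B. \<forall>m. step_len m \<le> \<epsilon> * real m + B"
  shows "code_limit w \<in> sublinear_limit_set G \<phi> x\<^sub>0"
proof -
  define \<xi> where "\<xi> = code_limit w"
  have \<xi>: "\<xi> \<in> hyp_boundary" using code_limit(1)[OF w] by (simp add: \<xi>_def)
  define f where "f t = ray_orbit_dist G \<phi> x\<^sub>0 \<xi> t" for t
  define L where "L m = len (vertex w m)" for m
  have vc: "vertex w m \<in> carrier G" for m by (rule vertex_carrier[OF w])
  have L: "L m \<ge> 10 * real m" "L m \<le> L (Suc m)" "L 0 = 0" "L m \<ge> 0" "L (Suc m) \<le> L m + step_len m" for m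
    using len_vertex_ge[OF w, of m] len_vertex_mono[OF w, of m] vc[of m]
      len_vertex_Suc(2)[OF w, of m] child_vertex(4)[OF w, of m]
    by (auto simp: L_def len_def[of \<one>] x0 simp del: vertex.simps(2))
  have near: "hdist (ray_pt x\<^sub>0 \<xi> (L m)) (P (vertex w m)) \<le> 2 * C + 18" for m
    using ray_near_vertex[OF w, of m] by (simp add: \<xi>_def L_def hdist_commute)
  have fL: "f (L m) \<le> 2 * C + 18" for m
    unfolding f_def using ray_orbit_dist_le[OF \<xi> L(4) vc] near order_trans by blast
  have "Liminf at_top (\<lambda>t. ereal (f t)) < \<infinity>"
  proof (rule ccontr)
    assume "\<not> ?thesis"
    then have "ereal (2 * C + 18) < Liminf at_top (\<lambda>t. ereal (f t))" by simp
    from less_LiminfD[OF this] obtain t where t: "\<And>u. u \<ge> t \<Longrightarrow> 2 * C + 18 < f u"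
      by (auto simp: eventually_at_top_linorder)
    obtain m :: nat where "t \<le> real m" using real_arch_simple by blast
    then have "t \<le> L m" using L(1)[of m] by simp
    then show False using t[of "L m"] fL[of m] by simp
  qed
  then have con: "\<xi> \<in> conical_limit_set G \<phi> x\<^sub>0" using \<xi> by (simp add: conical_limit_set_def f_def)
  have key: "\<exists>m. 10 * real m \<le> t \<and> f t \<le> step_len m + 2 * C + 18" if t: "t \<ge> 0" for t
  proof -
    obtain n :: nat where "t < real n" using reals_Archimedean2 by blast
    then have ex: "\<exists>n. t < L n" using L(1)[of n] by (intro exI[of _ n]) simp
    define k where "k = (LEAST n. t < L n)"
    have k: "t < L k" unfolding k_def using ex by (rule LeastI_ex)
    then have "k \<noteq> 0" using L(3) t by (intro notI) simp
    then obtain m where m: "k = Suc m" using not0_implies_Suc by blast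
    have Lm: "L m \<le> t" using not_less_Least[of m "\<lambda>n. t < L n"] m by (simp add: k_def)
    have "f t \<le> hdist (ray_pt x\<^sub>0 \<xi> t) (P (vertex w m))" unfolding f_def by (rule ray_orbit_dist_le[OF \<xi> t vc])
    also have "\<dots> \<le> hdist (ray_pt x\<^sub>0 \<xi> t) (ray_pt x\<^sub>0 \<xi> (L m)) + hdist (ray_pt x\<^sub>0 \<xi> (L m)) (P (vertex w m))"
      by (intro hdist_triangle ray_pt_hyp(1)[OF x0 \<xi>] t L(4) P_hyp vc)
    also have "\<dots> \<le> step_len m + (2 * C + 18)"
      using hdist_ray_pt[OF x0 \<xi> t L(4)] near[of m] Lm k L(5)[of m] unfolding m by (smt (verit))
    finally show ?thesis using L(1)[of m] Lm by (intro exI[of _ m]) auto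
  qed
  have "((\<lambda>t. f t / t) \<longlongrightarrow> 0) at_top"
  proof (rule tendstoI)
    fix \<epsilon> :: real assume \<epsilon>: "\<epsilon> > 0"
    obtain B where B: "\<And>m. step_len m \<le> \<epsilon> * real m + B" using sub[OF \<epsilon>] by blast
    define B' where "B' = \<bar>B + 2 * C + 18\<bar>"
    show "eventually (\<lambda>t. dist (f t / t) 0 < \<epsilon>) at_top"
      using eventually_gt_at_top[of "max 1 (2 * B' / \<epsilon>)"]
    proof eventually_elim
      case (elim t)
      then have t: "t > 1" "2 * B' < t * \<epsilon>" using \<epsilon> by (auto simp: pos_divide_less_eq)
      obtain m where m: "10 * real m \<le> t" "f t \<le> step_len m + 2 * C + 18" using key[of t] t by auto
      have "\<epsilon> * (10 * real m) \<le> \<epsilon> * t" using m(1) \<epsilon> by (intro mult_left_mono) auto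
      then have "f t \<le> \<epsilon> * t / 10 + B'" using m(2) B[of m] unfolding B'_def by linarith
      also have "\<dots> < \<epsilon> * t"
      proof -
        have "0 < \<epsilon> * t" using t(1) \<epsilon> by (intro mult_pos_pos) auto
        moreover have "2 * B' < \<epsilon> * t" using t(2) by (simp add: mult.commute)
        ultimately show ?thesis by linarith
      qed
      finally have "f t / t < \<epsilon>" using t by (simp add: pos_divide_less_eq)
      moreover have "0 \<le> f t" unfolding f_def by (rule ray_orbit_dist_nonneg[OF \<xi>]) (use t in simp)
      ultimately show ?case using t by (simp add: dist_real_def)
    qed
  qed
  then show ?thesis using con by (simp add: sublinear_limit_set_def f_def \<xi>_def)
qed

text \<open>Where \<open>h\<close> is inserted, the ray passes near the orbit points of
  \<open>v\<close> and \<open>v \<otimes> f \<otimes> h\<close>. The inverse of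
  \<open>v \<otimes> f\<close> takes the first to within \<open>c\<close> of the base point and the
  second to \<open>P h\<close>, with one constant for all \<open>h\<close>.\<close>

lemma code_limit_myrberg:
  assumes w: "w \<in> codes"
    and ins: "\<And>h. h \<in> carrier G \<Longrightarrow> len h \<ge> R \<Longrightarrow> \<exists>m. \<forall>g\<in>carrier G. \<forall>i<N m. \<exists>f\<in>carrier G. len f \<le> c \<and> child m g i = f \<otimes> h"
  shows "code_limit w \<in> myrberg_limit_set G \<phi> x\<^sub>0"
proof (rule myrbergI[OF code_limit_limit_set[OF w]])
  fix h assume h: "h \<in> carrier G" "len h \<ge> R"
  define \<xi> where "\<xi> = code_limit w"
  have \<xi>: "\<xi> \<in> hyp_boundary" using code_limit(1)[OF w] by (simp add: \<xi>_def)
  obtain m where m: "\<And>g i. g \<in> carrier G \<Longrightarrow> i < N m \<Longrightarrow> \<exists>f\<in>carrier G. len f \<le> c \<and> child m g i = f \<otimes> h"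
    using ins[OF h] by blast
  define v where "v = vertex w m"
  have v: "v \<in> carrier G" using vertex_carrier[OF w] by (simp add: v_def)
  obtain f where f: "f \<in> carrier G" "len f \<le> c" "child m v (w m) = f \<otimes> h"
    using m[OF v, of "w m"] w by (auto simp: codes_def)
  have vS: "vertex w (Suc m) = v \<otimes> f \<otimes> h" using f h v by (simp add: v_def[symmetric] m_assoc)
  define g where "g = inv (v \<otimes> f)"
  have g: "g \<in> carrier G" using v f by (simp add: g_def)
  define t u where "t = len v" and "u = len (v \<otimes> f \<otimes> h)"
  have tu: "0 \<le> t" "t < u"
    using v len_vertex_Suc(1)[OF w, of m] child_vertex(3)[OF w, of m] unfolding vS by (auto simp: t_def u_def v_def[symmetric])
  have rh: "ray_pt x\<^sub>0 \<xi> r \<in> hyp" if "r \<ge> 0" for r by (rule ray_pt_hyp(1)[OF x0 \<xi> that])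
  have n1: "hdist (P v) (ray_pt x\<^sub>0 \<xi> t) \<le> 2 * C + 18" using ray_near_vertex[OF w, of m] by (simp add: v_def t_def \<xi>_def)
  have n2: "hdist (P (v \<otimes> f \<otimes> h)) (ray_pt x\<^sub>0 \<xi> u) \<le> 2 * C + 18"
    using ray_near_vertex[OF w, of "Suc m"] unfolding vS by (simp add: u_def \<xi>_def)
  have "hdist x\<^sub>0 (\<phi> g (ray_pt x\<^sub>0 \<xi> t)) = hdist (P (v \<otimes> f)) (ray_pt x\<^sub>0 \<xi> t)"
    using hdist_act_left[of "v \<otimes> f" x\<^sub>0 "ray_pt x\<^sub>0 \<xi> t"] v f rh[OF tu(1)] x0 by (simp add: g_def)
  also have "\<dots> \<le> hdist (P (v \<otimes> f)) (P v) + hdist (P v) (ray_pt x\<^sub>0 \<xi> t)"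
    using v f rh[OF tu(1)] by (intro hdist_triangle) auto
  also have "hdist (P (v \<otimes> f)) (P v) = len f" using v f by (simp add: act_mult x0 len_def hdist_commute)
  finally have 1: "hdist x\<^sub>0 (\<phi> g (ray_pt x\<^sub>0 \<xi> t)) \<le> c + (2 * C + 18)" using f(2) n1 by simp
  have "hdist (P h) (\<phi> g (ray_pt x\<^sub>0 \<xi> u)) = hdist (\<phi> (v \<otimes> f) (P h)) (ray_pt x\<^sub>0 \<xi> u)"
    using hdist_act_left[of "v \<otimes> f" "P h" "ray_pt x\<^sub>0 \<xi> u"] v f h rh tu by (simp add: g_def)
  also have "\<phi> (v \<otimes> f) (P h) = P (v \<otimes> f \<otimes> h)" using v f h by (simp add: act_mult[of "v \<otimes> f" h] x0)
  finally have 2: "hdist (P h) (\<phi> g (ray_pt x\<^sub>0 \<xi> u)) \<le> c + (2 * C + 18)"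
    using n2 f(2) len_nonneg[OF f(1)] by simp
  show "\<exists>g\<in>carrier G. \<exists>t u. 0 \<le> t \<and> t < u \<and> hdist x\<^sub>0 (\<phi> g (ray_pt x\<^sub>0 (code_limit w) t)) \<le> c + (2 * C + 18)
      \<and> hdist (P h) (\<phi> g (ray_pt x\<^sub>0 (code_limit w) u)) \<le> c + (2 * C + 18)"
    using g tu 1 2 unfolding \<xi>_def by blast
qed

end

text \<open>
  Special steps of arbitrary cost \<open>a k\<close> are taken at the sparse times \<open>J k\<close>; the factor \<open>k + 1\<close>
  makes their total cost sublinear in time.
\<close>

locale sparse_schedule =
  fixes a :: "nat \<Rightarrow> nat"
  assumes a_pos: "\<And>k. a k \<ge> 1"
begin

definition J :: "nat \<Rightarrow> nat" where "J k = (k + 1) * (\<Sum>i\<le>k. a i)"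

definition cost :: "nat \<Rightarrow> nat" where "cost m = (if m \<in> range J then a (inv_into UNIV J m) else 0)"

lemma strict_mono_J: "strict_mono J"
proof (rule strict_monoI_Suc)
  fix k
  have "(k + 1) * (\<Sum>i\<le>k. a i) < (k + 1) * (\<Sum>i\<le>Suc k. a i)" 
    using a_pos[of "Suc k"] by (intro mult_strict_left_mono) auto
  also have "\<dots> \<le> (Suc k + 1) * (\<Sum>i\<le>Suc k. a i)" by (intro mult_right_mono) auto
  finally show "J k < J (Suc k)" by (simp add: J_def)
qed

lemma inj_J: "inj J"
  using strict_mono_J by (rule strict_mono_imp_inj_on)

lemma cost_J: "cost (J k) = a k"
  by (simp add: cost_def inv_f_f[OF inj_J])

text \<open>If \<open>k\<close> is the last index with \<open>J k \<le> M\<close>, the cost up to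
  \<open>M\<close> is at most \<open>J k / (k + 1)\<close>, hence at most
  \<open>M / (k + 1)\<close>. The finitely many small \<open>k\<close> go into the constant.\<close>

lemma sum_cost_sublinear:
  assumes "\<epsilon> > 0"
  shows "\<exists>B. \<forall>M. real (\<Sum>m\<le>M. cost m) \<le> \<epsilon> * real M + B"
proof -
  obtain K :: nat where K: "1 / \<epsilon> < real K" using reals_Archimedean2 by blast
  have "real (\<Sum>m\<le>M. cost m) \<le> \<epsilon> * real M + real (\<Sum>i\<le>K. a i)" for M
  proof -
    define S where "S = {k. J k \<le> M}"
    have "k \<le> J k" for k by (rule strict_mono_imp_increasing[OF strict_mono_J])
    then have fin: "finite S" by (intro finite_subset[of S "{..M}"]) (auto simp: S_def intro: order_trans)
    have "(\<Sum>m\<le>M. cost m) = (\<Sum>m\<in>J ` S. cost m)"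
      by (rule sum.mono_neutral_right) (auto simp: S_def cost_def)
    also have "\<dots> = (\<Sum>k\<in>S. a k)"
      using inj_J by (subst sum.reindex) (auto simp: cost_J intro: inj_on_subset)
    finally have e: "(\<Sum>m\<le>M. cost m) = (\<Sum>k\<in>S. a k)" .
    show ?thesis
    proof (cases "S = {}")
      case True
      have "0 \<le> \<epsilon> * real M" using assms by simp
      moreover have "0 \<le> real (\<Sum>i\<le>K. a i)" by (rule of_nat_0_le_iff)
      ultimately have "0 \<le> \<epsilon> * real M + real (\<Sum>i\<le>K. a i)" by linarith
      then show ?thesis using True by (simp add: e del: of_nat_sum)
    next
      case False
      define k where "k = Max S"
      have k: "k \<in> S" unfolding k_def using fin False by (rule Max_in)
      have "(\<Sum>k\<in>S. a k) \<le> (\<Sum>i\<le>k. a i)"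
        using fin by (intro sum_mono2) (auto simp: k_def)
      then have le: "real (\<Sum>m\<le>M. cost m) \<le> real (\<Sum>i\<le>k. a i)" unfolding e by (rule of_nat_mono)
      show ?thesis
      proof (cases "k \<le> K")
        case True
        then have "(\<Sum>i\<le>k. a i) \<le> (\<Sum>i\<le>K. a i)" by (intro sum_mono2) auto
        then have "real (\<Sum>i\<le>k. a i) \<le> real (\<Sum>i\<le>K. a i)" by (rule of_nat_mono)
        moreover have "0 \<le> \<epsilon> * real M" using assms by simp
        ultimately show ?thesis using le by linarith
      next
        case False
        have "real (k + 1) * real (\<Sum>i\<le>k. a i) = real (J k)" unfolding J_def by (simp only: of_nat_mult)
        also have "\<dots> \<le> real M" using k by (simp add: S_def)
        finally have 1: "real (k + 1) * real (\<Sum>i\<le>k. a i) \<le> real M" .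
        have "1 / \<epsilon> \<le> real (k + 1)" using K False by simp
        then have "1 \<le> \<epsilon> * real (k + 1)" using assms by (simp add: field_simps)
        then have "1 * real (\<Sum>i\<le>k. a i) \<le> \<epsilon> * real (k + 1) * real (\<Sum>i\<le>k. a i)"
          by (intro mult_right_mono of_nat_0_le_iff)
        also have "\<dots> \<le> \<epsilon> * real M" using 1 assms by (simp add: mult.assoc)
        finally have "real (\<Sum>i\<le>k. a i) \<le> \<epsilon> * real M" by simp
        moreover have "0 \<le> real (\<Sum>i\<le>K. a i)" by (rule of_nat_0_le_iff)
        ultimately show ?thesis using le by linarith
      qed
    qed
  qed
  then show ?thesis by blast
qed

end

section \<open>The tree with insertions and the lower bound for the dimension\<close>

context kleinian
begin

lemma hausdorff_measure_nonzero:
  assumes ne: "non_elementary G \<phi> x\<^sub>0" and s: "s > 0" "ereal s < critical_exponent G \<phi> x\<^sub>0"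
  shows "hausdorff_measure hyp_boundary (visual_dist x\<^sub>0) s
     (myrberg_limit_set G \<phi> x\<^sub>0 \<inter> sublinear_limit_set G \<phi> x\<^sub>0) \<noteq> 0"
proof -
  obtain F C where F: "finite F" "F \<subseteq> carrier G" "F \<noteq> {}"
    "\<And>g h. g \<in> carrier G \<Longrightarrow> h \<in> carrier G \<Longrightarrow> \<exists>f\<in>F. gp x\<^sub>0 (P (inv g)) (P (f \<otimes> h)) \<le> C"
    using extension_lemma[OF ne] by blast
  have C0: "C \<ge> 0"
  proof -
    obtain f where f: "f \<in> F" "gp x\<^sub>0 (P (inv \<one>)) (P (f \<otimes> \<one>)) \<le> C" using F(4)[of \<one> \<one>] by auto
    then have "f \<in> carrier G" using F(2) by blast
    then have "0 \<le> gp x\<^sub>0 (P (inv \<one>)) (P (f \<otimes> \<one>))" by (intro gp_nonneg x0 P_hyp) auto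
    with f(2) show ?thesis by linarith
  qed
  define c where "c = Max (len ` F)"
  have c: "len f \<le> c" if "f \<in> F" for f unfolding c_def using F(1) that by (intro Max_ge) auto
  have c0: "c \<ge> 0"
  proof -
    obtain f where "f \<in> F" using F(3) by blast
    then show ?thesis using c[of f] len_nonneg[of f] F(2) by fastforce
  qed
  \<comment> \<open>A connecting element of length at most \<open>c\<close> shortens an element of
    length \<open>R\<close> to no less than \<open>2 * C + 10\<close>. \<open>W\<close> is the width
    of the range from \<open>real n - c\<close> to \<open>real n + 1 + c\<close>, and
    \<open>D\<close> exceeds by 1 the separation that \<open>code_limit_separated\<close> asks for
    strictly.\<close>
  define R where "R = 2 * C + 10 + c"
  define W where "W = 1 + 2 * c"
  define D where "D = 6 * C + 39 + W"
  have D0: "D > 0" using C0 c0 by (simp add: D_def W_def)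
  obtain t where t: "ereal s < ereal t" "ereal t < critical_exponent G \<phi> x\<^sub>0"
    using ereal_dense2[OF s(2)] by blast
  then have st: "s < t" "t > 0" using s by auto
  obtain n N0 where n: "R \<le> real n" "exp (t * (real n + 1 + c)) \<le> real N0"
    and ch_ex: "\<forall>g\<in>carrier G. \<exists>ch::nat \<Rightarrow> 'g. \<forall>i<N0. ch i \<in> carrier G \<and> gp x\<^sub>0 (P (inv g)) (P (ch i)) \<le> C \<and>
       real n - c \<le> len (ch i) \<and> len (ch i) \<le> real n + 1 + c \<and>
       (\<forall>j<N0. i \<noteq> j \<longrightarrow> D \<le> hdist (P (ch i)) (P (ch j)))"
    using separated_children[OF st(2) t(2) D0 F c, of R] by blast
  define l where "l = real n + 1 + c"
  have l: "l > 0" using c0 by (simp add: l_def)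
  have N0: "exp (t * l) \<le> real N0" using n(2) by (simp add: l_def)
  have "0 < exp (t * l)" by simp
  with N0 have "0 < real N0" by linarith
  then have N0_pos: "N0 \<ge> 1" by simp
  from bchoice[OF ch_ex] obtain ch :: "'g \<Rightarrow> nat \<Rightarrow> 'g" where ch: "\<And>g i. g \<in> carrier G \<Longrightarrow> i < N0 \<Longrightarrow>
       ch g i \<in> carrier G \<and> gp x\<^sub>0 (P (inv g)) (P (ch g i)) \<le> C \<and>
       real n - c \<le> len (ch g i) \<and> len (ch g i) \<le> real n + 1 + c \<and>
       (\<forall>j<N0. i \<noteq> j \<longrightarrow> D \<le> hdist (P (ch g i)) (P (ch g j)))"
    by blast
  define H where "H = {h \<in> carrier G. R \<le> len h}"
  have "H \<noteq> {}"
  proof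
    assume "H = {}"
    then have "carrier G \<subseteq> {g \<in> carrier G. len g \<le> R}" by (auto simp: H_def)
    then show False using finite_ball[of R] infinite_carrier[OF ne] finite_subset by blast
  qed
  define hs where "hs = from_nat_into H"
  have "countable H" by (rule countable_subset[OF _ countable_carrier]) (auto simp: H_def)
  then have hs: "range hs = H" unfolding hs_def using \<open>H \<noteq> {}\<close> by (intro range_from_nat_into)
  have hsc: "hs k \<in> carrier G" "R \<le> len (hs k)" for k using hs by (auto simp: H_def)
  \<comment> \<open>The summand 1 makes every cost positive, as the schedule requires and as the
    estimate \<open>low\<close> uses.\<close>
  define a where "a k = nat \<lceil>len (hs k) + c\<rceil> + 1" for k
  interpret sparse_schedule a by unfold_locales (simp add: a_def)
  have a: "len (hs k) + c \<le> real (a k)" for k unfolding a_def by linarith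
  have "\<forall>g k. \<exists>f. g \<in> carrier G \<longrightarrow> f \<in> F \<and> gp x\<^sub>0 (P (inv g)) (P (f \<otimes> hs k)) \<le> C"
    using F(4) hsc by blast
  then obtain e where e: "\<And>g k. g \<in> carrier G \<Longrightarrow> e g k \<in> F \<and> gp x\<^sub>0 (P (inv g)) (P (e g k \<otimes> hs k)) \<le> C"
    by metis
  \<comment> \<open>A single child at the special levels means that two codes never differ there, so
    siblings are compared only where \<open>ch\<close> separates them.\<close>
  define N where "N m = (if m \<in> range J then 1 else N0)" for m
  define step_len where "step_len m = (if m \<in> range J then real (cost m) else l)" for m
  define child where "child m g i = (if m \<in> range J then e g (inv_into UNIV J m) \<otimes> hs (inv_into UNIV J m) else ch g i)" for m g i
  interpret kleinian_tree G \<phi> x\<^sub>0 C N step_len child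
  proof
    show "1 \<le> N m" for m using N0_pos by (simp add: N_def)
    fix m g i assume g: "g \<in> carrier G" and i: "i < N m"
    show "child m g i \<in> carrier G \<and> gp x\<^sub>0 (P (inv g)) (P (child m g i)) \<le> C \<and>
        2 * C + 10 \<le> len (child m g i) \<and> len (child m g i) \<le> step_len m"
    proof (cases "m \<in> range J")
      case True
      define k where "k = inv_into UNIV J m"
      define f where "f = e g k"
      have f: "f \<in> F" "f \<in> carrier G" "len f \<le> c" "gp x\<^sub>0 (P (inv g)) (P (f \<otimes> hs k)) \<le> C"
        using e[OF g, of k] F(2) c by (auto simp: f_def)
      have "len (hs k) \<le> len (inv f) + len (f \<otimes> hs k)"
        using len_mult[of "inv f" "f \<otimes> hs k"] f(2) hsc[of k] by (simp add: m_assoc[symmetric])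
      then have "2 * C + 10 \<le> len (f \<otimes> hs k)" using f(2,3) hsc(2)[of k] by (simp add: R_def)
      moreover have "len (f \<otimes> hs k) \<le> real (a k)"
        using len_mult[OF f(2) hsc(1)[of k]] a[of k] f(3) by linarith
      ultimately show ?thesis using True f hsc[of k]
        by (simp add: child_def step_len_def cost_def flip: k_def f_def)
    next
      case False
      then show ?thesis using ch[OF g, of i] i n(1) by (auto simp: child_def step_len_def N_def l_def R_def)
    qed
  qed
  have step_len_le: "step_len m \<le> l + real (cost m)" and step_len_ge: "10 \<le> step_len m" for m
  proof -
    show "step_len m \<le> l + real (cost m)" using l by (simp add: step_len_def)
    show "10 \<le> step_len m" using child[OF one_closed, of 0 m] N_pos[of m] C0 by simp
  qed
  have sub: "\<exists>B. \<forall>m. step_len m \<le> \<epsilon> * real m + B" if \<epsilon>: "\<epsilon> > 0" for \<epsilon>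
  proof -
    obtain B where B: "\<And>M. real (\<Sum>m\<le>M. cost m) \<le> \<epsilon> * real M + B" using sum_cost_sublinear[OF \<epsilon>] by blast
    have "step_len m \<le> \<epsilon> * real m + (B + l)" for m
    proof -
      have "cost m \<le> (\<Sum>m\<le>m. cost m)" by (rule member_le_sum) auto
      then have "real (cost m) \<le> real (\<Sum>m\<le>m. cost m)" by (rule of_nat_mono)
      then show ?thesis using B[of m] step_len_le[of m] by linarith
    qed
    then show ?thesis by blast
  qed
  have ins: "\<exists>m. \<forall>g\<in>carrier G. \<forall>i<N m. \<exists>f\<in>carrier G. len f \<le> c \<and> child m g i = f \<otimes> h"
    if h: "h \<in> carrier G" "len h \<ge> R" for h
  proof -
    have "h \<in> range hs" using h hs by (simp add: H_def)
    then obtain k where k: "h = hs k" by blast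
    have ck: "child (J k) g i = e g k \<otimes> h" for g i by (simp add: child_def inv_f_f[OF inj_J] k)
    have "\<exists>f\<in>carrier G. len f \<le> c \<and> child (J k) g i = f \<otimes> h" if "g \<in> carrier G" for g i
      unfolding ck using e[OF that, of k] F(2) c by (intro bexI[of _ "e g k"]) auto
    then show ?thesis by blast
  qed
  define S where "S M = (\<Sum>j<M. step_len j)" for M
  have "\<exists>b>0. \<forall>M. b * exp (s * S (Suc M)) \<le> (\<Prod>j<M. real (N j))"
  proof -
    \<comment> \<open>Each unit of cost is charged \<open>s\<close> through the scale and
      \<open>t * l\<close> through missing branching. With this \<open>\<epsilon>\<close> the charge
      for \<open>M\<close> levels is at most the surplus \<open>(t - s) * l * real M\<close>, up to
      the constant in \<open>E\<close>.\<close>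
    define \<epsilon> where "\<epsilon> = (t - s) * l / (t * l + s)"
    have den: "t * l + s > 0" using st l s by (intro add_pos_pos mult_pos_pos)
    have \<epsilon>: "\<epsilon> > 0" using st l den by (simp add: \<epsilon>_def)
    obtain B where B: "\<And>M. real (\<Sum>m\<le>M. cost m) \<le> \<epsilon> * real M + B" using sum_cost_sublinear[OF \<epsilon>] by blast
    define E where "E = (t * l + s) * B + s * l"
    have "exp (- E) * exp (s * S (Suc M)) \<le> (\<Prod>j<M. real (N j))" for M
    proof -
      define I where "I = real (\<Sum>m\<le>M. cost m)"
      have I: "I \<le> \<epsilon> * real M + B" using B by (simp add: I_def)
      have "S (Suc M) \<le> (\<Sum>j<Suc M. l + real (cost j))" unfolding S_def by (intro sum_mono step_len_le)
      also have "\<dots> = l * real (Suc M) + I" by (simp add: sum.distrib I_def lessThan_Suc_atMost mult.commute)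
      finally have S: "S (Suc M) \<le> l * real (Suc M) + I" .
      \<comment> \<open>One formula for both kinds of level: the cost is 0 where the tree branches,
        and at least 1 at a special level, where the left side is then at most 1.\<close>
      have low: "exp (t * l * (1 - real (cost j))) \<le> real (N j)" for j
      proof (cases "j \<in> range J")
        case True
        then obtain k where "j = J k" by blast
        then have "1 \<le> real (cost j)" using a_pos[of k] by (simp add: cost_J)
        then have "t * l * (1 - real (cost j)) \<le> 0" using st l by (intro mult_nonneg_nonpos) auto
        then show ?thesis using True by (simp add: N_def)
      next
        case False
        then show ?thesis using N0 by (simp add: N_def cost_def)
      qed
      have "(\<Sum>j<M. t * l * (1 - real (cost j))) = t * l * (real M - (\<Sum>j<M. real (cost j)))"
        by (simp add: sum_distrib_left[symmetric] sum_subtractf)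
      moreover have "(\<Sum>j<M. real (cost j)) \<le> I"
        unfolding I_def of_nat_sum by (intro sum_mono2) auto
      ultimately have P1: "t * l * (real M - I) \<le> (\<Sum>j<M. t * l * (1 - real (cost j)))"
        using st l by (simp add: mult_left_mono)
      have "- E + s * S (Suc M) \<le> - E + s * (l * real (Suc M) + I)" using S s by simp
      also have "\<dots> \<le> t * l * (real M - I)"
      proof -
        have "(t * l + s) * I \<le> (t * l + s) * (\<epsilon> * real M + B)" using I den by (intro mult_left_mono) auto
        also have "\<dots> = (t - s) * l * real M + (t * l + s) * B"
          using den by (simp add: \<epsilon>_def distrib_left)
        finally have "(t * l + s) * I \<le> (t - s) * l * real M + (t * l + s) * B" .
        then show ?thesis by (simp add: E_def algebra_simps)
      qed
      finally have "exp (- E + s * S (Suc M)) \<le> exp (\<Sum>j<M. t * l * (1 - real (cost j)))"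
        using P1 by (subst exp_le_cancel_iff) linarith
      also have "\<dots> = (\<Prod>j<M. exp (t * l * (1 - real (cost j))))" by (simp add: exp_sum)
      also have "\<dots> \<le> (\<Prod>j<M. real (N j))" using low by (intro prod_mono) auto
      finally show ?thesis by (simp only: exp_add)
    qed
    then show ?thesis by (intro exI[of _ "exp (- E)"]) auto
  qed
  then obtain b where b: "b > 0" "\<And>M. b * exp (s * S (Suc M)) \<le> (\<Prod>j<M. real (N j))" by blast
  have S_top: "filterlim S at_top sequentially"
  proof (rule filterlim_at_top_mono)
    show "filterlim (\<lambda>M. 10 * real M) at_top sequentially" by real_asymp
    show "eventually (\<lambda>M. 10 * real M \<le> S M) sequentially"
    proof (intro always_eventually allI)
      fix M
      have "(\<Sum>j<M. 10) \<le> (\<Sum>j<M. step_len j)" by (intro sum_mono step_len_ge)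
      then show "10 * real M \<le> S M" by (simp add: S_def)
    qed
  qed
  show ?thesis
  proof (rule hausdorff_measure_coded_nonzero[of N s b S "visual_dist x\<^sub>0" code_limit, OF N_pos s(1) b(1) S_top _ b(2)])
    fix w w' :: "nat \<Rightarrow> nat" and m
    assume ww: "\<And>j. w j < N j" "\<And>j. w' j < N j" and agree: "\<And>j. j < m \<Longrightarrow> w j = w' j" and neq: "w m \<noteq> w' m"
    have "\<not> (N m = 1)" using ww(1)[of m] ww(2)[of m] neq by auto
    then have m: "m \<notin> range J" by (auto simp: N_def)
    show "exp (- S (Suc m)) \<le> visual_dist x\<^sub>0 (code_limit w) (code_limit w')"
      unfolding S_def
    proof (rule code_limit_separated[where W = W])
      fix g i j assume g: "g \<in> carrier G" and ij: "i < N m" "j < N m" "i \<noteq> j"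
      have ij': "i < N0" "j < N0" using ij m by (auto simp: N_def)
      have "len (ch g i) \<le> len (ch g j) + W" using ch[OF g ij'(1)] ch[OF g ij'(2)] by (simp add: W_def)
      moreover have "D \<le> hdist (P (ch g i)) (P (ch g j))" using ch[OF g ij'(1)] ij' ij(3) by blast
      ultimately show "len (child m g i) \<le> len (child m g j) + W \<and> 6 * C + 38 + W < hdist (P (child m g i)) (P (child m g j))"
        using m by (simp add: child_def D_def)
    qed (use ww agree neq in \<open>auto simp: codes_def\<close>)
  next
    fix w :: "nat \<Rightarrow> nat" assume "\<And>j. w j < N j"
    then have w: "w \<in> codes" by (simp add: codes_def)
    show "code_limit w \<in> myrberg_limit_set G \<phi> x\<^sub>0 \<inter> sublinear_limit_set G \<phi> x\<^sub>0"
      using code_limit_sublinear[OF w sub] code_limit_myrberg[OF w ins] by blast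
  next
    fix x y :: 'a assume "x \<in> hyp_boundary" "y \<in> hyp_boundary"
    then show "0 \<le> visual_dist x\<^sub>0 x y \<and> visual_dist x\<^sub>0 x y \<le> pi" using cos_visual_dist[OF x0] by blast
  qed
qed

lemma hausdorff_dim_lower:
  assumes ne: "non_elementary G \<phi> x\<^sub>0"
  shows "critical_exponent G \<phi> x\<^sub>0 \<le> hausdorff_dim hyp_boundary (visual_dist x\<^sub>0)
     (myrberg_limit_set G \<phi> x\<^sub>0 \<inter> sublinear_limit_set G \<phi> x\<^sub>0)"
  unfolding hausdorff_dim_def
proof (rule Inf_greatest)
  fix x assume "x \<in> {ereal s |s. 0 < s \<and> hausdorff_measure hyp_boundary (visual_dist x\<^sub>0) s
     (myrberg_limit_set G \<phi> x\<^sub>0 \<inter> sublinear_limit_set G \<phi> x\<^sub>0) = 0}"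
  then show "critical_exponent G \<phi> x\<^sub>0 \<le> x"
    using hausdorff_measure_nonzero[OF ne] by (force simp: not_less[symmetric])
qed

end

theorem theorem2:
  fixes G :: "('g, 'r) monoid_scheme"
    and \<phi> :: "'g \<Rightarrow> 'a::euclidean_space \<Rightarrow> 'a"
    and x\<^sub>0 :: 'a
  assumes "x\<^sub>0 \<in> hyp"
    and "kleinian_group G \<phi>"
    and "non_elementary G \<phi> x\<^sub>0"
    and "\<not> convex_cocompact G \<phi> x\<^sub>0"
  shows "hausdorff_dim hyp_boundary (visual_dist x\<^sub>0)
           (myrberg_limit_set G \<phi> x\<^sub>0 \<inter> sublinear_limit_set G \<phi> x\<^sub>0)
         = critical_exponent G \<phi> x\<^sub>0"
proof -
  interpret kleinian G \<phi> x\<^sub>0 by (rule kleinian.intro) fact+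
  show ?thesis
  proof (rule antisym)
    show "hausdorff_dim hyp_boundary (visual_dist x\<^sub>0)
        (myrberg_limit_set G \<phi> x\<^sub>0 \<inter> sublinear_limit_set G \<phi> x\<^sub>0) \<le> critical_exponent G \<phi> x\<^sub>0"
      by (rule hausdorff_dim_upper[OF infinite_carrier[OF assms(3)]]) (auto simp: sublinear_limit_set_def)
    show "critical_exponent G \<phi> x\<^sub>0 \<le> hausdorff_dim hyp_boundary (visual_dist x\<^sub>0)
        (myrberg_limit_set G \<phi> x\<^sub>0 \<inter> sublinear_limit_set G \<phi> x\<^sub>0)"
      by (rule hausdorff_dim_lower[OF assms(3)])
  qed
qed

end
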